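(* Let $\Lambda:E\times\mathbb{R}^d\times\Theta\to\mathbb{R}$ satisfy ($\Lambda$1)–($\Lambda$5) and let $\mathcal{I}:E\times\Theta\to[0,\infty]$ satisfy ($\mathcal{I}$1)–($\mathcal{I}$5) (all listed in the context). Let $\mathcal{H}:E\times\mathbb{R}^d\to\mathbb{R}$ be given by $$\mathcal{H}(x,p)=\sup_{\theta\in\Theta}\left[\Lambda(x,p,\theta)-\mathcal{I}(x,\theta)\right],$$ and define the operator $\mathbf{H}f(x):=\mathcal{H}(x,\nabla f(x))$ with domain $\mathcal{D}(\mathbf{H})=C_{cc}^\infty(E)$. Then: (a) For any $f\in\mathcal{D}(\mathbf{H})$ the map $x\mapsto\mathbf{H}f(x)$ is continuous. (b) For any $h\in C_b(E)$ and $\lambda>0$, the comparison principle holds for $f-\lambda\mathbf{H}f=h$; that is, for every viscosity subsolution $u$ and every viscosity supersolution $v$ of this equation, $u\le v$ on $E$.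
   Context: **Setting.** $E\subseteq\mathbb{R}^d$ is a Polish space contained in the $\mathbb{R}^d$-closure of its $\mathbb{R}^d$-interior (so gradients of functions on $E$ are determined by their values on $E$; $E$ need not be open). $\Theta$ is a Polish space. $C_b(E)$: bounded continuous functions. $C_{cc}^\infty(E)$: smooth functions on $E$ that are constant outside a compact subset of $E$. **Viscosity solutions.** Let $A:\mathcal{D}(A)\subseteq C_b(E)\to C_b(E)$, $\lambda>0$, $h\in C_b(E)$. A function $u:E\to\mathbb{R}$ is a (viscosity) subsolution of $f-\lambda Af=h$ if $u$ is bounded from above, upper semi-continuous, and for every $f\in\mathcal{D}(A)$ there is a sequence $x_n\in E$ with $\lim_n u(x_n)-f(x_n)=\sup_x u(x)-f(x)$ and $\lim_n u(x_n)-\lambda Af(x_n)-h(x_n)\le0$. A function $v:E\to\mathbb{R}$ is a (viscosity) supersolution if $v$ is bounded from below, lower semi-continuous, and for every $f\in\mathcal{D}(A)$ there is a sequence $x_n\in E$ with $\lim_n v(x_n)-f(x_n)=\inf_x v(x)-f(x)$ and $\lim_n v(x_n)-\lambda Af(x_n)-h(x_n)\ge0$. **Continuity estimate.** A penalization function is a $\Psi:E^2\to[0,\infty)$, $\Psi\in C^1(E^2)$, with $x=y$ if and only if $\Psi(x,y)=0$. Let $\mathcal{G}:E\times\mathbb{R}^d\times\Theta\to\mathbb{R}$. Suppose that for each $\varepsilon>0$ there is a sequence of positive reals $\alpha\to\infty$ (dependence on $\varepsilon$ suppressed) and for each $\varepsilon,\alpha$ there are $(x_{\varepsilon,\alpha},y_{\varepsilon,\alpha})\in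 E^2$ and $\theta_{\varepsilon,\alpha}\in\Theta$. The collection is *fundamental* for $\mathcal{G}$ with respect to $\Psi$ if: (C1) for each $\varepsilon$ there are compact $K_\varepsilon\subseteq E$, $\widehat K_\varepsilon\subseteq\Theta$ such that for all $\alpha$: $x_{\varepsilon,\alpha},y_{\varepsilon,\alpha}\in K_\varepsilon$, $\theta_{\varepsilon,\alpha}\in\widehat K_\varepsilon$; (C2) for each $\varepsilon$, $\lim_{\alpha\to\infty}\alpha\Psi(x_{\varepsilon,\alpha},y_{\varepsilon,\alpha})=0$, and for any limit point $(x_\varepsilon,y_\varepsilon)$ of $(x_{\varepsilon,\alpha},y_{\varepsilon,\alpha})$ we have $\Psi(x_\varepsilon,y_\varepsilon)=0$; (C3) for each $\varepsilon$, $\sup_\alpha\mathcal{G}(y_{\varepsilon,\alpha},-\alpha(\nabla\Psi(x_{\varepsilon,\alpha},\cdot))(y_{\varepsilon,\alpha}),\theta_{\varepsilon,\alpha})<\infty$ and $\inf_\alpha\mathcal{G}(x_{\varepsilon,\alpha},\alpha(\nabla\Psi(\cdot,y_{\varepsilon,\alpha}))(x_{\varepsilon,\alpha}),\theta_{\varepsilon,\alpha})>-\infty$. $\mathcal{G}$ satisfies the *continuity estimate* (with respect to $\Psi$) if for every fundamental collection and each $\varepsilon>0$ $$\liminf_{\alpha\to\infty}\mathcal{G}(x_{\varepsilon,\alpha},\alpha(\nabla\Psi(\cdot,y_{\varepsilon,\alpha}))(x_{\varepsilon,\alpha}),\theta_{\varepsilon,\alpha})-\mathcal{G}(y_{\varepsilon,\alpha},-\alpha(\nabla\Psi(x_{\varepsilon,\alpha},\cdot))(y_{\varepsilon,\alpha}),\theta_{\varepsilon,\alpha})\le0.$$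 **Extended continuity estimate.** A pair of penalization functions is $\{\Psi_1,\Psi_2\}$ with $\Psi_i:E^2\to[0,\infty)$, $\Psi_i\in C^1(E^2)$, such that $x=y$ if and only if $\Psi_1(x,y)=\Psi_2(x,y)=0$. Suppose that for each $\varepsilon>0$ there is a sequence $\alpha_2\to\infty$, and for each $\varepsilon$ and $\alpha_2$ a sequence $\alpha_1\to\infty$; write $\alpha=(\alpha_1,\alpha_2)$. Suppose for each $(\varepsilon,\alpha_1,\alpha_2)$ there are $(x_{\varepsilon,\alpha},y_{\varepsilon,\alpha})\in E^2$, $\theta_{\varepsilon,\alpha}\in\Theta$. The collection is *fundamental* for $\mathcal{G}$ with respect to $\{\Psi_1,\Psi_2\}$ if: (C1) for each $\varepsilon$ there are compact $K_\varepsilon\subseteq E$, $\widehat K_\varepsilon\subseteq\Theta$ such that for all $\alpha=(\alpha_1,\alpha_2)$: $x_{\varepsilon,\alpha},y_{\varepsilon,\alpha}\in K_\varepsilon$, $\theta_{\varepsilon,\alpha}\in\widehat K_\varepsilon$; (C2) for each $\varepsilon$ and $\alpha_2$ there are limit points $x_{\varepsilon,\alpha_2},y_{\varepsilon,\alpha_2}\in K_\varepsilon$ of $x_{\varepsilon,\alpha},y_{\varepsilon,\alpha}$ as $\alpha_1\to\infty$, and for each $\varepsilon$ limit points $x_\varepsilon,y_\varepsilon\in K_\varepsilon$ of $x_{\varepsilon,\alpha_2},y_{\varepsilon,\alpha_2}$ as $\alpha_2\to\infty$, such that for all $\varepsilon$ and $\alpha_2$: $\Psi_1(x_{\varepsilon,\alpha_2},y_{\varepsilon,\alpha_2})=0$,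 $\Psi_1(x_\varepsilon,y_\varepsilon)+\Psi_2(x_\varepsilon,y_\varepsilon)=0$, $\lim_{\alpha_1\to\infty}\alpha_1\Psi_1(x_{\varepsilon,\alpha},y_{\varepsilon,\alpha})=0$, $\lim_{\alpha_2\to\infty}\alpha_2\Psi_2(x_{\varepsilon,\alpha_2},y_{\varepsilon,\alpha_2})=0$; (C3) for each $\varepsilon$, $\sup_{\alpha_2}\sup_{\alpha_1}\mathcal{G}(y_{\varepsilon,\alpha},-\sum_{i=1}^2\alpha_i(\nabla\Psi_i(x_{\varepsilon,\alpha},\cdot))(y_{\varepsilon,\alpha}),\theta_{\varepsilon,\alpha})<\infty$ and $\inf_{\alpha_2}\inf_{\alpha_1}\mathcal{G}(x_{\varepsilon,\alpha},\sum_{i=1}^2\alpha_i(\nabla\Psi_i(\cdot,y_{\varepsilon,\alpha}))(x_{\varepsilon,\alpha}),\theta_{\varepsilon,\alpha})>-\infty$. $\mathcal{G}$ satisfies the continuity estimate in the extended sense (with respect to $\{\Psi_1,\Psi_2\}$) if for every such fundamental collection and each $\varepsilon>0$ $$\liminf_{\alpha_2\to\infty}\liminf_{\alpha_1\to\infty}\mathcal{G}\Big(x_{\varepsilon,\alpha},\sum_{i=1}^2\alpha_i\nabla\Psi_i(\cdot,y_{\varepsilon,\alpha})(x_{\varepsilon,\alpha}),\theta_{\varepsilon,\alpha}\Big)-\mathcal{G}\Big(y_{\varepsilon,\alpha},-\sum_{i=1}^2\alpha_i\nabla\Psi_i(x_{\varepsilon,\alpha},\cdot)(y_{\varepsilon,\alpha}),\theta_{\varepsilon,\alpha}\Big)\le0.$$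 **Assumptions on $\Lambda$.** ($\Lambda$1) $\Lambda:E\times\mathbb{R}^d\times\Theta\to\mathbb{R}$ is continuous. ($\Lambda$2) For all $x\in E,\theta\in\Theta$, $p\mapsto\Lambda(x,p,\theta)$ is convex and $\Lambda(x,0,\theta)=0$. ($\Lambda$3) There is a containment function for $\Lambda$: a function $\Upsilon:E\to[0,\infty)$, $\Upsilon\in C^1(E)$, such that $\{x:\Upsilon(x)\le c\}$ is compact for every $c\ge0$ and $\sup_\theta\sup_x\Lambda(x,\nabla\Upsilon(x),\theta)<\infty$. ($\Lambda$4) For every compact $K\subseteq E$ there are $M,C_1,C_2\ge0$ such that $\Lambda(x,p,\theta_1)\le\max\{M,C_1\Lambda(x,p,\theta_2)+C_2\}$ for all $x\in K$, $p\in\mathbb{R}^d$, $\theta_1,\theta_2\in\Theta$. ($\Lambda$5) $\Lambda$ satisfies the continuity estimate with respect to some penalization function, or the continuity estimate in the extended sense with respect to some pair of penalization functions. **Assumptions on $\mathcal{I}$.** For compact $K\subseteq E$, $M\ge0$ put $\Theta_{K,M}=\bigcup_{x\in K}\{\theta:\mathcal{I}(x,\theta)\le M\}$ and $\Omega_{K,M}=\bigcap_{x\in K}\{\theta:\mathcal{I}(x,\theta)\le M\}$. ($\mathcal{I}$1) $(x,\theta)\mapsto\mathcal{I}(x,\theta)$ is lower semi-continuous on $E\times\Theta$. ($\mathcal{I}$2) For any $x\in E$ there is $\theta_x^0\in\Theta$ with $\mathcal{I}(x,\theta_x^0)=0$. ($\mathcal{I}$3) For any compact $K\subseteq E$ and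 $M\ge0$ the set $\Theta_{K,M}$ is compact. ($\mathcal{I}$4) For each $x\in E$ and $M\ge0$ there are an open neighbourhood $U\subseteq E$ of $x$ and $M',C_1',C_2'\ge0$ such that $\mathcal{I}(y_1,\theta)\le\max\{M',C_1'\mathcal{I}(y_2,\theta)+C_2'\}$ for all $y_1,y_2\in U$ and $\theta\in\Theta_{\{x\},M}$. ($\mathcal{I}$5) For every compact $K\subseteq E$ and $M\ge0$ the collection $\{\mathcal{I}(\cdot,\theta)\}_{\theta\in\Omega_{K,M}}$ is equicontinuous on $K$: for all $\varepsilon>0$ there is $\delta>0$ such that for all $\theta\in\Omega_{K,M}$ and $x,y\in K$ with $d(x,y)\le\delta$, $|\mathcal{I}(x,\theta)-\mathcal{I}(y,\theta)|\le\varepsilon$. *)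

theory Defs
  imports "HOL-Analysis.Analysis"
begin

section \<open>Smooth functions and gradients on a subset of Euclidean space\<close>

primrec Ck_on :: "nat \<Rightarrow> ('a::euclidean_space \<Rightarrow> real) \<Rightarrow> 'a set \<Rightarrow> bool" where
  "Ck_on 0 F U \<longleftrightarrow> continuous_on U F"
| "Ck_on (Suc k) F U \<longleftrightarrow>
     (\<forall>x\<in>U. F differentiable (at x)) \<and> (\<forall>v. Ck_on k (\<lambda>x. frechet_derivative F (at x) v) U)"

text \<open>\<^const>\<open>Ck_on\<close> is only meaningful on open sets. On an arbitrary set \<open>E\<close>, a function is \<open>C\<^sup>1\<close>
  (smooth) if it is the restriction to \<open>E\<close> of a \<open>C\<^sup>1\<close> (smooth) function on an open neighbourhood
  of \<open>E\<close>. Functions on \<open>E\<close> are total functions whose values outside \<open>E\<close> are irrelevant.\<close>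

definition C1_extension :: "'a::euclidean_space set \<Rightarrow> ('a \<Rightarrow> real) \<Rightarrow> 'a set \<Rightarrow> ('a \<Rightarrow> real) \<Rightarrow> bool" where
  "C1_extension E f U F \<longleftrightarrow> open U \<and> E \<subseteq> U \<and> Ck_on 1 F U \<and> (\<forall>x\<in>E. F x = f x)"

definition C1 :: "'a::euclidean_space set \<Rightarrow> ('a \<Rightarrow> real) set" where
  "C1 E = {f. \<exists>U F. C1_extension E f U F}"

definition Cinf :: "'a::euclidean_space set \<Rightarrow> ('a \<Rightarrow> real) set" where
  "Cinf E = {f. \<exists>U F. open U \<and> E \<subseteq> U \<and> (\<forall>k. Ck_on k F U) \<and> (\<forall>x\<in>E. F x = f x)}"

definition Cb :: "'a::euclidean_space set \<Rightarrow> ('a \<Rightarrow> real) set" where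
  "Cb E = {f. continuous_on E f \<and> bounded (f ` E)}"

definition Ccc_inf :: "'a::euclidean_space set \<Rightarrow> ('a \<Rightarrow> real) set" where
  "Ccc_inf E = {f \<in> Cinf E. \<exists>K c. compact K \<and> K \<subseteq> E \<and> (\<forall>x\<in>E - K. f x = c)}"

text \<open>The gradient at \<open>x \<in> E\<close> of a \<open>C\<^sup>1\<close> function on \<open>E\<close>. By \<open>gradient_on_eq\<close> below it does not depend
  on the extension as soon as \<open>E \<subseteq> closure (interior E)\<close>.\<close>

definition gradient_on :: "'a::euclidean_space set \<Rightarrow> ('a \<Rightarrow> real) \<Rightarrow> 'a \<Rightarrow> 'a" where
  "gradient_on E f x = (THE g. \<exists>U F. C1_extension E f U F \<and> GDERIV F x :> g)"

lemma gradient_on_eq: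
  assumes E: "E \<subseteq> closure (interior E)" and x: "x \<in> E"
    and ext: "C1_extension E f U F" and g: "GDERIV F x :> g"
  shows "gradient_on E f x = g"
  unfolding gradient_on_def
proof (rule the_equality)
  show "\<exists>U F. C1_extension E f U F \<and> GDERIV F x :> g" using ext g by blast
next
  fix g' assume "\<exists>U F. C1_extension E f U F \<and> GDERIV F x :> g'"
  then obtain U' F' where ext': "C1_extension E f U' F'" and g': "GDERIV F' x :> g'" by blast
  have U: "open U" "E \<subseteq> U" "open U'" "E \<subseteq> U'" and eq: "\<And>z. z \<in> E \<Longrightarrow> F z = F' z"
    using ext ext' by (auto simp: C1_extension_def)
  have "v \<bullet> g = v \<bullet> g'" for v
  proof -
    define D where "D = (\<lambda>z. frechet_derivative F (at z) v - frechet_derivative F' (at z) v)"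
    have cont: "continuous_on (U \<inter> U') D"
      unfolding D_def using ext ext'
      by (intro continuous_on_diff; auto simp: C1_extension_def intro: continuous_on_subset)
    have zero: "D z = 0" if z: "z \<in> interior E" for z
    proof -
      have d: "F differentiable (at z)"
        using ext z U interior_subset by (fastforce simp: C1_extension_def)
      have "(F has_derivative frechet_derivative F (at z)) (at z)"
        using d frechet_derivative_works by blast
      then have "(F' has_derivative frechet_derivative F (at z)) (at z)"
        using has_derivative_transform_within_open[of F _ z UNIV "interior E" F'] z eq interior_subset
        by (metis open_interior subsetD)
      then show ?thesis
        unfolding D_def by (metis frechet_derivative_at diff_self)
    qed
    have "x \<in> closure (interior E)" using E x by blast
    then obtain s where s: "\<And>n. s n \<in> interior E" "s \<longlonglongrightarrow> x"
      unfolding closure_sequential by blast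
    have "(\<lambda>n. D (s n)) \<longlonglongrightarrow> D x"
      using x U s(1) interior_subset
      by (intro continuous_on_tendsto_compose[OF cont s(2)] always_eventually allI) blast+
    then have "D x = 0" using zero s(1) LIMSEQ_unique by (simp add: tendsto_const_iff)
    moreover have "frechet_derivative F (at x) v = v \<bullet> g" "frechet_derivative F' (at x) v = v \<bullet> g'"
      using g g' unfolding gderiv_def by (metis frechet_derivative_at)+
    ultimately show ?thesis by (simp add: D_def)
  qed
  then show "g' = g" by (metis vector_eq_ldot)
qed

definition lsc_on :: "'a::topological_space set \<Rightarrow> ('a \<Rightarrow> 'b::linorder) \<Rightarrow> bool" where
  "lsc_on S f \<longleftrightarrow> (\<forall>c. openin (top_of_set S) {x\<in>S. c < f x})"

definition usc_on :: "'a::topological_space set \<Rightarrow> ('a \<Rightarrow> 'b::linorder) \<Rightarrow> bool" where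
  "usc_on S f \<longleftrightarrow> (\<forall>c. openin (top_of_set S) {x\<in>S. f x < c})"


section \<open>Viscosity solutions of \<open>f - \<lambda> A f = h\<close>\<close>

text \<open>\<open>D\<close> is the domain of the operator \<open>A\<close>.\<close>

definition viscosity_subsolution ::
  "'a::euclidean_space set \<Rightarrow> ('a \<Rightarrow> real) set \<Rightarrow> (('a \<Rightarrow> real) \<Rightarrow> 'a \<Rightarrow> real) \<Rightarrow> real \<Rightarrow> ('a \<Rightarrow> real)
    \<Rightarrow> ('a \<Rightarrow> real) \<Rightarrow> bool" where
  "viscosity_subsolution E D A lam h u \<longleftrightarrow>
     bdd_above (u ` E) \<and> usc_on E u \<and>
     (\<forall>f\<in>D. \<exists>x. (\<forall>n. x n \<in> E) \<and>
        (\<lambda>n. u (x n) - f (x n)) \<longlonglongrightarrow> (SUP z\<in>E. u z - f z) \<and>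
        (\<exists>L\<le>0. (\<lambda>n. u (x n) - lam * A f (x n) - h (x n)) \<longlonglongrightarrow> L))"

definition viscosity_supersolution ::
  "'a::euclidean_space set \<Rightarrow> ('a \<Rightarrow> real) set \<Rightarrow> (('a \<Rightarrow> real) \<Rightarrow> 'a \<Rightarrow> real) \<Rightarrow> real \<Rightarrow> ('a \<Rightarrow> real)
    \<Rightarrow> ('a \<Rightarrow> real) \<Rightarrow> bool" where
  "viscosity_supersolution E D A lam h v \<longleftrightarrow>
     bdd_below (v ` E) \<and> lsc_on E v \<and>
     (\<forall>f\<in>D. \<exists>x. (\<forall>n. x n \<in> E) \<and>
        (\<lambda>n. v (x n) - f (x n)) \<longlonglongrightarrow> (INF z\<in>E. v z - f z) \<and>
        (\<exists>L\<ge>0. (\<lambda>n. v (x n) - lam * A f (x n) - h (x n)) \<longlonglongrightarrow> L))"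

definition comparison_principle ::
  "'a::euclidean_space set \<Rightarrow> ('a \<Rightarrow> real) set \<Rightarrow> (('a \<Rightarrow> real) \<Rightarrow> 'a \<Rightarrow> real) \<Rightarrow> real \<Rightarrow> ('a \<Rightarrow> real)
    \<Rightarrow> bool" where
  "comparison_principle E D A lam h \<longleftrightarrow>
     (\<forall>u v. viscosity_subsolution E D A lam h u \<longrightarrow> viscosity_supersolution E D A lam h v \<longrightarrow>
        (\<forall>x\<in>E. u x \<le> v x))"


section \<open>The continuity estimate\<close>

definition seq_limit_point :: "(nat \<Rightarrow> 'a::topological_space) \<Rightarrow> 'a \<Rightarrow> bool" where
  "seq_limit_point s l \<longleftrightarrow> (\<exists>r. strict_mono r \<and> (s \<circ> r) \<longlonglongrightarrow> l)"

definition penalization :: "'a::euclidean_space set \<Rightarrow> ('a \<Rightarrow> 'a \<Rightarrow> real) \<Rightarrow> bool" where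
  "penalization E \<Psi> \<longleftrightarrow>
     (\<lambda>(x, y). \<Psi> x y) \<in> C1 (E \<times> E) \<and>
     (\<forall>x\<in>E. \<forall>y\<in>E. 0 \<le> \<Psi> x y) \<and>
     (\<forall>x\<in>E. \<forall>y\<in>E. x = y \<longleftrightarrow> \<Psi> x y = 0)"

definition penalization_pair ::
  "'a::euclidean_space set \<Rightarrow> ('a \<Rightarrow> 'a \<Rightarrow> real) \<Rightarrow> ('a \<Rightarrow> 'a \<Rightarrow> real) \<Rightarrow> bool" where
  "penalization_pair E \<Psi>\<^sub>1 \<Psi>\<^sub>2 \<longleftrightarrow>
     (\<forall>\<Psi>\<in>{\<Psi>\<^sub>1, \<Psi>\<^sub>2}. (\<lambda>(x, y). \<Psi> x y) \<in> C1 (E \<times> E) \<and> (\<forall>x\<in>E. \<forall>y\<in>E. 0 \<le> \<Psi> x y)) \<and>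
     (\<forall>x\<in>E. \<forall>y\<in>E. x = y \<longleftrightarrow> \<Psi>\<^sub>1 x y = 0 \<and> \<Psi>\<^sub>2 x y = 0)"

text \<open>\<open>(\<nabla>\<Psi>(\<cdot>,y))(x)\<close> and \<open>(\<nabla>\<Psi>(x,\<cdot>))(y)\<close>.\<close>

definition grad1 :: "'a::euclidean_space set \<Rightarrow> ('a \<Rightarrow> 'a \<Rightarrow> real) \<Rightarrow> 'a \<Rightarrow> 'a \<Rightarrow> 'a" where
  "grad1 E \<Psi> x y = gradient_on E (\<lambda>z. \<Psi> z y) x"

definition grad2 :: "'a::euclidean_space set \<Rightarrow> ('a \<Rightarrow> 'a \<Rightarrow> real) \<Rightarrow> 'a \<Rightarrow> 'a \<Rightarrow> 'a" where
  "grad2 E \<Psi> x y = gradient_on E (\<lambda>z. \<Psi> x z) y"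

text \<open>\<open>a \<epsilon>\<close> enumerates the sequence of \<open>\<alpha>\<close>'s belonging to \<open>\<epsilon>\<close>; the points \<open>x\<close>, \<open>y\<close>, \<open>\<theta>\<close> are indexed
  by \<open>\<epsilon>\<close> and the value of \<open>\<alpha>\<close>, and only matter at the values \<open>\<alpha> = a \<epsilon> n\<close>.\<close>

definition fundamental ::
  "'a::euclidean_space set \<Rightarrow> ('a \<Rightarrow> 'a \<Rightarrow> real) \<Rightarrow> ('a \<Rightarrow> 'a \<Rightarrow> 't::topological_space \<Rightarrow> real)
    \<Rightarrow> (real \<Rightarrow> nat \<Rightarrow> real) \<Rightarrow> (real \<Rightarrow> real \<Rightarrow> 'a) \<Rightarrow> (real \<Rightarrow> real \<Rightarrow> 'a) \<Rightarrow> (real \<Rightarrow> real \<Rightarrow> 't)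
    \<Rightarrow> bool" where
  "fundamental E \<Psi> G a x y \<theta> \<longleftrightarrow>
   (\<forall>\<epsilon>>0.
     (\<forall>n. 0 < a \<epsilon> n) \<and> filterlim (a \<epsilon>) at_top sequentially \<and>
     (\<exists>K K'. compact K \<and> K \<subseteq> E \<and> compact K' \<and>
        (\<forall>n. x \<epsilon> (a \<epsilon> n) \<in> K \<and> y \<epsilon> (a \<epsilon> n) \<in> K \<and> \<theta> \<epsilon> (a \<epsilon> n) \<in> K')) \<and>
     (\<lambda>n. a \<epsilon> n * \<Psi> (x \<epsilon> (a \<epsilon> n)) (y \<epsilon> (a \<epsilon> n))) \<longlonglongrightarrow> 0 \<and>
     (\<forall>x\<^sub>0 y\<^sub>0. seq_limit_point (\<lambda>n. (x \<epsilon> (a \<epsilon> n), y \<epsilon> (a \<epsilon> n))) (x\<^sub>0, y\<^sub>0) \<longrightarrow> \<Psi> x\<^sub>0 y\<^sub>0 = 0) \<and>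
     (SUP \<alpha>\<in>range (a \<epsilon>).
        ereal (G (y \<epsilon> \<alpha>) (- (\<alpha> *\<^sub>R grad2 E \<Psi> (x \<epsilon> \<alpha>) (y \<epsilon> \<alpha>))) (\<theta> \<epsilon> \<alpha>))) < \<infinity> \<and>
     (INF \<alpha>\<in>range (a \<epsilon>).
        ereal (G (x \<epsilon> \<alpha>) (\<alpha> *\<^sub>R grad1 E \<Psi> (x \<epsilon> \<alpha>) (y \<epsilon> \<alpha>)) (\<theta> \<epsilon> \<alpha>))) > - \<infinity>)"

definition continuity_estimate ::
  "'a::euclidean_space set \<Rightarrow> ('a \<Rightarrow> 'a \<Rightarrow> real) \<Rightarrow> ('a \<Rightarrow> 'a \<Rightarrow> 't::topological_space \<Rightarrow> real)
    \<Rightarrow> bool" where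
  "continuity_estimate E \<Psi> G \<longleftrightarrow>
   (\<forall>a x y \<theta>. fundamental E \<Psi> G a x y \<theta> \<longrightarrow>
     (\<forall>\<epsilon>>0. liminf (\<lambda>n. let \<alpha> = a \<epsilon> n in ereal
        (G (x \<epsilon> \<alpha>) (\<alpha> *\<^sub>R grad1 E \<Psi> (x \<epsilon> \<alpha>) (y \<epsilon> \<alpha>)) (\<theta> \<epsilon> \<alpha>)
         - G (y \<epsilon> \<alpha>) (- (\<alpha> *\<^sub>R grad2 E \<Psi> (x \<epsilon> \<alpha>) (y \<epsilon> \<alpha>))) (\<theta> \<epsilon> \<alpha>))) \<le> 0))"

text \<open>\<open>\<Sum>\<^sub>i \<alpha>\<^sub>i (\<nabla>\<Psi>\<^sub>i(\<cdot>,y))(x)\<close> and \<open>\<Sum>\<^sub>i \<alpha>\<^sub>i (\<nabla>\<Psi>\<^sub>i(x,\<cdot>))(y)\<close>.\<close>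

definition pair_grad1 ::
  "'a::euclidean_space set \<Rightarrow> ('a \<Rightarrow> 'a \<Rightarrow> real) \<Rightarrow> ('a \<Rightarrow> 'a \<Rightarrow> real) \<Rightarrow> real \<Rightarrow> real \<Rightarrow> 'a \<Rightarrow> 'a \<Rightarrow> 'a" where
  "pair_grad1 E \<Psi>\<^sub>1 \<Psi>\<^sub>2 \<alpha>\<^sub>1 \<alpha>\<^sub>2 x y = \<alpha>\<^sub>1 *\<^sub>R grad1 E \<Psi>\<^sub>1 x y + \<alpha>\<^sub>2 *\<^sub>R grad1 E \<Psi>\<^sub>2 x y"

definition pair_grad2 ::
  "'a::euclidean_space set \<Rightarrow> ('a \<Rightarrow> 'a \<Rightarrow> real) \<Rightarrow> ('a \<Rightarrow> 'a \<Rightarrow> real) \<Rightarrow> real \<Rightarrow> real \<Rightarrow> 'a \<Rightarrow> 'a \<Rightarrow> 'a" where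
  "pair_grad2 E \<Psi>\<^sub>1 \<Psi>\<^sub>2 \<alpha>\<^sub>1 \<alpha>\<^sub>2 x y = \<alpha>\<^sub>1 *\<^sub>R grad2 E \<Psi>\<^sub>1 x y + \<alpha>\<^sub>2 *\<^sub>R grad2 E \<Psi>\<^sub>2 x y"

text \<open>\<open>b \<epsilon>\<close> enumerates the \<open>\<alpha>\<^sub>2\<close>'s belonging to \<open>\<epsilon>\<close> and \<open>a \<epsilon> \<alpha>\<^sub>2\<close> the \<open>\<alpha>\<^sub>1\<close>'s belonging to \<open>\<epsilon>\<close> and \<open>\<alpha>\<^sub>2\<close>;
  the points are indexed in the order \<open>\<epsilon>, \<alpha>\<^sub>1, \<alpha>\<^sub>2\<close>. The limit points \<open>xl \<alpha>\<^sub>2\<close>, \<open>yl \<alpha>\<^sub>2\<close> (and \<open>x\<^sub>0\<close>, \<open>y\<^sub>0\<close>)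
  are limit points of the pairs, that is, reached along a common subsequence.\<close>

definition fundamental_ext ::
  "'a::euclidean_space set \<Rightarrow> ('a \<Rightarrow> 'a \<Rightarrow> real) \<Rightarrow> ('a \<Rightarrow> 'a \<Rightarrow> real)
    \<Rightarrow> ('a \<Rightarrow> 'a \<Rightarrow> 't::topological_space \<Rightarrow> real)
    \<Rightarrow> (real \<Rightarrow> real \<Rightarrow> nat \<Rightarrow> real) \<Rightarrow> (real \<Rightarrow> nat \<Rightarrow> real)
    \<Rightarrow> (real \<Rightarrow> real \<Rightarrow> real \<Rightarrow> 'a) \<Rightarrow> (real \<Rightarrow> real \<Rightarrow> real \<Rightarrow> 'a) \<Rightarrow> (real \<Rightarrow> real \<Rightarrow> real \<Rightarrow> 't)
    \<Rightarrow> bool" where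
  "fundamental_ext E \<Psi>\<^sub>1 \<Psi>\<^sub>2 G a b x y \<theta> \<longleftrightarrow>
   (\<forall>\<epsilon>>0.
     filterlim (b \<epsilon>) at_top sequentially \<and>
     (\<forall>\<alpha>\<^sub>2\<in>range (b \<epsilon>). filterlim (a \<epsilon> \<alpha>\<^sub>2) at_top sequentially) \<and>
     (\<exists>K K'. compact K \<and> K \<subseteq> E \<and> compact K' \<and>
        (\<forall>\<alpha>\<^sub>2\<in>range (b \<epsilon>). \<forall>\<alpha>\<^sub>1\<in>range (a \<epsilon> \<alpha>\<^sub>2).
           x \<epsilon> \<alpha>\<^sub>1 \<alpha>\<^sub>2 \<in> K \<and> y \<epsilon> \<alpha>\<^sub>1 \<alpha>\<^sub>2 \<in> K \<and> \<theta> \<epsilon> \<alpha>\<^sub>1 \<alpha>\<^sub>2 \<in> K') \<and>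
        (\<exists>xl yl. \<exists>x\<^sub>0\<in>K. \<exists>y\<^sub>0\<in>K.
           (\<forall>\<alpha>\<^sub>2\<in>range (b \<epsilon>). xl \<alpha>\<^sub>2 \<in> K \<and> yl \<alpha>\<^sub>2 \<in> K \<and>
              seq_limit_point (\<lambda>n. (x \<epsilon> (a \<epsilon> \<alpha>\<^sub>2 n) \<alpha>\<^sub>2, y \<epsilon> (a \<epsilon> \<alpha>\<^sub>2 n) \<alpha>\<^sub>2)) (xl \<alpha>\<^sub>2, yl \<alpha>\<^sub>2) \<and>
              \<Psi>\<^sub>1 (xl \<alpha>\<^sub>2) (yl \<alpha>\<^sub>2) = 0 \<and>
              (\<lambda>n. a \<epsilon> \<alpha>\<^sub>2 n * \<Psi>\<^sub>1 (x \<epsilon> (a \<epsilon> \<alpha>\<^sub>2 n) \<alpha>\<^sub>2) (y \<epsilon> (a \<epsilon> \<alpha>\<^sub>2 n) \<alpha>\<^sub>2)) \<longlonglongrightarrow> 0) \<and>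
           seq_limit_point (\<lambda>m. (xl (b \<epsilon> m), yl (b \<epsilon> m))) (x\<^sub>0, y\<^sub>0) \<and>
           \<Psi>\<^sub>1 x\<^sub>0 y\<^sub>0 + \<Psi>\<^sub>2 x\<^sub>0 y\<^sub>0 = 0 \<and>
           (\<lambda>m. b \<epsilon> m * \<Psi>\<^sub>2 (xl (b \<epsilon> m)) (yl (b \<epsilon> m))) \<longlonglongrightarrow> 0)) \<and>
     (SUP \<alpha>\<^sub>2\<in>range (b \<epsilon>). SUP \<alpha>\<^sub>1\<in>range (a \<epsilon> \<alpha>\<^sub>2).
        ereal (G (y \<epsilon> \<alpha>\<^sub>1 \<alpha>\<^sub>2)
          (- pair_grad2 E \<Psi>\<^sub>1 \<Psi>\<^sub>2 \<alpha>\<^sub>1 \<alpha>\<^sub>2 (x \<epsilon> \<alpha>\<^sub>1 \<alpha>\<^sub>2) (y \<epsilon> \<alpha>\<^sub>1 \<alpha>\<^sub>2)) (\<theta> \<epsilon> \<alpha>\<^sub>1 \<alpha>\<^sub>2))) < \<infinity> \<and>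
     (INF \<alpha>\<^sub>2\<in>range (b \<epsilon>). INF \<alpha>\<^sub>1\<in>range (a \<epsilon> \<alpha>\<^sub>2).
        ereal (G (x \<epsilon> \<alpha>\<^sub>1 \<alpha>\<^sub>2)
          (pair_grad1 E \<Psi>\<^sub>1 \<Psi>\<^sub>2 \<alpha>\<^sub>1 \<alpha>\<^sub>2 (x \<epsilon> \<alpha>\<^sub>1 \<alpha>\<^sub>2) (y \<epsilon> \<alpha>\<^sub>1 \<alpha>\<^sub>2)) (\<theta> \<epsilon> \<alpha>\<^sub>1 \<alpha>\<^sub>2))) > - \<infinity>)"

definition continuity_estimate_ext ::
  "'a::euclidean_space set \<Rightarrow> ('a \<Rightarrow> 'a \<Rightarrow> real) \<Rightarrow> ('a \<Rightarrow> 'a \<Rightarrow> real)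
    \<Rightarrow> ('a \<Rightarrow> 'a \<Rightarrow> 't::topological_space \<Rightarrow> real) \<Rightarrow> bool" where
  "continuity_estimate_ext E \<Psi>\<^sub>1 \<Psi>\<^sub>2 G \<longleftrightarrow>
   (\<forall>a b x y \<theta>. fundamental_ext E \<Psi>\<^sub>1 \<Psi>\<^sub>2 G a b x y \<theta> \<longrightarrow>
     (\<forall>\<epsilon>>0. liminf (\<lambda>m. liminf (\<lambda>n. let \<alpha>\<^sub>2 = b \<epsilon> m; \<alpha>\<^sub>1 = a \<epsilon> \<alpha>\<^sub>2 n in ereal
        (G (x \<epsilon> \<alpha>\<^sub>1 \<alpha>\<^sub>2)
           (pair_grad1 E \<Psi>\<^sub>1 \<Psi>\<^sub>2 \<alpha>\<^sub>1 \<alpha>\<^sub>2 (x \<epsilon> \<alpha>\<^sub>1 \<alpha>\<^sub>2) (y \<epsilon> \<alpha>\<^sub>1 \<alpha>\<^sub>2)) (\<theta> \<epsilon> \<alpha>\<^sub>1 \<alpha>\<^sub>2)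
         - G (y \<epsilon> \<alpha>\<^sub>1 \<alpha>\<^sub>2)
           (- pair_grad2 E \<Psi>\<^sub>1 \<Psi>\<^sub>2 \<alpha>\<^sub>1 \<alpha>\<^sub>2 (x \<epsilon> \<alpha>\<^sub>1 \<alpha>\<^sub>2) (y \<epsilon> \<alpha>\<^sub>1 \<alpha>\<^sub>2)) (\<theta> \<epsilon> \<alpha>\<^sub>1 \<alpha>\<^sub>2)))) \<le> 0))"


section \<open>Internal Hamiltonian, cost function and the Hamilton--Jacobi--Bellman operator\<close>

definition containment_function ::
  "'a::euclidean_space set \<Rightarrow> ('a \<Rightarrow> 'a \<Rightarrow> 't \<Rightarrow> real) \<Rightarrow> ('a \<Rightarrow> real) \<Rightarrow> bool" where
  "containment_function E \<Lambda> \<Upsilon> \<longleftrightarrow>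
     \<Upsilon> \<in> C1 E \<and> (\<forall>x\<in>E. 0 \<le> \<Upsilon> x) \<and>
     (\<forall>c\<ge>0. compact {x\<in>E. \<Upsilon> x \<le> c}) \<and>
     (SUP \<theta>. SUP x\<in>E. ereal (\<Lambda> x (gradient_on E \<Upsilon> x) \<theta>)) < \<infinity>"

definition Theta_set :: "('a \<Rightarrow> 't \<Rightarrow> ennreal) \<Rightarrow> 'a set \<Rightarrow> real \<Rightarrow> 't set" where
  "Theta_set \<I> K M = (\<Union>x\<in>K. {\<theta>. \<I> x \<theta> \<le> ennreal M})"

definition Omega_set :: "('a \<Rightarrow> 't \<Rightarrow> ennreal) \<Rightarrow> 'a set \<Rightarrow> real \<Rightarrow> 't set" where
  "Omega_set \<I> K M = (\<Inter>x\<in>K. {\<theta>. \<I> x \<theta> \<le> ennreal M})"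

text \<open>The supremum is formed in the extended reals, where \<open>\<Lambda> - \<infinity> = -\<infinity>\<close>.\<close>

definition Ham_ereal :: "('a \<Rightarrow> 'a \<Rightarrow> 't \<Rightarrow> real) \<Rightarrow> ('a \<Rightarrow> 't \<Rightarrow> ennreal) \<Rightarrow> 'a \<Rightarrow> 'a \<Rightarrow> ereal" where
  "Ham_ereal \<Lambda> \<I> x p = (SUP \<theta>. ereal (\<Lambda> x p \<theta>) - enn2ereal (\<I> x \<theta>))"

definition Ham :: "('a \<Rightarrow> 'a \<Rightarrow> 't \<Rightarrow> real) \<Rightarrow> ('a \<Rightarrow> 't \<Rightarrow> ennreal) \<Rightarrow> 'a \<Rightarrow> 'a \<Rightarrow> real" where
  "Ham \<Lambda> \<I> x p = real_of_ereal (Ham_ereal \<Lambda> \<I> x p)"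

definition Ham_op ::
  "'a::euclidean_space set \<Rightarrow> ('a \<Rightarrow> 'a \<Rightarrow> 't \<Rightarrow> real) \<Rightarrow> ('a \<Rightarrow> 't \<Rightarrow> ennreal)
    \<Rightarrow> ('a \<Rightarrow> real) \<Rightarrow> 'a \<Rightarrow> real" where
  "Ham_op E \<Lambda> \<I> f = (\<lambda>x. Ham \<Lambda> \<I> x (gradient_on E f x))"

end

(* Proof idea. Given a subsolution u and a supersolution v, one would like to double the variables and
   compare the Hamiltonian at x with the one at a nearby y, using a near-optimal theta at x. Hypothesis I4
   only compares the costs at x and y for those theta whose cost at the point x itself is bounded, on a
   neighbourhood of x whose size is not uniform in x, so x must stay fixed while the penalization
   parameters tend to infinity. We therefore do not double once. Let g_k be the inf-convolution of v with the
   k-th penalty; for fixed x, the loss in the comparison at x through g_k is small for all large k. The set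
   A_k of the points x where it is not small is closed, and each x lies in only finitely many A_k, so by
   Simons' inequality some convex combination of the indicators of the A_k is uniformly small. Let w be its
   weights. At a maximum of u - sum_k w_k g_k (perturbed by the containment function) convexity of the
   Hamiltonian splits the test gradient into those of the g_k, and the few bad k carry little weight.

   Each penalty is a minimum over finitely many scalings 2^l alpha Psi with decreasing costs (N - l) d; this
   makes alpha Psi small at the active pairs without passing to a limit. *)

theory Submission
  imports Defs
begin

subsection \<open>Semicontinuous functions on compact sets\<close>

text \<open>The indicators of the \<open>A_k\<close> tend to 0 pointwise but not uniformly. For
  continuous functions Mazur's lemma would restore uniformity by averaging; indicators of closed
  sets are only upper semicontinuous, hence Simons' inequality. Averaging is affordable on the side
  of \<open>u\<close> only: each \<open>g_k\<close> is an infimum of smooth functions of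
  \<open>x\<close>, so it has a superjet at every point, these add up to a superjet of
  \<open>u\<close> at the maximum, and convexity acts in the right direction. On the side of
  \<open>v\<close> each \<open>g_k\<close> keeps its own minimiser \<open>y\<close>. As
  \<open>x\<close> is not sent to a limit, the continuity estimates are recast, by contradiction, as
  statements about fixed large parameters. The containment function has weight \<epsilon>; the
  divisors \<open>1 - \<epsilon>\<close> and \<open>1 + \<epsilon>\<close> make test gradients
  convex combinations with its gradient, at the price of the difference between
  \<open>h / (1 - \<epsilon>)\<close> and \<open>h / (1 + \<epsilon>)\<close>, which vanishes with
  \<epsilon>. Since functions of the domain are constant outside a compact set, the viscosity
  inequalities are extended to first-order jets.\<close>

lemma closed_superlevel_attains_max:
  fixes f :: "'a::topological_space \<Rightarrow> real"
  assumes K: "compact K" "K \<noteq> {}" and cl: "\<And>q. closed {x\<in>K. q \<le> f x}"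
  shows "\<exists>x\<in>K. \<forall>y\<in>K. f y \<le> f x"
proof (rule ccontr)
  assume "\<not> ?thesis"
  then have ex: "\<forall>x\<in>K. \<exists>y\<in>K. f x < f y" by (meson not_le)
  have cover: "K \<subseteq> (\<Union>y\<in>K. - {x\<in>K. f y \<le> f x})"
  proof
    fix x assume "x \<in> K"
    then obtain y where "y \<in> K" "f x < f y" using ex by blast
    then show "x \<in> (\<Union>y\<in>K. - {x\<in>K. f y \<le> f x})" by (intro UN_I[of y]) auto
  qed
  obtain D where D: "D \<subseteq> K" "finite D" "K \<subseteq> (\<Union>y\<in>D. - {x\<in>K. f y \<le> f x})"
    by (rule compactE_image[OF K(1) _ cover]) (simp add: cl open_Compl, rule that)
  have "D \<noteq> {}" using D K by auto
  then have "Max (f ` D) \<in> f ` D" using D(2) by (intro Max_in) auto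
  then obtain y where y: "y \<in> D" "f y = Max (f ` D)" by auto
  have "y \<in> K" using y(1) D(1) by blast
  from subsetD[OF D(3) this] obtain z where "z \<in> D" "y \<in> - {x\<in>K. f z \<le> f x}" by (rule UN_E)
  then have z: "z \<in> D" "f y < f z" using \<open>y \<in> K\<close> by auto
  then show False using D(2) y by (metis Max_ge finite_imageI imageI not_le)
qed

text \<open>If \<open>f x + g x < q\<close>, some \<open>r\<close> has \<open>f x < r\<close> and
  \<open>g x < q - r\<close>. Hence the superlevel set of the sum is an intersection over
  \<open>r\<close> of unions of two closed sets.\<close>

lemma closed_superlevel_add:
  fixes f g :: "'a::t2_space \<Rightarrow> real"
  assumes K: "compact K" and "\<And>q. closed {x\<in>K. q \<le> f x}" "\<And>q. closed {x\<in>K. q \<le> g x}"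
  shows "closed {x\<in>K. q \<le> f x + g x}"
proof -
  have *: "q \<le> a + b" if "\<forall>r. r \<le> a \<or> q - r \<le> b" for a b :: real
  proof (rule ccontr)
    assume "\<not> q \<le> a + b"
    \<comment> \<open>The midpoint of \<open>a\<close> and \<open>q - b\<close> is a threshold that
      violates both alternatives.\<close>
    moreover have "(a + q - b) / 2 \<le> a \<or> q - (a + q - b) / 2 \<le> b" using that by blast
    ultimately show False by (auto simp: field_simps)
  qed
  have "{x\<in>K. q \<le> f x + g x} = K \<inter> (\<Inter>r. {x\<in>K. r \<le> f x} \<union> {x\<in>K. q - r \<le> g x})"
    by (auto intro: *)
  moreover have "closed (K \<inter> (\<Inter>r. {x\<in>K. r \<le> f x} \<union> {x\<in>K. q - r \<le> g x}))"
    by (intro closed_Int closed_INT ballI closed_Un compact_imp_closed assms)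
  ultimately show ?thesis by simp
qed

text \<open>The map \<pi> lets \<open>v\<close> be evaluated at one coordinate only: the identity
  serves maxima over a compact set, the second projection serves sets of pairs. Everything
  continuous is collected in \<open>c\<close>, since \<open>v\<close> itself is merely lower
  semicontinuous.\<close>

lemma lsc_on_closed_sublevel:
  fixes v :: "'b::metric_space \<Rightarrow> real" and c :: "'a::metric_space \<Rightarrow> real"
  assumes v: "lsc_on E v" and S: "closed S" "\<pi> ` S \<subseteq> E" and \<pi>: "continuous_on S \<pi>"
    and c: "continuous_on S c"
  shows "closed {z\<in>S. v (\<pi> z) \<le> c z}"
  unfolding closed_sequential_limits
proof (intro allI impI, elim conjE)
  fix z l assume z: "\<forall>n. z n \<in> {z\<in>S. v (\<pi> z) \<le> c z}" and lim: "z \<longlonglongrightarrow> l"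
  have l: "l \<in> S" using S(1) z lim unfolding closed_sequential_limits by blast
  moreover have "v (\<pi> l) \<le> c l"
  proof (rule ccontr)
    assume "\<not> v (\<pi> l) \<le> c l"
    then obtain q where q: "c l < q" "q < v (\<pi> l)" using dense by (meson not_le)
    obtain T where T: "open T" "{y\<in>E. q < v y} = E \<inter> T"
      using v unfolding lsc_on_def by (meson openin_open)
    have p: "(\<lambda>n. \<pi> (z n)) \<longlonglongrightarrow> \<pi> l"
      using z by (intro continuous_on_tendsto_compose[OF \<pi> lim l]) auto
    have "(\<lambda>n. c (z n)) \<longlonglongrightarrow> c l"
      using z by (intro continuous_on_tendsto_compose[OF c lim l]) auto
    then have "\<forall>\<^sub>F n in sequentially. c (z n) < q" using q(1) by (rule order_tendstoD)
    moreover have "\<pi> l \<in> T" using T q l S by blast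
    then have "\<forall>\<^sub>F n in sequentially. \<pi> (z n) \<in> T" using p T(1) by (simp add: topological_tendstoD)
    ultimately have "\<forall>\<^sub>F n in sequentially. c (z n) < q \<and> \<pi> (z n) \<in> T" by eventually_elim auto
    then obtain n where n: "c (z n) < q" "\<pi> (z n) \<in> T" by (auto simp: eventually_sequentially)
    have "\<pi> (z n) \<in> E" using z S by blast
    then have "q < v (\<pi> (z n))" using T(2) n(2) by blast
    moreover have "v (\<pi> (z n)) \<le> c (z n)" using z by blast
    ultimately show False using n(1) by linarith
  qed
  ultimately show "l \<in> {z\<in>S. v (\<pi> z) \<le> c z}" by simp
qed

lemma usc_on_uminus:
  fixes u :: "'a::topological_space \<Rightarrow> real"
  assumes "usc_on E u" shows "lsc_on E (\<lambda>x. - u x)"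
  unfolding lsc_on_def
proof
  fix c
  have "{x\<in>E. c < - u x} = {x\<in>E. u x < - c}" by auto
  then show "openin (top_of_set E) {x\<in>E. c < - u x}" using assms unfolding usc_on_def by simp
qed

lemma lsc_on_uminus:
  fixes v :: "'a::topological_space \<Rightarrow> real"
  assumes "lsc_on E v" shows "usc_on E (\<lambda>x. - v x)"
  unfolding usc_on_def
proof
  fix c
  have "{x\<in>E. - v x < c} = {x\<in>E. - c < v x}" by auto
  then show "openin (top_of_set E) {x\<in>E. - v x < c}" using assms unfolding lsc_on_def by simp
qed

lemma usc_on_attains_max:
  fixes u c :: "'a::metric_space \<Rightarrow> real"
  assumes u: "usc_on E u" and K: "compact K" "K \<subseteq> E" "K \<noteq> {}" and c: "continuous_on K c"
  shows "\<exists>x\<in>K. \<forall>y\<in>K. u y + c y \<le> u x + c x"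
proof (rule closed_superlevel_attains_max[OF K(1,3)])
  fix q
  have "closed {x\<in>K. - u (id x) \<le> c x - q}"
    by (rule lsc_on_closed_sublevel[OF usc_on_uminus[OF u]])
      (use K c in \<open>auto intro: compact_imp_closed continuous_intros\<close>)
  moreover have "{x\<in>K. - u (id x) \<le> c x - q} = {x\<in>K. q \<le> u x + c x}" by auto
  ultimately show "closed {x\<in>K. q \<le> u x + c x}" by simp
qed

lemma lsc_on_attains_min:
  fixes v c :: "'a::metric_space \<Rightarrow> real"
  assumes v: "lsc_on E v" and K: "compact K" "K \<subseteq> E" "K \<noteq> {}" and c: "continuous_on K c"
  shows "\<exists>x\<in>K. \<forall>y\<in>K. v x + c x \<le> v y + c y"
proof -
  obtain x where x: "x \<in> K" "\<forall>y\<in>K. - v y + - c y \<le> - v x + - c x"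
    using usc_on_attains_max[OF lsc_on_uminus[OF v] K continuous_on_minus[OF c]] by blast
  have "v x + c x \<le> v y + c y" if "y \<in> K" for y using x(2) that by force
  then show ?thesis using x(1) by blast
qed

subsection \<open>Convex combinations of indicators of closed sets\<close>

text \<open>Convex hull of the tail of the sequence, generated by binary mixtures so that range,
  positivity and semicontinuity pass to it by induction. Explicit weights are recovered in
  \<open>tail_conv_weights\<close>.\<close>

inductive_set tail_conv :: "(nat \<Rightarrow> 'a \<Rightarrow> real) \<Rightarrow> nat \<Rightarrow> ('a \<Rightarrow> real) set" for f n where
  base: "n \<le> k \<Longrightarrow> f k \<in> tail_conv f n"
| mix: "g \<in> tail_conv f n \<Longrightarrow> h \<in> tail_conv f n \<Longrightarrow> 0 \<le> s \<Longrightarrow> s \<le> 1 \<Longrightarrow>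
    (\<lambda>x. (1 - s) * g x + s * h x) \<in> tail_conv f n"

lemma tail_conv_antimono: "g \<in> tail_conv f m \<Longrightarrow> n \<le> m \<Longrightarrow> g \<in> tail_conv f n"
  by (induction rule: tail_conv.induct) (auto intro: tail_conv.intros)

lemma tail_conv_range:
  assumes "g \<in> tail_conv f n" "\<And>k x. 0 \<le> f k x \<and> f k x \<le> 1"
  shows "0 \<le> g x \<and> g x \<le> (1::real)"
  using assms(1)
proof (induction rule: tail_conv.induct)
  case (mix g h s)
  then have "(1 - s) * g x + s * h x \<le> (1 - s) * 1 + s * 1" by (intro add_mono mult_left_mono) auto
  then show ?case using mix by simp
qed (use assms in auto)

lemma tail_conv_pos:
  assumes "g \<in> tail_conv f n" "0 < g x" shows "\<exists>k\<ge>n. 0 < f k x"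
  using assms
proof (induction rule: tail_conv.induct)
  case (mix g h s)
  have "0 < g x \<or> 0 < h x"
  proof (rule ccontr)
    assume "\<not> (0 < g x \<or> 0 < h x)"
    then have "(1 - s) * g x \<le> 0" "s * h x \<le> 0" using mix by (auto intro: mult_nonneg_nonpos)
    then show False using mix.prems by simp
  qed
  then show ?case using mix by blast
qed auto

lemma tail_conv_usc:
  fixes f :: "nat \<Rightarrow> 'a::t2_space \<Rightarrow> real"
  assumes "g \<in> tail_conv f n" and K: "compact K" and f: "\<And>k q. closed {x\<in>K. q \<le> f k x}"
  shows "closed {x\<in>K. q \<le> g x}"
  using assms(1)
proof (induction arbitrary: q rule: tail_conv.induct)
  case (mix g h s)
  have *: "closed {x\<in>K. q \<le> c * g x}" if "0 \<le> c" "\<And>q. closed {x\<in>K. q \<le> g x}" for c q and g :: "'a \<Rightarrow> real"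
  proof (cases "c = 0")
    case True
    then show ?thesis using compact_imp_closed[OF K] by (cases "q \<le> 0") auto
  next
    case False
    then have "{x\<in>K. q \<le> c * g x} = {x\<in>K. q / c \<le> g x}"
      using that by (auto simp: field_simps)
    then show ?thesis using that by simp
  qed
  show ?case by (rule closed_superlevel_add[OF K]) (use mix * in auto)
qed (use f in auto)

text \<open>The weights are padded by zeros beyond \<open>N\<close>, so that two combinations of
  different length can be mixed over a common range.\<close>

lemma tail_conv_weights:
  assumes "g \<in> tail_conv f n"
  shows "\<exists>N w. (\<forall>k. 0 \<le> w k) \<and> (\<Sum>k<N. w k) = 1 \<and> (\<forall>k\<ge>N. w k = 0) \<and> g = (\<lambda>x. \<Sum>k<N. w k * f k x)"
  using assms
proof (induction rule: tail_conv.induct)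
  case (base k)
  show ?case
    by (rule exI[of _ "Suc k"], rule exI[of _ "\<lambda>j. if j = k then 1 else 0"])
      (auto simp: if_distrib[of "\<lambda>z. z * _"] cong: if_cong)
next
  case (mix g h s)
  obtain N w where w: "\<forall>k. 0 \<le> w k" "(\<Sum>k<N. w k) = 1" "\<forall>k\<ge>N. w k = 0" "g = (\<lambda>x. \<Sum>k<N. w k * f k x)"
    using mix by blast
  obtain N' w' where w': "\<forall>k. 0 \<le> w' k" "(\<Sum>k<N'. w' k) = 1" "\<forall>k\<ge>N'. w' k = 0"
      "h = (\<lambda>x. \<Sum>k<N'. w' k * f k x)"
    using mix by blast
  have e1: "(\<Sum>k<N. w k * c k) = (\<Sum>k<max N N'. w k * c k)" for c
    by (rule sum.mono_neutral_left) (use w(3) in auto)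
  have e2: "(\<Sum>k<N'. w' k * c k) = (\<Sum>k<max N N'. w' k * c k)" for c
    by (rule sum.mono_neutral_left) (use w'(3) in auto)
  show ?case
  proof (intro exI conjI)
    show "\<forall>k. 0 \<le> (1 - s) * w k + s * w' k" using w w' mix by auto
    show "(\<Sum>k<max N N'. (1 - s) * w k + s * w' k) = 1"
      using w(2) w'(2) e1[of "\<lambda>_. 1"] e2[of "\<lambda>_. 1"] by (simp add: sum.distrib sum_distrib_left[symmetric])
    show "\<forall>k\<ge>max N N'. (1 - s) * w k + s * w' k = 0" using w w' by auto
    show "(\<lambda>x. (1 - s) * g x + s * h x) = (\<lambda>x. \<Sum>k<max N N'. ((1 - s) * w k + s * w' k) * f k x)"
      unfolding w(4) w'(4) e1 e2
      by (simp add: sum.distrib sum_distrib_left distrib_right mult.assoc)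
  qed
qed

text \<open>Simons' inequality: the \<open>g n\<close> are chosen almost minimal for the maximum of
  \<open>\<Sum>m\<le>n. t ^ m * g m\<close>, so that comparison with the mixture \<open>(g n + t * g (Suc n)) / (1 + t)\<close>
  keeps every \<open>g n\<close> large at a maximum point of the infinite sum.\<close>

lemma Simons_inequality:
  fixes f :: "nat \<Rightarrow> 'a::heine_borel \<Rightarrow> real"
  assumes K: "compact K" and rng: "\<And>k x. 0 \<le> f k x \<and> f k x \<le> 1"
    and cl: "\<And>k q. closed {x\<in>K. q \<le> f k x}"
    and d: "0 < d" and ge: "\<And>g. g \<in> tail_conv f 0 \<Longrightarrow> \<exists>x\<in>K. d \<le> g x"
  shows "\<exists>x\<in>K. \<forall>n. \<exists>k\<ge>n. 0 < f k x"
proof -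
  have mem: "f n \<in> tail_conv f n" for n by (rule tail_conv.base) simp
  have Kne: "K \<noteq> {}" and d1: "d \<le> 1"
    using ge[OF mem[of 0]] rng[of 0] by (auto intro: order_trans)
  \<comment> \<open>Small enough that the geometric tail after step \<open>n\<close>, at most
    \<open>2 * t ^ Suc n\<close>, stays below the growth \<open>t ^ n * d / 2\<close> obtained at
    step \<open>n\<close>.\<close>
  define t where "t = d / 8"
  have t: "0 < t" "t \<le> 1/2" "2 * t < d / 2" using d d1 by (auto simp: t_def)
  \<comment> \<open>Chosen so that \<open>2 * \<tau> n\<close> is exactly the amount
    \<open>t ^ Suc n * (d / 2 / 2 ^ Suc n)\<close> by which the lower bound in \<open>incr\<close>
    may shrink at the next step.\<close>
  define \<tau> where "\<tau> n = t ^ Suc n * d / 2 ^ (n + 3)" for n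
  have \<tau>: "0 < \<tau> n" for n using t d by (simp add: \<tau>_def)
  define S where "S F = Sup (F ` K)" for F :: "'a \<Rightarrow> real"
  have Sle: "S F \<le> c" if "\<And>x. x \<in> K \<Longrightarrow> F x \<le> c" for F c
    unfolding S_def using that Kne by (intro cSUP_least) auto
  have leS: "F x \<le> S F" if "x \<in> K" "\<And>x. F x \<le> c" for F c x
    unfolding S_def using that by (intro cSUP_upper) (auto intro!: bdd_aboveI)
  \<comment> \<open>The bound on \<open>F\<close> is a premise inside the existential, so that a
    total selector can be chosen before the partial sums are known to be bounded; where it fails,
    \<open>f n\<close> is the default.\<close>
  have "\<exists>g. g \<in> tail_conv f n \<and> ((\<forall>x. 0 \<le> F x \<and> F x \<le> c) \<longrightarrow>
      (\<forall>h\<in>tail_conv f n. S (\<lambda>x. F x + t ^ n * g x) \<le> S (\<lambda>x. F x + t ^ n * h x) + \<tau> n))" for n F c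
  proof (cases "\<forall>x. 0 \<le> F x \<and> F x \<le> c")
    case True
    let ?V = "(\<lambda>h. S (\<lambda>x. F x + t ^ n * h x)) ` tail_conv f n"
    have lb: "bdd_below ?V"
    proof (rule bdd_belowI2[of _ 0])
      fix h assume h: "h \<in> tail_conv f n"
      obtain x where x: "x \<in> K" using Kne by blast
      have "F z + t ^ n * h z \<le> c + t ^ n * 1" for z
        using True tail_conv_range[OF h rng] t by (intro add_mono mult_left_mono) auto
      then have "F x + t ^ n * h x \<le> S (\<lambda>x. F x + t ^ n * h x)"
        by (intro leS[OF x]) auto
      moreover have "0 \<le> F x + t ^ n * h x"
        using True tail_conv_range[OF h rng] t by simp
      ultimately show "0 \<le> S (\<lambda>x. F x + t ^ n * h x)" by simp
    qed
    have ne: "?V \<noteq> {}" using mem by blast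
    have "Inf ?V < Inf ?V + \<tau> n" using \<tau> by simp
    then obtain g where g: "g \<in> tail_conv f n" "S (\<lambda>x. F x + t ^ n * g x) < Inf ?V + \<tau> n"
      using cInf_lessD[OF ne] by blast
    have "S (\<lambda>x. F x + t ^ n * g x) \<le> S (\<lambda>x. F x + t ^ n * h x) + \<tau> n" if "h \<in> tail_conv f n" for h
    proof -
      have "Inf ?V \<le> S (\<lambda>x. F x + t ^ n * h x)" using lb that by (intro cInf_lower) auto
      then show ?thesis using g(2) by linarith
    qed
    then show ?thesis using g by blast
  qed (use mem in blast)
  then have "\<forall>n F. \<exists>g. g \<in> tail_conv f n \<and> ((\<forall>x. 0 \<le> F x \<and> F x \<le> 2) \<longrightarrow>
      (\<forall>h\<in>tail_conv f n. S (\<lambda>x. F x + t ^ n * g x) \<le> S (\<lambda>x. F x + t ^ n * h x) + \<tau> n))"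
    by blast
  then obtain sel where sel: "\<And>n F. sel n F \<in> tail_conv f n"
    "\<And>n F h. (\<And>x. 0 \<le> F x \<and> F x \<le> 2) \<Longrightarrow> h \<in> tail_conv f n \<Longrightarrow>
      S (\<lambda>x. F x + t ^ n * sel n F x) \<le> S (\<lambda>x. F x + t ^ n * h x) + \<tau> n"
    by metis
  \<comment> \<open>\<open>G n\<close> is the partial sum of \<open>t ^ m * g m\<close> over
    \<open>m < n\<close>, with \<open>g n\<close> nearly minimal given \<open>G n\<close>.\<close>
  define G where "G = rec_nat (\<lambda>_. 0) (\<lambda>n F x. F x + t ^ n * sel n F x)"
  define g where "g n = sel n (G n)" for n
  have G0: "G 0 = (\<lambda>_. 0)" and GS: "G (Suc n) = (\<lambda>x. G n x + t ^ n * g n x)" for n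
    by (simp_all add: G_def g_def)
  have gmem: "g n \<in> tail_conv f n" for n by (simp add: g_def sel)
  have grng: "0 \<le> g n x" "g n x \<le> 1" for n x using tail_conv_range[OF gmem rng] by auto
  have tn: "0 < t ^ n" for n using t by simp
  have Gstep: "G n x \<le> G (Suc n) x" "G (Suc n) x \<le> G n x + t ^ n" for n x
    using grng[of n x] tn[of n] by (auto simp: GS mult_left_le)
  have geom: "t ^ n + 2 * t ^ Suc n \<le> 2 * t ^ n" for n using t tn[of n] by (simp add: mult.commute)
  have "G n x + 2 * t ^ n \<le> 2" for n x
  proof (induction n)
    case (Suc n) then show ?case using Gstep(2)[of n x] geom[of n] by linarith
  qed (simp add: G0)
  then have Gle: "G n x \<le> 2" for n x using tn[of n] by (smt (verit))
  have Gge: "0 \<le> G n x" for n x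
  proof (induction n)
    case (Suc n) then show ?case using Gstep(1)[of n x] by linarith
  qed (simp add: G0)
  have near: "S (G (Suc n)) \<le> S (\<lambda>x. G n x + t ^ n * h x) + \<tau> n" if "h \<in> tail_conv f n" for n h
    using sel(2)[OF _ that, of "G n"] Gle Gge by (simp add: GS g_def)
  have leSG: "G n x \<le> S (G n)" if "x \<in> K" for n x using leS[OF that] Gle by blast
  have S0: "S (G 0) = 0" unfolding S_def G0 using Kne by simp
  \<comment> \<open>Near-minimality against the mixture gives \<open>(1 + t) * (S (G (Suc n)) -
    \<tau> n) \<le> S (G (Suc (Suc n))) + t * S (G n)\<close>: each increment is at least
    \<open>t\<close> times the previous one, up to errors. The start is at least \<open>d\<close>;
    one half of it is kept, the other half pays for the errors.\<close>
  have incr: "t ^ n * (d / 2 + d / 2 / 2 ^ n) \<le> S (G (Suc n)) - S (G n)" for n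
  proof (induction n)
    case 0
    obtain x where x: "x \<in> K" "d \<le> g 0 x" using ge[OF gmem] by blast
    then have "d \<le> G (Suc 0) x" by (simp add: GS G0)
    then show ?case using leSG[OF x(1), of "Suc 0"] S0 by simp
  next
    case (Suc n)
    let ?s = "t / (1 + t)"
    let ?h = "\<lambda>x. (1 - ?s) * g n x + ?s * g (Suc n) x"
    have "?h \<in> tail_conv f n"
      using t gmem tail_conv_antimono[OF gmem, of n "Suc n"] by (intro tail_conv.mix) auto
    then have "S (G (Suc n)) \<le> S (\<lambda>x. G n x + t ^ n * ?h x) + \<tau> n" by (rule near)
    moreover have "S (\<lambda>x. G n x + t ^ n * ?h x) \<le> (S (G (Suc (Suc n))) + t * S (G n)) / (1 + t)"
    proof (rule Sle)
      fix x assume x: "x \<in> K"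
      have "(1 + t) * (1 - ?s) = 1" "(1 + t) * ?s = t" using t by (simp_all add: field_simps)
      moreover have "(1 + t) * ?h x = ((1 + t) * (1 - ?s)) * g n x + ((1 + t) * ?s) * g (Suc n) x"
        by (simp only: distrib_left mult.assoc)
      ultimately have h: "(1 + t) * ?h x = g n x + t * g (Suc n) x" by (simp only: mult_1)
      have "(1 + t) * (G n x + t ^ n * ?h x) = (1 + t) * G n x + t ^ n * ((1 + t) * ?h x)"
        by (simp only: distrib_left mult.left_commute)
      also have "\<dots> = (1 + t) * G n x + t ^ n * (g n x + t * g (Suc n) x)" by (simp only: h)
      also have "\<dots> = G (Suc (Suc n)) x + t * G n x" by (simp add: GS algebra_simps)
      also have "\<dots> \<le> S (G (Suc (Suc n))) + t * S (G n)"
        using leSG[OF x] t by (intro add_mono mult_left_mono) auto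
      finally show "G n x + t ^ n * ?h x \<le> (S (G (Suc (Suc n))) + t * S (G n)) / (1 + t)"
        using t by (simp add: field_simps)
    qed
    ultimately have "S (G (Suc n)) - \<tau> n \<le> (S (G (Suc (Suc n))) + t * S (G n)) / (1 + t)" by linarith
    then have "(1 + t) * (S (G (Suc n)) - \<tau> n) \<le> S (G (Suc (Suc n))) + t * S (G n)"
      using t by (simp add: field_simps)
    then have "t * (S (G (Suc n)) - S (G n)) - (1 + t) * \<tau> n \<le> S (G (Suc (Suc n))) - S (G (Suc n))"
      by (simp add: algebra_simps)
    moreover have "t * (t ^ n * (d / 2 + d / 2 / 2 ^ n)) \<le> t * (S (G (Suc n)) - S (G n))"
      using Suc t by (intro mult_left_mono) auto
    moreover have "(1 + t) * \<tau> n \<le> 2 * \<tau> n" using t \<tau>[of n] by (intro mult_right_mono) auto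
    moreover have "2 * \<tau> n = t ^ Suc n * (d / 2 / 2 ^ Suc n)"
      by (simp add: \<tau>_def power_add)
    moreover have "t * (t ^ n * (d / 2 + d / 2 / 2 ^ n)) - t ^ Suc n * (d / 2 / 2 ^ Suc n)
        = t ^ Suc n * (d / 2 + d / 2 / 2 ^ Suc n)" by (simp add: field_simps)
    ultimately show ?case by linarith
  qed
  have bound: "S (G (Suc n)) + 2 * t ^ Suc n \<le> S (G n) + 2 * t ^ n" for n
  proof -
    have "S (G (Suc n)) \<le> S (G n) + t ^ n"
      using Gstep(2) leSG by (intro Sle) (meson add_right_mono order_trans)
    then show ?thesis using geom[of n] by linarith
  qed
  have mono: "S (G n) \<le> S (G (Suc n))" for n
    using leSG Gstep(1) by (intro Sle) (meson order_trans)
  define s where "s = (SUP n. S (G n))"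
  have S2: "S (G n) \<le> 2" for n by (rule Sle) (rule Gle)
  have Ss: "S (G n) \<le> s" for n unfolding s_def using S2 by (intro cSUP_upper) (auto intro!: bdd_aboveI)
  have sS: "s \<le> S (G n) + 2 * t ^ n" for n
    unfolding s_def
  proof (rule cSUP_least)
    fix m
    show "S (G m) \<le> S (G n) + 2 * t ^ n"
    proof (cases "n \<le> m")
      case True
      have "S (G m) + 2 * t ^ m \<le> S (G n) + 2 * t ^ n"
        using True by (induction rule: dec_induct) (use bound in \<open>auto intro: order_trans\<close>)
      then show ?thesis using tn[of m] by linarith
    next
      case False
      then have "m \<le> n" by simp
      then have "S (G m) \<le> S (G n)" by (rule lift_Suc_mono_le[of "\<lambda>n. S (G n)", OF mono])
      then show ?thesis using tn[of n] by linarith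
    qed
  qed simp
  have Gusc: "closed {x\<in>K. q \<le> G n x}" for n q
  proof (induction n arbitrary: q)
    case 0
    then show ?case using compact_imp_closed[OF K] by (cases "q \<le> 0") (auto simp: G0)
  next
    case (Suc n)
    have "closed {x\<in>K. q \<le> t ^ n * g n x}" for q
    proof -
      have "{x\<in>K. q \<le> t ^ n * g n x} = {x\<in>K. q / t ^ n \<le> g n x}"
        using tn[of n] by (auto simp: field_simps)
      then show ?thesis using tail_conv_usc[OF gmem K cl] by simp
    qed
    then show ?case unfolding GS using Suc by (intro closed_superlevel_add[OF K])
  qed
  \<comment> \<open>A common point of these nested compact sets nearly maximises all partial sums at
    once; it replaces a maximum point of the infinite sum.\<close>
  define Z where "Z n = {x\<in>K. s - 2 * t ^ n \<le> G n x}" for n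
  have "(\<Inter>n. Z n) \<noteq> {}"
  proof (rule compact_nest)
    fix n
    have "Z n = K \<inter> {x\<in>K. s - 2 * t ^ n \<le> G n x}" unfolding Z_def by blast
    then show "compact (Z n)" using compact_Int_closed[OF K Gusc] by simp
    obtain x where x: "x \<in> K" "\<forall>y\<in>K. G n y \<le> G n x"
      using closed_superlevel_attains_max[OF K Kne Gusc] by blast
    then have "S (G n) \<le> G n x" by (intro Sle) blast
    then show "Z n \<noteq> {}" using sS[of n] x(1) unfolding Z_def by force
  next
    fix m n :: nat assume "m \<le> n"
    then show "Z n \<subseteq> Z m"
    proof (induction rule: dec_induct)
      case (step k)
      have "s - 2 * t ^ k \<le> G k y" if "s - 2 * t ^ Suc k \<le> G (Suc k) y" for y
        using that Gstep(2)[of k y] geom[of k] by linarith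
      then have "Z (Suc k) \<subseteq> Z k" unfolding Z_def by blast
      then show ?case using step by blast
    qed simp
  qed
  then obtain x where x: "\<And>n. x \<in> Z n" by blast
  \<comment> \<open>At such a point \<open>G (Suc n) x\<close> is within
    \<open>2 * t ^ Suc n\<close> of \<open>s\<close>, whereas \<open>G n x\<close> lies below
    \<open>s\<close> by at least \<open>t ^ n * d / 2\<close>; the difference has to come from
    \<open>g n x\<close>.\<close>
  have "0 < g n x" for n
  proof -
    have xK: "x \<in> K" using x[of 0] by (simp add: Z_def)
    have "s - 2 * t ^ Suc n \<le> G n x + t ^ n * g n x" using x[of "Suc n"] by (simp add: Z_def GS)
    moreover have "t ^ n * (d / 2) \<le> S (G (Suc n)) - S (G n)"
    proof -
      have "t ^ n * (d / 2) \<le> t ^ n * (d / 2 + d / 2 / 2 ^ n)"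
        using tn[of n] d by (intro mult_left_mono) auto
      then show ?thesis using incr[of n] by linarith
    qed
    ultimately have "t ^ n * (d / 2) - 2 * t ^ Suc n \<le> t ^ n * g n x"
      using Ss[of "Suc n"] leSG[OF xK, of n] by linarith
    then have "t ^ n * (d / 2 - 2 * t) \<le> t ^ n * g n x" by (simp add: algebra_simps)
    then show ?thesis using tn[of n] t(3) by (simp add: mult_le_cancel_left_pos)
  qed
  then show ?thesis using tail_conv_pos[OF gmem] x[of 0] unfolding Z_def by blast
qed

text \<open>If every convex combination reached \<open>d\<close> somewhere on \<open>K\<close>,
  Simons' inequality would produce a point lying in infinitely many \<open>A k\<close>. Closedness
  of the sets is what makes the indicators upper semicontinuous.\<close>

lemma small_convex_combination_of_indicators:
  fixes A :: "nat \<Rightarrow> 'a::heine_borel set" and d :: real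
  assumes K: "compact K" and A: "\<And>k. closed (A k \<inter> K)"
    and ev: "\<And>x. x \<in> K \<Longrightarrow> \<forall>\<^sub>F k in sequentially. x \<notin> A k" and d: "0 < d"
  shows "\<exists>N w. (\<forall>k. 0 \<le> w k) \<and> (\<Sum>k<N. w k) = 1 \<and> (\<forall>x\<in>K. (\<Sum>k<N. w k * indicator (A k) x) < d)"
proof (rule ccontr)
  assume no: "\<not> ?thesis"
  let ?f = "\<lambda>k. indicator (A k) :: 'a \<Rightarrow> real"
  have "\<exists>x\<in>K. \<forall>n. \<exists>k\<ge>n. 0 < ?f k x"
  proof (rule Simons_inequality[where f = ?f and d = d, OF K])
    fix k q
    have "{x\<in>K. q \<le> ?f k x} = (if q \<le> 0 then K else if q \<le> 1 then A k \<inter> K else {})"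
      by (auto simp: indicator_def)
    then show "closed {x\<in>K. q \<le> ?f k x}" using A compact_imp_closed[OF K] by simp
  next
    fix g assume "g \<in> tail_conv ?f 0"
    from tail_conv_weights[OF this] obtain N w where
      w: "\<forall>k. 0 \<le> w k" "(\<Sum>k<N. w k) = 1" "g = (\<lambda>x. \<Sum>k<N. w k * ?f k x)" by blast
    then show "\<exists>x\<in>K. d \<le> g x" using no by (metis not_le)
  qed (use d in \<open>auto simp: indicator_def\<close>)
  then obtain x where x: "x \<in> K" "\<forall>n. \<exists>k\<ge>n. 0 < ?f k x" by blast
  then have "\<forall>n. \<exists>k\<ge>n. x \<in> A k" by (metis indicator_simps(2) less_irrefl)
  then show False using ev[OF x(1)] unfolding eventually_sequentially by blast
qed

subsection \<open>A smooth bump function\<close>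

text \<open>The extra power of \<open>inverse t\<close> makes the family stable under
  differentiation: the derivative of index \<open>n\<close> is a combination of the indices
  \<open>n + 1\<close> and \<open>n + 2\<close>. Index 0 is the usual flat function.\<close>

definition flat_exp :: "nat \<Rightarrow> real \<Rightarrow> real" where
  "flat_exp n t = (if 0 < t then inverse t ^ n * exp (- inverse t) else 0)"

lemma flat_exp_nonneg: "0 \<le> flat_exp n t"
  by (simp add: flat_exp_def)

text \<open>With \<open>x = inverse t\<close>, a single term of the exponential series gives
  \<open>x ^ (n + k) \<le> fact (n + k) * exp x\<close>. The case \<open>k = 2\<close> yields
  differentiability at 0, the case \<open>k = 0\<close> boundedness.\<close>

lemma flat_exp_le: "flat_exp n t \<le> fact (n + k) * \<bar>t\<bar> ^ k"
proof (cases "0 < t")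
  case True
  define x where "x = inverse t"
  have x: "0 < x" using True by (simp add: x_def)
  have "(\<lambda>m. x ^ m /\<^sub>R fact m) sums exp x" by (rule exp_converges)
  then have "(\<Sum>m\<in>{n + k}. x ^ m /\<^sub>R fact m) \<le> exp x"
    unfolding sums_iff using x by (metis (no_types, lifting) finite.emptyI finite_insert
        divide_inverse_commute less_eq_real_def sum_le_suminf zero_le_divide_iff zero_le_power fact_ge_zero real_scaleR_def)
  then have "x ^ n * x ^ k \<le> fact (n + k) * exp x"
    by (simp add: power_add divide_simps mult.commute)
  then have "x ^ n * x ^ k * exp (- x) \<le> fact (n + k) * exp x * exp (- x)"
    by (intro mult_right_mono) auto
  then have "x ^ n * exp (- x) * x ^ k \<le> fact (n + k)"
    by (simp add: exp_minus field_simps)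
  then have "x ^ n * exp (- x) * x ^ k * t ^ k \<le> fact (n + k) * t ^ k"
    using True by (intro mult_right_mono) auto
  moreover have "x ^ k * t ^ k = 1" using True by (simp add: x_def power_mult_distrib[symmetric])
  then have "x ^ n * exp (- x) * x ^ k * t ^ k = x ^ n * exp (- x)" by (simp only: mult.assoc mult_1_right)
  moreover have "flat_exp n t = x ^ n * exp (- x)" using True by (simp add: flat_exp_def x_def)
  ultimately show ?thesis using True by simp
qed (simp add: flat_exp_def)

lemma flat_exp_deriv:
  "(flat_exp n has_real_derivative flat_exp (n + 2) t - real n * flat_exp (n + 1) t) (at t)"
proof -
  consider "0 < t" | "t < 0" | "t = 0" by linarith
  then show ?thesis
  proof cases
    case 1
    have "((\<lambda>t. inverse t ^ n * exp (- inverse t)) has_real_derivative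
        flat_exp (n + 2) t - real n * flat_exp (n + 1) t) (at t)"
      using 1 by (auto intro!: derivative_eq_intros simp: flat_exp_def)
        (cases n; simp add: field_simps power2_eq_square)
    then show ?thesis
      by (rule has_field_derivative_transform_within_open[of _ _ _ "{0<..}"]) (use 1 in \<open>auto simp: flat_exp_def\<close>)
  next
    case 2
    have "((\<lambda>_. 0) has_real_derivative 0) (at t)" by simp
    then have "(flat_exp n has_real_derivative 0) (at t)"
      by (rule has_field_derivative_transform_within_open[of _ _ _ "{..<0}"]) (use 2 in \<open>auto simp: flat_exp_def\<close>)
    then show ?thesis using 2 by (simp add: flat_exp_def)
  next
    case 3
    have "((\<lambda>h. flat_exp n h / h) \<longlongrightarrow> 0) (at 0)"
    proof (rule Lim_null_comparison)
      show "\<forall>\<^sub>F h in at 0. norm (flat_exp n h / h) \<le> fact (n + 2) * \<bar>h\<bar>"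
      proof (rule always_eventually, rule allI)
        fix h :: real
        show "norm (flat_exp n h / h) \<le> fact (n + 2) * \<bar>h\<bar>"
        proof (cases "h = 0")
          case False
          have "flat_exp n h \<le> fact (n + 2) * \<bar>h\<bar> * \<bar>h\<bar>"
            using flat_exp_le[of n h 2] unfolding power2_eq_square by (simp only: mult.assoc)
          then have "flat_exp n h / \<bar>h\<bar> \<le> fact (n + 2) * \<bar>h\<bar>"
            using False by (subst pos_divide_le_eq) auto
          then show ?thesis using flat_exp_nonneg[of n h] by (simp only: real_norm_def abs_divide abs_of_nonneg)
        qed simp
      qed
      show "((\<lambda>h. fact (n + 2) * \<bar>h\<bar>) \<longlongrightarrow> 0) (at (0::real))"
        by (auto intro!: tendsto_eq_intros)
    qed
    then have "(flat_exp n has_real_derivative 0) (at 0)"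
      by (simp add: has_field_derivative_iff flat_exp_def)
    then show ?thesis using 3 by (simp add: flat_exp_def)
  qed
qed

text \<open>An algebra of functions closed under directional derivatives. Smoothness of every order
  follows by induction on the order, without a formula for higher derivatives.\<close>

inductive_set bump_algebra :: "'a::euclidean_space \<Rightarrow> real \<Rightarrow> ('a \<Rightarrow> real) set" for a R where
  const: "(\<lambda>_. c) \<in> bump_algebra a R"
| inner: "(\<lambda>x. x \<bullet> v) \<in> bump_algebra a R"
| bump: "(\<lambda>x. flat_exp n (R\<^sup>2 - (x - a) \<bullet> (x - a))) \<in> bump_algebra a R"
| add: "f \<in> bump_algebra a R \<Longrightarrow> g \<in> bump_algebra a R \<Longrightarrow> (\<lambda>x. f x + g x) \<in> bump_algebra a R"
| mult: "f \<in> bump_algebra a R \<Longrightarrow> g \<in> bump_algebra a R \<Longrightarrow> (\<lambda>x. f x * g x) \<in> bump_algebra a R"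

lemma bump_has_derivative:
  "((\<lambda>x. flat_exp n (R\<^sup>2 - (x - a) \<bullet> (x - a))) has_derivative
    (\<lambda>v. (flat_exp (n + 2) (R\<^sup>2 - (x - a) \<bullet> (x - a)) - real n * flat_exp (n + 1) (R\<^sup>2 - (x - a) \<bullet> (x - a)))
       * (- 2 * ((x - a) \<bullet> v)))) (at x)"
proof -
  have "((\<lambda>x. R\<^sup>2 - (x - a) \<bullet> (x - a)) has_derivative (\<lambda>v. - 2 * ((x - a) \<bullet> v))) (at x)"
    by (auto intro!: derivative_eq_intros simp: inner_commute)
  from has_derivative_compose[OF this flat_exp_deriv[unfolded has_field_derivative_def]]
  show ?thesis by simp
qed

lemma bump_algebra_derivative:
  assumes "f \<in> bump_algebra a R"
  shows "\<exists>f'. (\<forall>x. (f has_derivative f' x) (at x)) \<and> (\<forall>v. (\<lambda>x. f' x v) \<in> bump_algebra a R)"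
  using assms
proof induction
  case (const c)
  show ?case by (rule exI[of _ "\<lambda>_ _. 0"]) (auto intro: bump_algebra.const)
next
  case (inner v)
  show ?case by (rule exI[of _ "\<lambda>_ w. w \<bullet> v"]) (auto intro!: bump_algebra.const derivative_eq_intros)
next
  case (bump n)
  have lin: "(\<lambda>x. - 2 * ((x - a) \<bullet> v)) \<in> bump_algebra a R" for v
  proof -
    have "(\<lambda>x. (- 2) * (x \<bullet> v) + 2 * (a \<bullet> v)) \<in> bump_algebra a R"
      by (intro bump_algebra.add bump_algebra.mult bump_algebra.const bump_algebra.inner)
    then show ?thesis by (simp add: inner_diff_left algebra_simps)
  qed
  have "(\<lambda>x. (flat_exp (n + 2) (R\<^sup>2 - (x - a) \<bullet> (x - a)) + (- real n) * flat_exp (n + 1) (R\<^sup>2 - (x - a) \<bullet> (x - a)))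
      * (- 2 * ((x - a) \<bullet> v))) \<in> bump_algebra a R" for v
    by (intro bump_algebra.add bump_algebra.const bump_algebra.bump bump_algebra.mult[OF _ lin] bump_algebra.mult[OF bump_algebra.const])
  then show ?case using bump_has_derivative[of n R a] by force
next
  case (add f g)
  then obtain f' g' where
    "\<forall>x. (f has_derivative f' x) (at x)" "\<forall>v. (\<lambda>x. f' x v) \<in> bump_algebra a R"
    "\<forall>x. (g has_derivative g' x) (at x)" "\<forall>v. (\<lambda>x. g' x v) \<in> bump_algebra a R" by blast
  then show ?case
    by (intro exI[of _ "\<lambda>x v. f' x v + g' x v"]) (auto intro: has_derivative_add bump_algebra.add)
next
  case (mult f g)
  then obtain f' g' where
    "\<forall>x. (f has_derivative f' x) (at x)" "\<forall>v. (\<lambda>x. f' x v) \<in> bump_algebra a R"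
    "\<forall>x. (g has_derivative g' x) (at x)" "\<forall>v. (\<lambda>x. g' x v) \<in> bump_algebra a R" by blast
  then show ?case using mult.hyps
    by (intro exI[of _ "\<lambda>x v. f x * g' x v + f' x v * g x"])
      (intro conjI allI has_derivative_mult bump_algebra.add bump_algebra.mult; blast)
qed

lemma bump_algebra_Ck_on: "f \<in> bump_algebra a R \<Longrightarrow> Ck_on k f UNIV"
proof (induction k arbitrary: f)
  case 0
  then obtain f' where "\<forall>x. (f has_derivative f' x) (at x)" using bump_algebra_derivative by blast
  then show ?case by (auto intro!: continuous_at_imp_continuous_on has_derivative_continuous)
next
  case (Suc k)
  then obtain f' where f': "\<forall>x. (f has_derivative f' x) (at x)" "\<forall>v. (\<lambda>x. f' x v) \<in> bump_algebra a R"
    using bump_algebra_derivative by blast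
  then have "frechet_derivative f (at x) = f' x" for x by (metis frechet_derivative_at)
  then show ?case using f' Suc.IH by (auto simp: differentiable_def)
qed

definition bump :: "'a::euclidean_space \<Rightarrow> real \<Rightarrow> 'a \<Rightarrow> real" where
  "bump a R x = exp (inverse (R\<^sup>2)) * flat_exp 0 (R\<^sup>2 - (x - a) \<bullet> (x - a))"

lemma bump_center: "0 < R \<Longrightarrow> bump a R a = 1"
  by (simp add: bump_def flat_exp_def exp_minus)

lemma bump_outside:
  assumes "0 < R" "R \<le> dist x a" shows "bump a R x = 0"
proof -
  have "R\<^sup>2 \<le> (dist x a)\<^sup>2" using assms by (intro power_mono) auto
  then show ?thesis by (simp add: bump_def flat_exp_def dist_norm power2_norm_eq_inner)
qed

lemma bump_nonneg: "0 \<le> bump a R x"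
  by (simp add: bump_def flat_exp_nonneg)

text \<open>With \<open>r = R\<^sup>2\<close> and \<open>q\<close> the squared distance, the
  exponent \<open>1 / r - 1 / (r - q)\<close> is at most \<open>- q / r\<^sup>2\<close>, and
  \<open>exp (- s) \<le> 1 / (1 + s)\<close>. The resulting quadratic gap below 1 is what lets a
  multiple of \<open>1 - bump\<close> beat first-order errors.\<close>

lemma bump_upper:
  assumes R: "0 < R" and x: "dist x a \<le> R"
  shows "(dist x a)\<^sup>2 / (R ^ 4 + R\<^sup>2) \<le> 1 - bump a R x"
proof (cases "dist x a = R")
  case True
  then have "bump a R x = 0" using R by (intro bump_outside) auto
  moreover have "(dist x a)\<^sup>2 \<le> R ^ 4 + R\<^sup>2" using True by simp
  ultimately show ?thesis using R by (simp add: divide_le_eq_1 add_pos_pos)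
next
  case False
  define q where "q = (dist x a)\<^sup>2"
  have q: "0 \<le> q" "q < R\<^sup>2"
    using x False by (auto simp: q_def intro!: power_strict_mono)
  have qe: "(x - a) \<bullet> (x - a) = q" by (simp add: q_def dist_norm power2_norm_eq_inner)
  define r where "r = R\<^sup>2"
  have R4: "R ^ 4 = r * r" by (simp add: r_def power2_eq_square power4_eq_xxxx)
  have r: "0 < r" "q < r" using R q by (auto simp: r_def)
  have "inverse r + q / R ^ 4 \<le> inverse (r - q)"
  proof -
    have "(r + q) * (r - q) \<le> r * r" by (simp add: algebra_simps)
    then have "(r + q) / (r * r) \<le> 1 / (r - q)" using r by (simp add: field_simps)
    moreover have "inverse r + q / R ^ 4 = (r + q) / (r * r)"
      using r by (simp add: R4 field_simps)
    ultimately show ?thesis by (simp add: inverse_eq_divide)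
  qed
  moreover have "bump a R x = exp (inverse r + - inverse (r - q))"
    using r unfolding bump_def flat_exp_def qe exp_add by (simp add: r_def)
  ultimately have "bump a R x \<le> exp (- (q / R ^ 4))" by simp
  also have "\<dots> \<le> 1 / (1 + q / R ^ 4)"
  proof -
    have "0 < 1 + q / R ^ 4" using q R by (simp add: add_pos_nonneg)
    then show ?thesis using exp_ge_add_one_self[of "q / R ^ 4"]
      by (simp add: exp_minus inverse_eq_divide frac_le)
  qed
  finally have "bump a R x \<le> R ^ 4 / (R ^ 4 + q)" using R q by (simp add: field_simps)
  moreover have "0 < R ^ 4 + q" using R q by (simp add: add_pos_nonneg)
  then have "1 - R ^ 4 / (R ^ 4 + q) = q / (R ^ 4 + q)" by (simp add: diff_divide_eq_iff)
  moreover have "q / (R ^ 4 + R\<^sup>2) \<le> q / (R ^ 4 + q)" using R q by (intro divide_left_mono) (auto intro!: mult_pos_pos add_pos_nonneg)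
  ultimately show ?thesis unfolding q_def by linarith
qed

lemma bump_le_1: "0 < R \<Longrightarrow> bump a R x \<le> 1"
  using bump_upper[of R x a] bump_outside[of R x a]
  by (cases "dist x a \<le> R") (smt (verit) divide_nonneg_nonneg zero_le_power2 zero_le_even_power even_numeral)+

subsection \<open>Superjets and viscosity subsolutions\<close>

text \<open>The Frechet superdifferential relative to \<open>E\<close>. The one-sided expansion,
  unlike a touching test function, passes directly to sums and nonnegative multiples, and it makes
  sense for the inf-convolutions, which are not differentiable.\<close>

definition superjet :: "'a::euclidean_space set \<Rightarrow> ('a \<Rightarrow> real) \<Rightarrow> 'a \<Rightarrow> 'a set" where
  "superjet E f a = {p. \<forall>\<omega>>0. \<exists>r>0. \<forall>x\<in>E. dist x a < r \<longrightarrow> f x \<le> f a + p \<bullet> (x - a) + \<omega> * dist x a}"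

lemma superjetD:
  assumes "p \<in> superjet E f a" "0 < \<omega>"
  obtains r where "0 < r" "\<And>x. x \<in> E \<Longrightarrow> dist x a < r \<Longrightarrow> f x \<le> f a + p \<bullet> (x - a) + \<omega> * dist x a"
  using assms unfolding superjet_def by blast

text \<open>Touching from above: bounds on the increments of \<open>f\<close> at \<open>a\<close>
  are bounds on those of \<open>g\<close>. Maxima and active penalties produce superjets in this
  way.\<close>

lemma superjet_mono:
  assumes p: "p \<in> superjet E f a" and le: "\<And>x. x \<in> E \<Longrightarrow> g x - g a \<le> f x - f a"
  shows "p \<in> superjet E g a"
  unfolding superjet_def
proof (intro CollectI allI impI)
  fix \<omega> :: real assume \<omega>: "0 < \<omega>"
  obtain r where "0 < r" "\<And>x. x \<in> E \<Longrightarrow> dist x a < r \<Longrightarrow> f x \<le> f a + p \<bullet> (x - a) + \<omega> * dist x a"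
    using superjetD[OF p \<omega>] by blast
  then show "\<exists>r>0. \<forall>x\<in>E. dist x a < r \<longrightarrow> g x \<le> g a + p \<bullet> (x - a) + \<omega> * dist x a"
    using le by (intro exI[of _ r]) (smt (verit))
qed

lemma superjet_add:
  assumes p: "p \<in> superjet E f a" and q: "q \<in> superjet E g a"
  shows "p + q \<in> superjet E (\<lambda>x. f x + g x) a"
  unfolding superjet_def
proof (intro CollectI allI impI)
  fix \<omega> :: real assume \<omega>: "0 < \<omega>"
  obtain r where r: "0 < r" "\<And>x. x \<in> E \<Longrightarrow> dist x a < r \<Longrightarrow> f x \<le> f a + p \<bullet> (x - a) + \<omega> / 2 * dist x a"
    using superjetD[OF p half_gt_zero[OF \<omega>]] by blast
  obtain s where s: "0 < s" "\<And>x. x \<in> E \<Longrightarrow> dist x a < s \<Longrightarrow> g x \<le> g a + q \<bullet> (x - a) + \<omega> / 2 * dist x a"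
    using superjetD[OF q half_gt_zero[OF \<omega>]] by blast
  have "f x + g x \<le> f a + g a + (p + q) \<bullet> (x - a) + \<omega> * dist x a" if "x \<in> E" "dist x a < min r s" for x
    using r(2)[of x] s(2)[of x] that by (simp add: inner_add_left)
  then show "\<exists>r>0. \<forall>x\<in>E. dist x a < r \<longrightarrow> f x + g x \<le> f a + g a + (p + q) \<bullet> (x - a) + \<omega> * dist x a"
    using r(1) s(1) by (intro exI[of _ "min r s"]) auto
qed

lemma superjet_scaleR:
  assumes p: "p \<in> superjet E f a" and c: "0 \<le> c"
  shows "c *\<^sub>R p \<in> superjet E (\<lambda>x. c * f x) a"
proof (cases "c = 0")
  case False
  then have c: "0 < c" using c by simp
  show ?thesis
    unfolding superjet_def
  proof (intro CollectI allI impI)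
    fix \<omega> :: real assume "0 < \<omega>"
    then have "0 < \<omega> / c" using c by simp
    from superjetD[OF p this] obtain r where r: "0 < r"
      "\<And>x. x \<in> E \<Longrightarrow> dist x a < r \<Longrightarrow> f x \<le> f a + p \<bullet> (x - a) + \<omega> / c * dist x a" by blast
    have "c * f x \<le> c * f a + (c *\<^sub>R p) \<bullet> (x - a) + \<omega> * dist x a" if "x \<in> E" "dist x a < r" for x
    proof -
      have "c * f x \<le> c * (f a + p \<bullet> (x - a) + \<omega> / c * dist x a)"
        using r(2)[OF that] c by (intro mult_left_mono) auto
      then show ?thesis using c by (simp add: distrib_left)
    qed
    then show "\<exists>r>0. \<forall>x\<in>E. dist x a < r \<longrightarrow> c * f x \<le> c * f a + (c *\<^sub>R p) \<bullet> (x - a) + \<omega> * dist x a"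
      using r(1) by blast
  qed
qed (auto simp: superjet_def intro: exI[of _ 1])

lemma superjet_const: "0 \<in> superjet E (\<lambda>_. c) a"
  by (auto simp: superjet_def intro: exI[of _ 1])

lemma superjet_sum:
  assumes "finite I" "\<And>i. i \<in> I \<Longrightarrow> 0 \<le> w i" "\<And>i. i \<in> I \<Longrightarrow> p i \<in> superjet E (f i) a"
  shows "(\<Sum>i\<in>I. w i *\<^sub>R p i) \<in> superjet E (\<lambda>x. \<Sum>i\<in>I. w i * f i x) a"
  using assms
proof (induction I)
  case empty
  then show ?case using superjet_const[of E 0 a] by simp
next
  case (insert i I)
  have "w i *\<^sub>R p i + (\<Sum>i\<in>I. w i *\<^sub>R p i) \<in> superjet E (\<lambda>x. w i * f i x + (\<Sum>i\<in>I. w i * f i x)) a"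
    by (rule superjet_add[OF superjet_scaleR]) (use insert in auto)
  then show ?case using insert by simp
qed

lemma superjet_has_derivative:
  assumes "(f has_derivative (\<lambda>v. p \<bullet> v)) (at a within E)"
  shows "p \<in> superjet E f a"
  unfolding superjet_def
proof (intro CollectI allI impI)
  fix \<omega> :: real assume "0 < \<omega>"
  then obtain r where "0 < r" "\<And>x. x \<in> E \<Longrightarrow> norm (x - a) < r \<Longrightarrow>
      norm (f x - f a - p \<bullet> (x - a)) \<le> \<omega> * norm (x - a)"
    using assms unfolding has_derivative_within_alt by blast
  then show "\<exists>r>0. \<forall>x\<in>E. dist x a < r \<longrightarrow> f x \<le> f a + p \<bullet> (x - a) + \<omega> * dist x a"
    by (intro exI[of _ r]) (fastforce simp: dist_norm abs_le_iff)
qed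

section \<open>Compactly localised test functions and superjets of subsolutions\<close>

text \<open>Interpolates between the linear function \<open>p \<bullet> (x - a)\<close> at
  \<open>a\<close> and the constant \<open>L\<close> outside the ball, which places it in the
  operator's domain. Its gradient at \<open>a\<close> is \<open>p\<close>, as the cut-off has a
  critical point there.\<close>

definition bump_test :: "'a::euclidean_space \<Rightarrow> real \<Rightarrow> 'a \<Rightarrow> real \<Rightarrow> 'a \<Rightarrow> real" where
  "bump_test a R p L x = L + (p \<bullet> (x - a) - L) * bump a R x"

definition bump_test_grad :: "'a::euclidean_space \<Rightarrow> real \<Rightarrow> 'a \<Rightarrow> real \<Rightarrow> 'a \<Rightarrow> 'a" where
  "bump_test_grad a R p L x = bump a R x *\<^sub>R p -
     (2 * (p \<bullet> (x - a) - L) * exp (inverse (R\<^sup>2)) * flat_exp 2 (R\<^sup>2 - (x - a) \<bullet> (x - a))) *\<^sub>R (x - a)"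

lemma bump_test_has_derivative:
  "(bump_test a R p L has_derivative (\<lambda>v. v \<bullet> bump_test_grad a R p L x)) (at x)"
proof -
  have "(bump a R has_derivative (\<lambda>v. exp (inverse (R\<^sup>2)) *
      (flat_exp 2 (R\<^sup>2 - (x - a) \<bullet> (x - a)) * (- 2 * ((x - a) \<bullet> v))))) (at x)"
    unfolding bump_def using has_derivative_mult_right[OF bump_has_derivative[of 0 R a x]]
    by (simp add: numeral_2_eq_2)
  moreover have "((\<lambda>x. p \<bullet> (x - a) - L) has_derivative (\<lambda>v. p \<bullet> v)) (at x)"
    by (auto intro!: derivative_eq_intros)
  ultimately have "(bump_test a R p L has_derivative (\<lambda>v. (p \<bullet> (x - a) - L) * (exp (inverse (R\<^sup>2)) *
      (flat_exp 2 (R\<^sup>2 - (x - a) \<bullet> (x - a)) * (- 2 * ((x - a) \<bullet> v)))) + p \<bullet> v * bump a R x)) (at x)"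
    unfolding bump_test_def by (auto intro!: derivative_eq_intros)
  then show ?thesis
    by (rule has_derivative_eq_rhs)
      (simp add: bump_test_grad_def fun_eq_iff inner_diff_right inner_diff_left inner_commute algebra_simps)
qed

lemma bump_test_Ck_on: "Ck_on k (bump_test a R p L) UNIV"
proof (rule bump_algebra_Ck_on)
  have "(\<lambda>x. L + (x \<bullet> p + (- (p \<bullet> a) - L)) * (exp (inverse (R\<^sup>2)) * flat_exp 0 (R\<^sup>2 - (x - a) \<bullet> (x - a))))
      \<in> bump_algebra a R"
    by (intro bump_algebra.intros)
  then show "bump_test a R p L \<in> bump_algebra a R"
    by (simp add: bump_test_def[abs_def] bump_def inner_diff_right inner_commute algebra_simps)
qed

lemma bump_test_mem:
  assumes "0 < R" "compact (E \<inter> cball a R)"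
  shows "bump_test a R p L \<in> Ccc_inf E"
proof -
  have "bump_test a R p L \<in> Cinf E" unfolding Cinf_def using bump_test_Ck_on by blast
  moreover have "\<forall>x\<in>E - E \<inter> cball a R. bump_test a R p L x = L"
  proof
    fix x assume "x \<in> E - E \<inter> cball a R"
    then have "\<not> dist a x \<le> R" by auto
    then have "R \<le> dist x a" by (simp add: dist_commute)
    then show "bump_test a R p L x = L" using bump_outside[OF assms(1), of x a] by (simp add: bump_test_def)
  qed
  ultimately show ?thesis using assms(2) unfolding Ccc_inf_def by blast
qed

lemma bump_test_gradient:
  assumes "E \<subseteq> closure (interior E)" "x \<in> E"
  shows "gradient_on E (bump_test a R p L) x = bump_test_grad a R p L x"
proof (rule gradient_on_eq[OF assms])
  show "C1_extension E (bump_test a R p L) UNIV (bump_test a R p L)"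
    unfolding C1_extension_def using bump_test_Ck_on by blast
  show "GDERIV (bump_test a R p L) x :> bump_test_grad a R p L x"
    using bump_test_has_derivative by (simp add: gderiv_def)
qed

text \<open>A large plateau \<open>L\<close> forces near-maximisers of \<open>u - f\<close> into a
  ball of radius \<rho> about \<open>a\<close>. The cut-off perturbs the gradient at a rate of order
  \<open>L\<close> times the distance, but \<open>L * \<kappa> * \<rho> = 4 * \<omega>\<close>, so
  the error is of order \<omega> with a constant that does not depend on \<omega>.\<close>

lemma subsolution_near_superjet:
  assumes E: "E \<subseteq> closure (interior E)"
    and u: "viscosity_subsolution E (Ccc_inf E) (\<lambda>f x. H x (gradient_on E f x)) lam h u"
    and a: "a \<in> E" and p: "p \<in> superjet E u a" and R: "0 < R" "compact (E \<inter> cball a R)"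
  shows "\<exists>C. \<forall>\<omega>>0. \<exists>x\<in>E. \<exists>q. dist x a < \<omega> \<and> norm (q - p) \<le> C * \<omega> \<and> u a - 3 * \<omega> \<le> lam * H x q + h x"
proof -
  define \<kappa> where "\<kappa> = 1 / (R ^ 4 + R\<^sup>2)"
  have \<kappa>: "0 < \<kappa>" using R by (simp add: \<kappa>_def add_pos_pos)
  have chi: "\<kappa> * (dist x a)\<^sup>2 \<le> 1 - bump a R x" if "dist x a \<le> R" for x
    using bump_upper[OF R(1) that] by (simp add: \<kappa>_def)
  define e where "e = exp (inverse (R\<^sup>2))"
  have e: "0 < e" by (simp add: e_def)
  define P where "P = norm p"
  have P: "0 \<le> P" by (simp add: P_def)
  have pz: "\<bar>p \<bullet> (x - a)\<bar> \<le> P * dist x a" for x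
    by (simp add: P_def dist_norm Cauchy_Schwarz_ineq2)
  obtain B where B: "\<And>x. x \<in> E \<Longrightarrow> u x \<le> B"
    using u unfolding viscosity_subsolution_def bdd_above_def by auto
  have "\<exists>x\<in>E. \<exists>q. dist x a < \<omega> \<and> norm (q - p) \<le> (1 + 32 * e / \<kappa>) * \<omega> \<and> u a - 3 * \<omega> \<le> lam * H x q + h x"
    if \<omega>: "0 < \<omega>" for \<omega>
  proof -
    obtain r where r: "0 < r"
      "\<And>x. x \<in> E \<Longrightarrow> dist x a < r \<Longrightarrow> u x \<le> u a + p \<bullet> (x - a) + \<omega> * dist x a"
      using superjetD[OF p \<omega>] by blast
    have "isCont (bump a R) a"
      unfolding bump_def using bump_has_derivative[of 0 R a a]
      by (intro continuous_mult continuous_const has_derivative_continuous)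
    moreover have "0 < \<omega> / (P + 1)" using \<omega> P by simp
    ultimately obtain \<delta> where \<delta>: "0 < \<delta>" "\<And>x. dist x a < \<delta> \<Longrightarrow> \<bar>bump a R x - 1\<bar> < \<omega> / (P + 1)"
      unfolding continuous_at_eps_delta using bump_center[OF R(1), of a] by (metis dist_real_def)
    \<comment> \<open>Radius within which the cut-off is so close to 1 that it changes
      \<open>p\<close> by at most \<omega>, and the linear part is at most \<omega> in absolute
      value.\<close>
    define d where "d = Min {\<omega>, \<delta>, R, \<omega> / (P + 1)}"
    have d: "0 < d" "d \<le> \<omega>" "d \<le> \<delta>" "d \<le> R" "d \<le> \<omega> / (P + 1)" using \<omega> \<delta> R P by (auto simp: d_def)
    \<comment> \<open>\<open>2 * P * R\<close> keeps \<open>L - p \<bullet> (x - a)\<close> above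
      \<open>L / 2\<close> in the ball; \<open>B - u a + 1\<close> handles points outside the ball
      of radius \<open>R\<close>; the fourth entry handles points of that ball beyond the range
      \<open>r\<close> of the jet; the last one gives \<open>\<rho> \<le> d / 2\<close>.\<close>
    define L where "L = Max {1, 2 * P * R, B - u a + 1, (B - u a + 1 + P * R) / (\<kappa> * r\<^sup>2), 8 * \<omega> / (\<kappa> * d)}"
    have L: "1 \<le> L" "2 * P * R \<le> L" "B - u a + 1 \<le> L" "(B - u a + 1 + P * R) / (\<kappa> * r\<^sup>2) \<le> L"
      "8 * \<omega> / (\<kappa> * d) \<le> L" by (auto simp: L_def)
    have L4: "B - u a + 1 + P * R \<le> L * \<kappa> * r\<^sup>2"
      using L(4) \<kappa> r(1) by (simp add: divide_le_eq mult.assoc)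
    define \<rho> where "\<rho> = 4 * \<omega> / (L * \<kappa>)"
    have \<rho>0: "0 < \<rho>" using \<omega> L \<kappa> by (simp add: \<rho>_def)
    have L\<rho>: "L * \<kappa> * \<rho> = 4 * \<omega>" using L \<kappa> by (simp add: \<rho>_def)
    have "8 * \<omega> \<le> L * \<kappa> * d" using L(5) \<kappa> d(1) by (simp add: divide_le_eq mult.assoc)
    then have "L * \<kappa> * \<rho> < L * \<kappa> * d" using L\<rho> \<omega> by linarith
    then have \<rho>: "\<rho> < d" using L \<kappa> by (simp add: mult_less_cancel_left_pos)
    define f where "f = bump_test a R p L"
    have f: "f x = L * (1 - bump a R x) + bump a R x * (p \<bullet> (x - a))" for x
      by (simp add: f_def bump_test_def algebra_simps)
    have fD: "f \<in> Ccc_inf E" unfolding f_def by (rule bump_test_mem[OF R])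
    have chi01: "0 \<le> bump a R x" "bump a R x \<le> 1" for x by (auto simp: bump_nonneg bump_le_1 R)
    have chip: "- (P * dist x a) \<le> bump a R x * (p \<bullet> (x - a))" for x
    proof -
      have "\<bar>bump a R x * (p \<bullet> (x - a))\<bar> \<le> 1 * (P * dist x a)"
        unfolding abs_mult using chi01 pz by (intro mult_mono) auto
      then show ?thesis by linarith
    qed
    have chiout: "bump a R x = 0" if "R < dist x a" for x using bump_outside[OF R(1), of x a] that by simp
    have fge: "- (P * R) \<le> f x" for x
    proof (cases "dist x a \<le> R")
      case True
      have "0 \<le> L * (1 - bump a R x)" using chi01 L by simp
      moreover have "P * dist x a \<le> P * R" using True P by (intro mult_left_mono)
      ultimately show ?thesis using chip[of x] by (simp add: f)
    next
      case False
      then show ?thesis using chiout[of x] L P R by (simp add: f) (smt (verit) mult_nonneg_nonneg)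
    qed
    \<comment> \<open>Points at distance \<rho> or more lose a definite amount against
      \<open>a\<close>, so late members of the sequence for \<open>f\<close> must lie
      closer.\<close>
    have far: "u x - f x \<le> u a - min (\<omega> * \<rho>) 1" if x: "x \<in> E" "\<rho> \<le> dist x a" for x
    proof -
      consider "R < dist x a" | "dist x a \<le> R" "r \<le> dist x a" | "dist x a \<le> R" "dist x a < r" by linarith
      then show ?thesis
      proof cases
        case 1
        then show ?thesis using chiout[of x] B[OF x(1)] L(3) by (simp add: f)
      next
        case 2
        have "L * \<kappa> * r\<^sup>2 \<le> L * \<kappa> * (dist x a)\<^sup>2"
          using 2 r(1) L \<kappa> by (intro mult_left_mono power_mono) auto
        also have "\<dots> \<le> L * (1 - bump a R x)"
          using chi[OF 2(1)] L by (simp add: mult.assoc)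
        finally have "B - u a + 1 + P * R \<le> L * (1 - bump a R x)" using L4 by linarith
        moreover have "P * dist x a \<le> P * R" using 2 P by (intro mult_left_mono)
        ultimately show ?thesis using chip[of x] B[OF x(1)] by (simp add: f)
      next
        case 3
        have "P * dist x a \<le> P * R" using 3 P by (intro mult_left_mono)
        then have half: "L / 2 \<le> L - p \<bullet> (x - a)" using pz[of x] L(2) by linarith
        have "\<rho> * dist x a \<le> dist x a * dist x a" using x(2) by (intro mult_right_mono) auto
        then have "L * \<kappa> * (\<rho> * dist x a) \<le> L * \<kappa> * (dist x a)\<^sup>2"
          using L \<kappa> by (intro mult_left_mono) (auto simp: power2_eq_square)
        \<comment> \<open>Beyond \<rho> the quadratic penalty is at least twice the error
          \<open>\<omega> * dist x a\<close> allowed by the jet, which leaves a loss of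
          \<open>\<omega> * dist x a\<close>.\<close>
        then have "2 * \<omega> * dist x a \<le> L / 2 * (\<kappa> * (dist x a)\<^sup>2)"
          using L\<rho> by (simp add: mult.assoc[symmetric])
        also have "\<dots> \<le> (L - p \<bullet> (x - a)) * (1 - bump a R x)"
          using half chi[OF 3(1)] L \<kappa> by (intro mult_mono) auto
        also have "\<dots> = f x - p \<bullet> (x - a)" by (simp add: f algebra_simps)
        finally have "u x - f x \<le> u a - \<omega> * dist x a" using r(2)[OF x(1) 3(2)] by linarith
        moreover have "\<omega> * \<rho> \<le> \<omega> * dist x a" using x(2) \<omega> by (intro mult_left_mono) auto
        ultimately show ?thesis by linarith
      qed
    qed
    obtain xs l where xs: "\<And>n. xs n \<in> E" "(\<lambda>n. u (xs n) - f (xs n)) \<longlonglongrightarrow> (SUP z\<in>E. u z - f z)"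
      "l \<le> 0" "(\<lambda>n. u (xs n) - lam * H (xs n) (gradient_on E f (xs n)) - h (xs n)) \<longlonglongrightarrow> l"
      using u fD unfolding viscosity_subsolution_def by blast
    have "f a = 0" by (simp add: f bump_center[OF R(1)])
    moreover have "u a - f a \<le> (SUP z\<in>E. u z - f z)"
    proof (rule cSUP_upper[OF a])
      have "u z - f z \<le> B + P * R" if "z \<in> E" for z using B[OF that] fge[of z] by linarith
      then show "bdd_above ((\<lambda>z. u z - f z) ` E)" by (auto intro!: bdd_aboveI)
    qed
    \<comment> \<open>The inner minimum localises the point by \<open>far\<close>. The outer
      \<omega> is one of the three in the conclusion; the other two come from
      \<open>- \<omega> \<le> f x\<close> and from the residual of the equation.\<close>
    ultimately have "u a - min (min (\<omega> * \<rho>) 1) \<omega> < (SUP z\<in>E. u z - f z)"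
      using \<omega> \<rho>0 by (smt (verit) mult_pos_pos)
    then have "\<forall>\<^sub>F n in sequentially. u a - min (min (\<omega> * \<rho>) 1) \<omega> < u (xs n) - f (xs n)"
      using xs(2) by (rule order_tendstoD(1)[rotated])
    moreover have "l < \<omega>" using xs(3) \<omega> by linarith
    then have "\<forall>\<^sub>F n in sequentially. u (xs n) - lam * H (xs n) (gradient_on E f (xs n)) - h (xs n) < \<omega>"
      using xs(4) by (rule order_tendstoD(2)[rotated])
    ultimately have "\<forall>\<^sub>F n in sequentially. u a - min (min (\<omega> * \<rho>) 1) \<omega> < u (xs n) - f (xs n) \<and>
        u (xs n) - lam * H (xs n) (gradient_on E f (xs n)) - h (xs n) < \<omega>" by (rule eventually_conj)
    then obtain n where n: "u a - min (min (\<omega> * \<rho>) 1) \<omega> < u (xs n) - f (xs n)"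
        "u (xs n) - lam * H (xs n) (gradient_on E f (xs n)) - h (xs n) < \<omega>"
      using eventually_happens' by (metis (no_types, lifting) sequentially_bot)
    define x where "x = xs n"
    define q where "q = bump_test_grad a R p L x"
    have xE: "x \<in> E" by (simp add: x_def xs)
    have q: "gradient_on E f x = q" unfolding f_def q_def by (rule bump_test_gradient[OF E xE])
    have dx: "dist x a < \<rho>" using far[OF xE] n(1) unfolding x_def[symmetric] by linarith
    have "P * dist x a \<le> P * (\<omega> / (P + 1))" using dx \<rho> d P by (intro mult_left_mono) auto
    also have "\<dots> \<le> \<omega>" using P \<omega> by (simp add: field_simps)
    finally have "- \<omega> \<le> bump a R x * (p \<bullet> (x - a))" using chip[of x] by linarith
    moreover have "0 \<le> L * (1 - bump a R x)" using chi01 L by simp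
    ultimately have "- \<omega> \<le> f x" by (simp add: f)
    then have main: "u a - 3 * \<omega> \<le> lam * H x q + h x"
      using n unfolding x_def[symmetric] q by linarith
    have "norm (q - p) \<le> \<bar>bump a R x - 1\<bar> * P +
        \<bar>2 * (p \<bullet> (x - a) - L) * e * flat_exp 2 (R\<^sup>2 - (x - a) \<bullet> (x - a))\<bar> * dist x a"
    proof -
      define k where "k = 2 * (p \<bullet> (x - a) - L) * e * flat_exp 2 (R\<^sup>2 - (x - a) \<bullet> (x - a))"
      have "q - p = (bump a R x - 1) *\<^sub>R p - k *\<^sub>R (x - a)"
        by (simp add: q_def bump_test_grad_def e_def k_def scaleR_diff_left)
      then show ?thesis
        unfolding k_def[symmetric] P_def dist_norm by (metis norm_scaleR norm_triangle_ineq4)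
    qed
    also have "\<dots> \<le> \<omega> + 32 * e / \<kappa> * \<omega>"
    proof (rule add_mono)
      have "\<bar>bump a R x - 1\<bar> * P \<le> \<omega> / (P + 1) * P"
        using \<delta>(2)[of x] dx \<rho> d P by (intro mult_right_mono) auto
      also have "\<dots> \<le> \<omega>" using P \<omega> by (simp add: field_simps)
      finally show "\<bar>bump a R x - 1\<bar> * P \<le> \<omega>" .
      have fl: "0 \<le> flat_exp 2 t" "flat_exp 2 t \<le> 2" for t
        using flat_exp_le[of 2 t 0] flat_exp_nonneg[of 2 t] by (auto simp: numeral_2_eq_2)
      have "P * dist x a \<le> P * R" using dx \<rho> d P by (intro mult_left_mono) auto
      then have "\<bar>p \<bullet> (x - a) - L\<bar> \<le> 2 * L" using pz[of x] L by linarith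
      then have "\<bar>2 * (p \<bullet> (x - a) - L) * e * flat_exp 2 (R\<^sup>2 - (x - a) \<bullet> (x - a))\<bar> * dist x a
          \<le> (2 * (2 * L) * e * 2) * \<rho>"
        unfolding abs_mult using e fl L dx by (intro mult_mono) auto
      also have "\<dots> = 8 * e * (L * \<kappa> * \<rho>) / \<kappa>" using \<kappa> by (simp add: field_simps)
      also have "\<dots> = 32 * e / \<kappa> * \<omega>" unfolding L\<rho> by simp
      finally show "\<bar>2 * (p \<bullet> (x - a) - L) * e * flat_exp 2 (R\<^sup>2 - (x - a) \<bullet> (x - a))\<bar> * dist x a
          \<le> 32 * e / \<kappa> * \<omega>" .
    qed
    finally have "norm (q - p) \<le> (1 + 32 * e / \<kappa>) * \<omega>" by (simp add: distrib_right)
    moreover have "dist x a < \<omega>" using dx \<rho> d by linarith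
    ultimately show ?thesis using main xE by blast
  qed
  then show ?thesis by blast
qed

text \<open>The constant in the approximate inequality is independent of \<omega>, so \<omega> can
  tend to 0, and continuity of \<open>H\<close> and \<open>h\<close> gives the inequality at
  \<open>a\<close> itself.\<close>

lemma subsolution_superjet:
  assumes E: "E \<subseteq> closure (interior E)"
    and u: "viscosity_subsolution E (Ccc_inf E) (\<lambda>f x. H x (gradient_on E f x)) lam h u"
    and H: "continuous_on (E \<times> UNIV) (\<lambda>(x, p). H x p)" and h: "continuous_on E h"
    and a: "a \<in> E" and p: "p \<in> superjet E u a" and R: "0 < R" "compact (E \<inter> cball a R)"
  shows "u a \<le> lam * H a p + h a"
proof -
  obtain C where C: "\<And>\<omega>. 0 < \<omega> \<Longrightarrow> \<exists>x\<in>E. \<exists>q. dist x a < \<omega> \<and> norm (q - p) \<le> C * \<omega> \<and>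
      u a - 3 * \<omega> \<le> lam * H x q + h x"
    using subsolution_near_superjet[OF E u a p R] by blast
  define \<omega> where "\<omega> n = inverse (real (Suc n))" for n
  have \<omega>: "0 < \<omega> n" for n by (simp add: \<omega>_def)
  have \<omega>0: "\<omega> \<longlonglongrightarrow> 0" unfolding \<omega>_def by (rule LIMSEQ_inverse_real_of_nat)
  have "\<forall>n. \<exists>x q. x \<in> E \<and> dist x a < \<omega> n \<and> norm (q - p) \<le> C * \<omega> n \<and> u a - 3 * \<omega> n \<le> lam * H x q + h x"
    using C \<omega> by blast
  then obtain x q where xq: "\<And>n. x n \<in> E" "\<And>n. dist (x n) a < \<omega> n" "\<And>n. norm (q n - p) \<le> C * \<omega> n"
    "\<And>n. u a - 3 * \<omega> n \<le> lam * H (x n) (q n) + h (x n)" by metis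
  have x: "x \<longlonglongrightarrow> a"
    by (rule metric_tendsto_imp_tendsto[OF \<omega>0]) (use xq(2) \<omega> in \<open>auto intro!: always_eventually simp: less_imp_le\<close>)
  have "(\<lambda>n. q n - p) \<longlonglongrightarrow> 0"
    by (rule Lim_null_comparison[of _ "\<lambda>n. C * \<omega> n"]) (use xq(3) tendsto_mult_right_zero[OF \<omega>0] in auto)
  then have q: "q \<longlonglongrightarrow> p" by (simp add: LIM_zero_iff)
  have "(\<lambda>n. (\<lambda>(x, p). H x p) (x n, q n)) \<longlonglongrightarrow> (\<lambda>(x, p). H x p) (a, p)"
    by (rule continuous_on_tendsto_compose[OF H tendsto_Pair[OF x q]]) (use a xq in auto)
  then have "(\<lambda>n. lam * H (x n) (q n) + h (x n)) \<longlonglongrightarrow> lam * H a p + h a"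
    using continuous_on_tendsto_compose[OF h x a] xq(1) by (intro tendsto_add tendsto_mult) auto
  moreover have "(\<lambda>n. u a - 3 * \<omega> n) \<longlonglongrightarrow> u a - 3 * 0" by (intro tendsto_intros \<omega>0)
  ultimately have "u a - 3 * 0 \<le> lam * H a p + h a" using xq(4) by (intro LIMSEQ_le) auto
  then show ?thesis by simp
qed

section \<open>Negation, and subjets of supersolutions\<close>

lemma Ck_on_cong:
  assumes "open U" "Ck_on k F U" "\<And>x. x \<in> U \<Longrightarrow> F x = G x"
  shows "Ck_on k G U"
  using assms(2,3)
proof (induction k arbitrary: F G)
  case 0
  then show ?case using continuous_on_cong[of U U F G] by simp
next
  case (Suc k)
  have d: "(G has_derivative frechet_derivative F (at x)) (at x)" if "x \<in> U" for x
  proof (rule has_derivative_transform_within_open[OF _ assms(1) that])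
    show "(F has_derivative frechet_derivative F (at x)) (at x)"
      using Suc.prems that frechet_derivative_works by auto
  qed (use Suc.prems in auto)
  then have eq: "frechet_derivative F (at x) = frechet_derivative G (at x)" if "x \<in> U" for x
    using frechet_derivative_at that by blast
  have "Ck_on k (\<lambda>x. frechet_derivative G (at x) v) U" for v
    by (rule Suc.IH[of "\<lambda>x. frechet_derivative F (at x) v"]) (use Suc.prems eq in auto)
  then show ?case using d by (auto simp: differentiable_def)
qed

lemma Ck_on_minus:
  assumes "open U" "Ck_on k F U" shows "Ck_on k (\<lambda>x. - F x) U"
  using assms(2)
proof (induction k arbitrary: F)
  case 0
  then show ?case by (auto intro: continuous_intros)
next
  case (Suc k)
  have d: "((\<lambda>x. - F x) has_derivative (\<lambda>v. - frechet_derivative F (at x) v)) (at x)" if "x \<in> U" for x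
    using Suc.prems that frechet_derivative_works by (auto intro!: has_derivative_minus)
  have eq: "- frechet_derivative F (at x) v = frechet_derivative (\<lambda>x. - F x) (at x) v" if "x \<in> U" for x v
    using frechet_derivative_at[OF d[OF that]] by metis
  have "Ck_on k (\<lambda>x. frechet_derivative (\<lambda>x. - F x) (at x) v) U" for v
    by (rule Ck_on_cong[OF assms(1) Suc.IH[of "\<lambda>x. frechet_derivative F (at x) v"]]) (use Suc.prems eq in auto)
  then show ?case using d by (auto simp: differentiable_def)
qed

lemma Ccc_inf_minus:
  assumes "f \<in> Ccc_inf E" shows "(\<lambda>x. - f x) \<in> Ccc_inf E"
proof -
  obtain U F K c where *: "open U" "E \<subseteq> U" "\<forall>k. Ck_on k F U" "\<forall>x\<in>E. F x = f x"
    "compact K" "K \<subseteq> E" "\<forall>x\<in>E - K. f x = c"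
    using assms unfolding Ccc_inf_def Cinf_def by blast
  then have "(\<lambda>x. - f x) \<in> Cinf E"
    unfolding Cinf_def by (intro CollectI exI[of _ U] exI[of _ "\<lambda>x. - F x"]) (auto intro: Ck_on_minus)
  moreover have "\<forall>x\<in>E - K. - f x = - c" using * by simp
  ultimately show ?thesis using *(5,6) unfolding Ccc_inf_def by blast
qed

lemma C1_extension_GDERIV:
  assumes "C1_extension E f U F" "x \<in> U" obtains g where "GDERIV F x :> g"
proof -
  have d: "(F has_derivative frechet_derivative F (at x)) (at x)"
    using assms frechet_derivative_works by (auto simp: C1_extension_def)
  then have "GDERIV F x :> (\<Sum>b\<in>Basis. frechet_derivative F (at x) b *\<^sub>R b)"
    unfolding gderiv_def
  proof (rule has_derivative_eq_rhs)
    have "frechet_derivative F (at x) v = v \<bullet> (\<Sum>b\<in>Basis. frechet_derivative F (at x) b *\<^sub>R b)" for v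
    proof -
      have "frechet_derivative F (at x) v = frechet_derivative F (at x) (\<Sum>b\<in>Basis. (v \<bullet> b) *\<^sub>R b)"
        by (simp add: euclidean_representation)
      then show ?thesis
        using has_derivative_linear[OF d] by (simp add: linear_sum linear_scale inner_sum_right mult.commute)
    qed
    then show "frechet_derivative F (at x) = (\<lambda>v. v \<bullet> (\<Sum>b\<in>Basis. frechet_derivative F (at x) b *\<^sub>R b))"
      by blast
  qed
  then show ?thesis using that by blast
qed

lemma Cinf_subset_C1: "Cinf E \<subseteq> C1 E"
  unfolding Cinf_def C1_def C1_extension_def by blast

lemma gradient_on_minus:
  assumes E: "E \<subseteq> closure (interior E)" and x: "x \<in> E" and f: "f \<in> C1 E"
  shows "gradient_on E (\<lambda>x. - f x) x = - gradient_on E f x"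
proof -
  obtain U F where F: "C1_extension E f U F" using f unfolding C1_def by blast
  then have xU: "x \<in> U" using x by (auto simp: C1_extension_def)
  obtain g where g: "GDERIV F x :> g" by (rule C1_extension_GDERIV[OF F xU])
  have F': "C1_extension E (\<lambda>x. - f x) U (\<lambda>x. - F x)"
    using F Ck_on_minus[of U 1 F] unfolding C1_extension_def by auto
  have "GDERIV (\<lambda>x. - F x) x :> - g" using g by (rule GDERIV_minus)
  then show ?thesis using gradient_on_eq[OF E x F g] gradient_on_eq[OF E x F'] by simp
qed

text \<open>Negation turns the Hamiltonian into \<open>- H x (- p)\<close>, for which convexity
  becomes concavity. The superjet inequality relies on continuity only, so it may be transferred in
  this way.\<close>

lemma supersolution_uminus:
  assumes E: "E \<subseteq> closure (interior E)"
    and v: "viscosity_supersolution E (Ccc_inf E) (\<lambda>f x. H x (gradient_on E f x)) lam h v"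
  shows "viscosity_subsolution E (Ccc_inf E) (\<lambda>f x. - H x (- gradient_on E f x)) lam (\<lambda>x. - h x) (\<lambda>x. - v x)"
  unfolding viscosity_subsolution_def
proof (intro conjI ballI)
  show "bdd_above ((\<lambda>x. - v x) ` E)"
    using v by (auto simp: viscosity_supersolution_def bdd_above_def bdd_below_def) (meson neg_le_iff_le)
  show "usc_on E (\<lambda>x. - v x)" using v by (auto simp: viscosity_supersolution_def intro: lsc_on_uminus)
  fix f assume f: "f \<in> Ccc_inf E"
  then have C1: "f \<in> C1 E" using Cinf_subset_C1 by (auto simp: Ccc_inf_def)
  let ?f = "\<lambda>x. - f x"
  have "\<forall>f\<in>Ccc_inf E. \<exists>x. (\<forall>n. x n \<in> E) \<and> (\<lambda>n. v (x n) - f (x n)) \<longlonglongrightarrow> (INF z\<in>E. v z - f z) \<and>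
      (\<exists>L\<ge>0. (\<lambda>n. v (x n) - lam * H (x n) (gradient_on E f (x n)) - h (x n)) \<longlonglongrightarrow> L)"
    using v unfolding viscosity_supersolution_def by (elim conjE)
  from bspec[OF this Ccc_inf_minus[OF f]]
  obtain xs l where xs: "\<forall>n. xs n \<in> E" "(\<lambda>n. v (xs n) - ?f (xs n)) \<longlonglongrightarrow> (INF z\<in>E. v z - ?f z)"
    "l \<ge> 0" "(\<lambda>n. v (xs n) - lam * H (xs n) (gradient_on E ?f (xs n)) - h (xs n)) \<longlonglongrightarrow> l"
    by blast
  have "(INF z\<in>E. v z - ?f z) = - (SUP z\<in>E. - v z - f z)"
    by (simp add: Inf_real_def image_image)
  then have "(\<lambda>n. - v (xs n) - f (xs n)) \<longlonglongrightarrow> (SUP z\<in>E. - v z - f z)"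
    using tendsto_minus[OF xs(2)] by simp
  moreover have "(\<lambda>n. - v (xs n) - lam * - H (xs n) (- gradient_on E f (xs n)) - - h (xs n)) \<longlonglongrightarrow> - l"
    using tendsto_minus[OF xs(4)] xs(1) by (simp add: gradient_on_minus[OF E _ C1] algebra_simps)
  ultimately show "\<exists>x. (\<forall>n. x n \<in> E) \<and> (\<lambda>n. - v (x n) - f (x n)) \<longlonglongrightarrow> (SUP z\<in>E. - v z - f z) \<and>
      (\<exists>L\<le>0. (\<lambda>n. - v (x n) - lam * - H (x n) (- gradient_on E f (x n)) - - h (x n)) \<longlonglongrightarrow> L)"
    using xs(1,3) by (intro exI[of _ xs] conjI exI[of _ "- l"]) auto
qed

lemma supersolution_subjet:
  assumes E: "E \<subseteq> closure (interior E)"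
    and v: "viscosity_supersolution E (Ccc_inf E) (\<lambda>f x. H x (gradient_on E f x)) lam h v"
    and H: "continuous_on (E \<times> UNIV) (\<lambda>(x, p). H x p)" and h: "continuous_on E h"
    and a: "a \<in> E" and p: "- p \<in> superjet E (\<lambda>x. - v x) a" and R: "0 < R" "compact (E \<inter> cball a R)"
  shows "lam * H a p + h a \<le> v a"
proof -
  have "continuous_on (E \<times> UNIV) (\<lambda>z. - (\<lambda>(x, p). H x p) (fst z, - snd z))"
    by (intro continuous_on_minus continuous_on_compose2[OF H]) (auto intro!: continuous_intros)
  then have H': "continuous_on (E \<times> UNIV) (\<lambda>(x, p). - H x (- p))" by (simp add: case_prod_unfold)
  show ?thesis
    using subsolution_superjet[where H="\<lambda>x p. - H x (- p)", OF E supersolution_uminus[OF E v] H' continuous_on_minus[OF h] a p R]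
    by simp
qed

subsection \<open>Gradients of functions on a set and of penalization functions\<close>

lemma gradient_on_GDERIV:
  assumes "E \<subseteq> closure (interior E)" "C1_extension E f U F" "x \<in> E"
  shows "GDERIV F x :> gradient_on E f x"
  using assms C1_extension_GDERIV[of E f U F x] gradient_on_eq[OF assms(1,3,2)]
  by (metis C1_extension_def subsetD)

lemma gradient_on_has_derivative:
  assumes E: "E \<subseteq> closure (interior E)" and f: "f \<in> C1 E" and x: "x \<in> E"
  shows "(f has_derivative (\<lambda>v. gradient_on E f x \<bullet> v)) (at x within E)"
proof -
  obtain U F where F: "C1_extension E f U F" using f unfolding C1_def by blast
  have "(F has_derivative (\<lambda>v. gradient_on E f x \<bullet> v)) (at x within E)"
    using gradient_on_GDERIV[OF E F x] unfolding gderiv_def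
    by (simp add: inner_commute has_derivative_at_withinI)
  then show ?thesis
    by (rule has_derivative_transform[OF x, rotated]) (use F in \<open>auto simp: C1_extension_def\<close>)
qed

lemma C1_continuous_on:
  assumes "E \<subseteq> closure (interior E)" "f \<in> C1 E" shows "continuous_on E f"
  by (rule has_derivative_continuous_on) (rule gradient_on_has_derivative[OF assms])

lemma continuous_on_gradient_on:
  assumes E: "E \<subseteq> closure (interior E)" and f: "f \<in> C1 E"
  shows "continuous_on E (gradient_on E f)"
proof -
  obtain U F where F: "C1_extension E f U F" using f unfolding C1_def by blast
  have "gradient_on E f x = (\<Sum>b\<in>Basis. frechet_derivative F (at x) b *\<^sub>R b)" if "x \<in> E" for x
  proof -
    have "(F has_derivative (\<lambda>v. v \<bullet> gradient_on E f x)) (at x)"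
      using gradient_on_GDERIV[OF E F that] unfolding gderiv_def .
    then have "frechet_derivative F (at x) b = b \<bullet> gradient_on E f x" for b
      by (metis frechet_derivative_at)
    then show ?thesis by (simp add: inner_commute[of _ "gradient_on E f x"] euclidean_representation)
  qed
  moreover have "continuous_on E (\<lambda>x. \<Sum>b\<in>Basis. frechet_derivative F (at x) b *\<^sub>R b)"
  proof (intro continuous_on_sum continuous_on_scaleR continuous_on_const)
    fix b :: 'a
    have "continuous_on U (\<lambda>x. frechet_derivative F (at x) b)" "E \<subseteq> U"
      using F by (auto simp: C1_extension_def)
    then show "continuous_on E (\<lambda>x. frechet_derivative F (at x) b)" by (rule continuous_on_subset)
  qed
  ultimately show ?thesis by (metis (no_types, lifting) continuous_on_cong)
qed

lemma subset_closure_interior_Times: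
  assumes "E \<subseteq> closure (interior E)"
  shows "E \<times> E \<subseteq> closure (interior (E \<times> E))"
  using assms by (auto simp: interior_Times closure_Times)

text \<open>Chain rule along a map whose derivative \<open>L\<close> is the same at every point,
  such as \<open>z \<mapsto> (z, y)\<close>: composing with \<open>e\<close> turns a C1 extension of
  \<open>f\<close> into one on the preimage of its open set. The condition on \<open>g\<close> says
  that \<open>g\<close> is the adjoint of \<open>L\<close> applied to the gradient.\<close>

lemma gradient_on_slice:
  fixes e :: "'a::euclidean_space \<Rightarrow> 'b::euclidean_space"
  assumes E: "E \<subseteq> closure (interior E)" and S: "S \<subseteq> closure (interior S)"
    and f: "f \<in> C1 S" and e: "\<And>z. (e has_derivative L) (at z)" "\<And>z. z \<in> E \<Longrightarrow> e z \<in> S"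
    and L: "\<And>v. L v \<bullet> gradient_on S f (e x) = v \<bullet> g" and x: "x \<in> E"
  shows "gradient_on E (\<lambda>z. f (e z)) x = g"
proof -
  obtain U F where F: "C1_extension S f U F" using f unfolding C1_def by blast
  have U: "open U" "S \<subseteq> U" and FU: "\<And>z. z \<in> U \<Longrightarrow> F differentiable (at z)"
    and Fc: "\<And>v. continuous_on U (\<lambda>x. frechet_derivative F (at x) v)" and Fe: "\<And>z. z \<in> S \<Longrightarrow> F z = f z"
    using F by (auto simp: C1_extension_def)
  have ec: "continuous_on T e" for T
    using e(1) by (meson continuous_at_imp_continuous_on has_derivative_continuous)
  have d: "((\<lambda>z. F (e z)) has_derivative (\<lambda>v. frechet_derivative F (at (e z)) (L v))) (at z)" if "e z \<in> U" for z
    by (rule has_derivative_compose[OF e(1)]) (use FU[OF that] frechet_derivative_works in blast)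
  then have fd: "frechet_derivative (\<lambda>z. F (e z)) (at z) = (\<lambda>v. frechet_derivative F (at (e z)) (L v))" if "e z \<in> U" for z
    using that by (metis frechet_derivative_at)
  have ext: "C1_extension E (\<lambda>z. f (e z)) (e -` U) (\<lambda>z. F (e z))"
    unfolding C1_extension_def
  proof (intro conjI ballI)
    show "open (e -` U)" using ec[of UNIV] U(1) by (simp add: continuous_on_open_vimage)
    show "E \<subseteq> e -` U" using e(2) U by blast
    show "F (e z) = f (e z)" if "z \<in> E" for z using Fe e(2) that by blast
    have "continuous_on (e -` U) (\<lambda>z. frechet_derivative F (at (e z)) (L v))" for v
      by (rule continuous_on_compose2[OF Fc ec]) auto
    then have "continuous_on (e -` U) (\<lambda>z. frechet_derivative (\<lambda>z. F (e z)) (at z) v)" for v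
      by (rule continuous_on_eq) (simp add: fd)
    then show "Ck_on 1 (\<lambda>z. F (e z)) (e -` U)"
      using d by (auto simp: differentiable_def)
  qed
  have "(F has_derivative (\<lambda>v. v \<bullet> gradient_on S f (e x))) (at (e x))"
    using gradient_on_GDERIV[OF S F e(2)[OF x]] unfolding gderiv_def .
  from has_derivative_compose[OF e(1) this] have "GDERIV (\<lambda>z. F (e z)) x :> g"
    unfolding gderiv_def L .
  then show ?thesis by (rule gradient_on_eq[OF E x ext])
qed

lemma grad1_eq:
  assumes E: "E \<subseteq> closure (interior E)" and f: "(\<lambda>(x, y). \<Psi> x y) \<in> C1 (E \<times> E)" and xy: "x \<in> E" "y \<in> E"
  shows "grad1 E \<Psi> x y = fst (gradient_on (E \<times> E) (\<lambda>(x, y). \<Psi> x y) (x, y))"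
  using gradient_on_slice[OF E subset_closure_interior_Times[OF E] f
      has_derivative_Pair[OF has_derivative_ident has_derivative_const], of y x
      "fst (gradient_on (E \<times> E) (\<lambda>(x, y). \<Psi> x y) (x, y))"] xy
  by (simp add: grad1_def inner_prod_def)

lemma grad2_eq:
  assumes E: "E \<subseteq> closure (interior E)" and f: "(\<lambda>(x, y). \<Psi> x y) \<in> C1 (E \<times> E)" and xy: "x \<in> E" "y \<in> E"
  shows "grad2 E \<Psi> x y = snd (gradient_on (E \<times> E) (\<lambda>(x, y). \<Psi> x y) (x, y))"
  using gradient_on_slice[OF E subset_closure_interior_Times[OF E] f
      has_derivative_Pair[OF has_derivative_const has_derivative_ident], of x y
      "snd (gradient_on (E \<times> E) (\<lambda>(x, y). \<Psi> x y) (x, y))"] xy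
  by (simp add: grad2_def inner_prod_def)

lemma continuous_on_grad1:
  assumes E: "E \<subseteq> closure (interior E)" and f: "(\<lambda>(x, y). \<Psi> x y) \<in> C1 (E \<times> E)"
  shows "continuous_on (E \<times> E) (\<lambda>(x, y). grad1 E \<Psi> x y)"
  using continuous_on_fst[OF continuous_on_gradient_on[OF subset_closure_interior_Times[OF E] f]]
  by (rule continuous_on_eq) (auto simp: grad1_eq[OF E f])

lemma grad1_has_derivative:
  assumes E: "E \<subseteq> closure (interior E)" and f: "(\<lambda>(x, y). \<Psi> x y) \<in> C1 (E \<times> E)" and xy: "x \<in> E" "y \<in> E"
  shows "((\<lambda>z. \<Psi> z y) has_derivative (\<lambda>v. grad1 E \<Psi> x y \<bullet> v)) (at x within E)"
proof -
  have 1: "((\<lambda>(x, y). \<Psi> x y) has_derivative (\<lambda>v. gradient_on (E \<times> E) (\<lambda>(x, y). \<Psi> x y) (x, y) \<bullet> v)) (at (x, y) within E \<times> E)"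
    by (rule gradient_on_has_derivative[OF subset_closure_interior_Times[OF E] f]) (use xy in auto)
  have 2: "((\<lambda>z. (z, y)) has_derivative (\<lambda>v. (v, 0))) (at x within E)"
    by (rule has_derivative_Pair[OF has_derivative_ident has_derivative_const])
  have "((\<lambda>z. (\<lambda>(x, y). \<Psi> x y) (z, y)) has_derivative
      (\<lambda>v. gradient_on (E \<times> E) (\<lambda>(x, y). \<Psi> x y) (x, y) \<bullet> (v, 0))) (at x within E)"
    by (rule has_derivative_in_compose[OF 2 has_derivative_subset[OF 1]]) (use xy in auto)
  then show ?thesis by (simp add: grad1_eq[OF E f xy] inner_prod_def)
qed

lemma grad2_has_derivative:
  assumes E: "E \<subseteq> closure (interior E)" and f: "(\<lambda>(x, y). \<Psi> x y) \<in> C1 (E \<times> E)" and xy: "x \<in> E" "y \<in> E"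
  shows "((\<lambda>z. \<Psi> x z) has_derivative (\<lambda>v. grad2 E \<Psi> x y \<bullet> v)) (at y within E)"
proof -
  have 1: "((\<lambda>(x, y). \<Psi> x y) has_derivative (\<lambda>v. gradient_on (E \<times> E) (\<lambda>(x, y). \<Psi> x y) (x, y) \<bullet> v)) (at (x, y) within E \<times> E)"
    by (rule gradient_on_has_derivative[OF subset_closure_interior_Times[OF E] f]) (use xy in auto)
  have 2: "((\<lambda>z. (x, z)) has_derivative (\<lambda>v. (0, v))) (at y within E)"
    by (rule has_derivative_Pair[OF has_derivative_const has_derivative_ident])
  have "((\<lambda>z. (\<lambda>(x, y). \<Psi> x y) (x, z)) has_derivative
      (\<lambda>v. gradient_on (E \<times> E) (\<lambda>(x, y). \<Psi> x y) (x, y) \<bullet> (0, v))) (at y within E)"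
    by (rule has_derivative_in_compose[OF 2 has_derivative_subset[OF 1]]) (use xy in auto)
  then show ?thesis by (simp add: grad2_eq[OF E f xy] inner_prod_def)
qed

lemma const_C1: "(\<lambda>_. c) \<in> C1 E"
  unfolding C1_def C1_extension_def
  by (intro CollectI exI[of _ UNIV] exI[of _ "\<lambda>_. c"]) auto

lemma gradient_on_const:
  assumes "E \<subseteq> closure (interior E)" "x \<in> E"
  shows "gradient_on E (\<lambda>_. c) x = 0"
  by (rule gradient_on_eq[OF assms, of _ UNIV "\<lambda>_. c"]) (auto simp: C1_extension_def GDERIV_const)

subsection \<open>A locally uniform form of the continuity estimates\<close>

text \<open>Sequences and limits are replaced by thresholds: the choice of \<open>n\<close> after
  \<open>\<alpha>\<^sub>2\<close> reflects the iterated lower limit, and the inverses stand for the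
  vanishing of the penalties. With \<open>\<Psi>\<^sub>2 = 0\<close> the same form covers a single
  penalization function.\<close>

definition uniform_estimate ::
  "'a::euclidean_space set \<Rightarrow> ('a \<Rightarrow> 'a \<Rightarrow> real) \<Rightarrow> ('a \<Rightarrow> 'a \<Rightarrow> real)
    \<Rightarrow> ('a \<Rightarrow> 'a \<Rightarrow> 't::topological_space \<Rightarrow> real) \<Rightarrow> bool" where
  "uniform_estimate E \<Psi>\<^sub>1 \<Psi>\<^sub>2 G \<longleftrightarrow>
    (\<forall>K K' C \<eta>. compact K \<and> K \<subseteq> E \<and> compact K' \<and> 0 < \<eta> \<longrightarrow>
      (\<exists>m. \<forall>\<alpha>\<^sub>2\<ge>real m. \<exists>n. \<forall>\<alpha>\<^sub>1\<ge>real n. \<forall>x\<in>K. \<forall>y\<in>K. \<forall>\<theta>\<in>K'.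
        \<alpha>\<^sub>1 * \<Psi>\<^sub>1 x y \<le> inverse (real (Suc n)) \<longrightarrow> \<alpha>\<^sub>2 * \<Psi>\<^sub>2 x y \<le> inverse (real (Suc m)) \<longrightarrow>
        G y (- pair_grad2 E \<Psi>\<^sub>1 \<Psi>\<^sub>2 \<alpha>\<^sub>1 \<alpha>\<^sub>2 x y) \<theta> \<le> C \<longrightarrow>
        - C \<le> G x (pair_grad1 E \<Psi>\<^sub>1 \<Psi>\<^sub>2 \<alpha>\<^sub>1 \<alpha>\<^sub>2 x y) \<theta> \<longrightarrow>
        G x (pair_grad1 E \<Psi>\<^sub>1 \<Psi>\<^sub>2 \<alpha>\<^sub>1 \<alpha>\<^sub>2 x y) \<theta> - G y (- pair_grad2 E \<Psi>\<^sub>1 \<Psi>\<^sub>2 \<alpha>\<^sub>1 \<alpha>\<^sub>2 x y) \<theta> < \<eta>))"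

text \<open>Fundamental collections index their points by the value of \<alpha>. The selected values
  must be distinct for a point to be recovered from its parameter, hence strict
  monotonicity.\<close>

lemma strict_mono_selection:
  fixes Q :: "nat \<Rightarrow> real \<Rightarrow> bool"
  assumes ex: "\<And>m. \<exists>a\<ge>real m. Q m a" and anti: "\<And>m n a. m \<le> n \<Longrightarrow> Q n a \<Longrightarrow> Q m a"
  shows "\<exists>f. strict_mono f \<and> (\<forall>k. real k < f k \<and> Q k (f k))"
proof -
  have "\<exists>f. \<forall>k. (real k < f k \<and> Q k (f k)) \<and> f k < f (Suc k)"
  proof (rule dependent_nat_choice)
    obtain a where "real 1 \<le> a" "Q 1 a" using ex[of 1] by blast
    then have "real 0 < a" "Q 0 a" using anti[of 0 1 a] by auto
    then show "\<exists>a. real 0 < a \<and> Q 0 a" by blast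
    fix a :: real and n
    obtain c where c: "real (max (Suc (Suc n)) (Suc (nat \<lceil>a\<rceil>))) \<le> c" "Q (max (Suc (Suc n)) (Suc (nat \<lceil>a\<rceil>))) c"
      using ex by blast
    have "a < real (Suc (nat \<lceil>a\<rceil>))" by linarith
    then have "a < c" "real (Suc n) < c" using c(1) by auto
    moreover have "Q (Suc n) c" using anti[OF _ c(2)] by simp
    ultimately show "\<exists>c. (real (Suc n) < c \<and> Q (Suc n) c) \<and> a < c" by blast
  qed
  then show ?thesis by (metis strict_mono_Suc_iff)
qed

text \<open>If no threshold worked, violating triples with parameters tending to infinity would form
  a fundamental collection: \<open>inverse (real (Suc n))\<close> supplies (C2) and \<open>C\<close>
  supplies (C3). Along it all differences are at least \<eta>, against the continuity
  estimate.\<close>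

lemma uniform_estimate_single:
  fixes G :: "'a::euclidean_space \<Rightarrow> 'a \<Rightarrow> 't::topological_space \<Rightarrow> real"
  assumes E: "E \<subseteq> closure (interior E)" and pen: "penalization E \<Psi>" and ce: "continuity_estimate E \<Psi> G"
  shows "uniform_estimate E \<Psi> (\<lambda>_ _. 0) G"
  unfolding uniform_estimate_def
proof (intro allI impI, elim conjE)
  fix K :: "'a set" and K' :: "'t set" and C \<eta> :: real assume K: "compact K" "K \<subseteq> E" "compact K'" and \<eta>: "0 < \<eta>"
  have pg1: "pair_grad1 E \<Psi> (\<lambda>_ _. 0) a1 a2 x y = a1 *\<^sub>R grad1 E \<Psi> x y" if "x \<in> K" "y \<in> K" for a1 a2 x y
    using that K by (auto simp: pair_grad1_def grad1_def gradient_on_const[OF E] subset_iff)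
  have pg2: "pair_grad2 E \<Psi> (\<lambda>_ _. 0) a1 a2 x y = a1 *\<^sub>R grad2 E \<Psi> x y" if "x \<in> K" "y \<in> K" for a1 a2 x y
    using that K by (auto simp: pair_grad2_def grad2_def gradient_on_const[OF E] subset_iff)
  have cont: "continuous_on (E \<times> E) (\<lambda>(x, y). \<Psi> x y)"
    using pen C1_continuous_on[OF subset_closure_interior_Times[OF E]] by (auto simp: penalization_def)
  define bad where "bad a x y \<theta> \<longleftrightarrow> G y (- (a *\<^sub>R grad2 E \<Psi> x y)) \<theta> \<le> C \<and> - C \<le> G x (a *\<^sub>R grad1 E \<Psi> x y) \<theta> \<and>
    \<eta> \<le> G x (a *\<^sub>R grad1 E \<Psi> x y) \<theta> - G y (- (a *\<^sub>R grad2 E \<Psi> x y)) \<theta>" for a x y \<theta>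
  have "\<exists>n. \<forall>a\<ge>real n. \<forall>x\<in>K. \<forall>y\<in>K. \<forall>\<theta>\<in>K'. a * \<Psi> x y \<le> inverse (real (Suc n)) \<longrightarrow> \<not> bad a x y \<theta>"
  proof (rule ccontr)
    assume no: "\<not> ?thesis"
    define Q where "Q n a \<longleftrightarrow> (\<exists>x\<in>K. \<exists>y\<in>K. \<exists>\<theta>\<in>K'. a * \<Psi> x y \<le> inverse (real (Suc n)) \<and> bad a x y \<theta>)" for n a
    have "\<exists>a\<ge>real n. Q n a" for n using no unfolding Q_def by blast
    moreover have "Q m a" if "m \<le> n" "Q n a" for m n a
    proof -
      have "inverse (real (Suc n)) \<le> inverse (real (Suc m))" using that by (intro le_imp_inverse_le) auto
      then show ?thesis using that unfolding Q_def by (meson order_trans)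
    qed
    ultimately have "\<exists>a. strict_mono a \<and> (\<forall>n. real n < a n \<and> Q n (a n))"
      by (rule strict_mono_selection)
    then obtain a where a: "strict_mono a" "\<And>n. real n < a n" "\<And>n. Q n (a n)" by blast
    have "\<forall>n. \<exists>x y \<theta>. x \<in> K \<and> y \<in> K \<and> \<theta> \<in> K' \<and> a n * \<Psi> x y \<le> inverse (real (Suc n)) \<and> bad (a n) x y \<theta>"
      using a(3) unfolding Q_def by blast
    then obtain X Y T where XYT: "\<And>n. X n \<in> K" "\<And>n. Y n \<in> K" "\<And>n. T n \<in> K'"
      "\<And>n. a n * \<Psi> (X n) (Y n) \<le> inverse (real (Suc n))" "\<And>n. bad (a n) (X n) (Y n) (T n)"
      by metis
    \<comment> \<open>Decodes the index from the value of \<alpha>. The same collection is used for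
      every \<epsilon>.\<close>
    have inv: "inv a (a n) = n" for n using a(1) strict_mono_eq by (intro inv_f_f injI) auto
    have a0: "0 < a n" for n using a(2)[of n] by (smt (verit) of_nat_0_le_iff)
    have pos: "0 \<le> \<Psi> (X n) (Y n)" for n
      using pen XYT(1,2)[of n] K(2) unfolding penalization_def by blast
    have a\<Psi>: "(\<lambda>n. a n * \<Psi> (X n) (Y n)) \<longlonglongrightarrow> 0"
    proof (rule tendsto_sandwich[OF _ _ tendsto_const LIMSEQ_inverse_real_of_nat])
      show "\<forall>\<^sub>F n in sequentially. 0 \<le> a n * \<Psi> (X n) (Y n)"
        using pos a0 by (intro always_eventually allI mult_nonneg_nonneg) (auto simp: less_imp_le)
      show "\<forall>\<^sub>F n in sequentially. a n * \<Psi> (X n) (Y n) \<le> inverse (real (Suc n))"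
        using XYT(4) by (intro always_eventually allI)
    qed
    have \<Psi>0: "(\<lambda>n. \<Psi> (X n) (Y n)) \<longlonglongrightarrow> 0"
    proof (rule tendsto_sandwich[OF _ _ tendsto_const a\<Psi>])
      show "\<forall>\<^sub>F n in sequentially. \<Psi> (X n) (Y n) \<le> a n * \<Psi> (X n) (Y n)"
        using eventually_ge_at_top[of 1]
      proof eventually_elim
        case (elim n)
        then have "1 \<le> a n" using a(2)[of n] by linarith
        then show ?case using pos[of n] mult_right_mono[of 1 "a n" "\<Psi> (X n) (Y n)"] by simp
      qed
    qed (use pos in auto)
    have c1: "filterlim a at_top sequentially"
      by (rule filterlim_at_top_mono[OF filterlim_real_sequentially]) (use a(2) in \<open>auto intro!: always_eventually less_imp_le\<close>)
    have c2: "\<Psi> x\<^sub>0 y\<^sub>0 = 0" if lim: "seq_limit_point (\<lambda>n. (X n, Y n)) (x\<^sub>0, y\<^sub>0)" for x\<^sub>0 y\<^sub>0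
    proof -
      obtain r where r: "strict_mono r" "((\<lambda>n. (X n, Y n)) \<circ> r) \<longlonglongrightarrow> (x\<^sub>0, y\<^sub>0)"
        using lim unfolding seq_limit_point_def by blast
      have "(x\<^sub>0, y\<^sub>0) \<in> K \<times> K"
        by (rule closed_sequentially[OF _ _ r(2)]) (use K XYT in \<open>auto intro: compact_imp_closed compact_Times\<close>)
      then have "(\<lambda>n. (\<lambda>(x, y). \<Psi> x y) (((\<lambda>n. (X n, Y n)) \<circ> r) n)) \<longlonglongrightarrow> (\<lambda>(x, y). \<Psi> x y) (x\<^sub>0, y\<^sub>0)"
        using K XYT by (intro continuous_on_tendsto_compose[OF cont r(2)]) (auto intro!: always_eventually)
      then have "(\<lambda>n. \<Psi> (X (r n)) (Y (r n))) \<longlonglongrightarrow> \<Psi> x\<^sub>0 y\<^sub>0" by simp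
      moreover have "(\<lambda>n. \<Psi> (X (r n)) (Y (r n))) \<longlonglongrightarrow> 0"
        using LIMSEQ_subseq_LIMSEQ[OF \<Psi>0 r(1)] by (simp add: o_def)
      ultimately show ?thesis by (rule LIMSEQ_unique)
    qed
    have "(SUP \<alpha>\<in>range a. ereal (G (Y (inv a \<alpha>)) (- (\<alpha> *\<^sub>R grad2 E \<Psi> (X (inv a \<alpha>)) (Y (inv a \<alpha>)))) (T (inv a \<alpha>)))) \<le> ereal C"
      using XYT(5) by (intro SUP_least) (auto simp: inv bad_def)
    then have c3: "(SUP \<alpha>\<in>range a. ereal (G (Y (inv a \<alpha>)) (- (\<alpha> *\<^sub>R grad2 E \<Psi> (X (inv a \<alpha>)) (Y (inv a \<alpha>)))) (T (inv a \<alpha>)))) < \<infinity>"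
      by (rule le_less_trans) simp
    have "ereal (- C) \<le> (INF \<alpha>\<in>range a. ereal (G (X (inv a \<alpha>)) (\<alpha> *\<^sub>R grad1 E \<Psi> (X (inv a \<alpha>)) (Y (inv a \<alpha>))) (T (inv a \<alpha>))))"
      using XYT(5) by (intro INF_greatest) (auto simp: inv bad_def)
    then have c4: "- \<infinity> < (INF \<alpha>\<in>range a. ereal (G (X (inv a \<alpha>)) (\<alpha> *\<^sub>R grad1 E \<Psi> (X (inv a \<alpha>)) (Y (inv a \<alpha>))) (T (inv a \<alpha>))))"
      by (rule less_le_trans[rotated]) simp
    have "fundamental E \<Psi> G (\<lambda>_. a) (\<lambda>_ \<alpha>. X (inv a \<alpha>)) (\<lambda>_ \<alpha>. Y (inv a \<alpha>)) (\<lambda>_ \<alpha>. T (inv a \<alpha>))"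
      unfolding fundamental_def inv
    proof (intro allI impI conjI)
      show "\<exists>K K'. compact K \<and> K \<subseteq> E \<and> compact K' \<and> (\<forall>n. X n \<in> K \<and> Y n \<in> K \<and> T n \<in> K')"
        using K XYT(1-3) by (intro exI[of _ K] exI[of _ K']) simp
    qed (rule a0 c1 a\<Psi> c3 c4 | erule c2)+
    from ce[unfolded continuity_estimate_def, rule_format, OF this zero_less_one]
    have "liminf (\<lambda>n. ereal (G (X n) (a n *\<^sub>R grad1 E \<Psi> (X n) (Y n)) (T n)
        - G (Y n) (- (a n *\<^sub>R grad2 E \<Psi> (X n) (Y n))) (T n))) \<le> 0"
      unfolding Let_def inv .
    moreover have "ereal \<eta> \<le> liminf (\<lambda>n. ereal (G (X n) (a n *\<^sub>R grad1 E \<Psi> (X n) (Y n)) (T n)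
        - G (Y n) (- (a n *\<^sub>R grad2 E \<Psi> (X n) (Y n))) (T n)))"
      using XYT(5) by (intro Liminf_bounded always_eventually) (auto simp: bad_def)
    ultimately have "ereal \<eta> \<le> 0" by (rule order_trans[rotated])
    then show False using \<eta> by simp
  qed
  then obtain n where n: "\<forall>a\<ge>real n. \<forall>x\<in>K. \<forall>y\<in>K. \<forall>\<theta>\<in>K'. a * \<Psi> x y \<le> inverse (real (Suc n)) \<longrightarrow> \<not> bad a x y \<theta>"
    by blast
  show "\<exists>m. \<forall>\<alpha>\<^sub>2\<ge>real m. \<exists>n. \<forall>\<alpha>\<^sub>1\<ge>real n. \<forall>x\<in>K. \<forall>y\<in>K. \<forall>\<theta>\<in>K'.
      \<alpha>\<^sub>1 * \<Psi> x y \<le> inverse (real (Suc n)) \<longrightarrow> \<alpha>\<^sub>2 * 0 \<le> inverse (real (Suc m)) \<longrightarrow>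
      G y (- pair_grad2 E \<Psi> (\<lambda>_ _. 0) \<alpha>\<^sub>1 \<alpha>\<^sub>2 x y) \<theta> \<le> C \<longrightarrow>
      - C \<le> G x (pair_grad1 E \<Psi> (\<lambda>_ _. 0) \<alpha>\<^sub>1 \<alpha>\<^sub>2 x y) \<theta> \<longrightarrow>
      G x (pair_grad1 E \<Psi> (\<lambda>_ _. 0) \<alpha>\<^sub>1 \<alpha>\<^sub>2 x y) \<theta> - G y (- pair_grad2 E \<Psi> (\<lambda>_ _. 0) \<alpha>\<^sub>1 \<alpha>\<^sub>2 x y) \<theta> < \<eta>"
  \<comment> \<open>The second penalty is zero, so any threshold \<open>m\<close> will do, and
    \<open>n\<close> need not depend on \<open>\<alpha>\<^sub>2\<close>.\<close>
  proof (rule exI[of _ 0], intro allI impI, rule exI[of _ n], intro allI impI ballI)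
    fix \<alpha>\<^sub>2 \<alpha>\<^sub>1 x y \<theta>
    assume xy: "x \<in> K" "y \<in> K" and *: "real n \<le> \<alpha>\<^sub>1" "\<theta> \<in> K'" "\<alpha>\<^sub>1 * \<Psi> x y \<le> inverse (real (Suc n))"
      "G y (- pair_grad2 E \<Psi> (\<lambda>_ _. 0) \<alpha>\<^sub>1 \<alpha>\<^sub>2 x y) \<theta> \<le> C"
      "- C \<le> G x (pair_grad1 E \<Psi> (\<lambda>_ _. 0) \<alpha>\<^sub>1 \<alpha>\<^sub>2 x y) \<theta>"
    have "\<not> bad \<alpha>\<^sub>1 x y \<theta>" using n xy *(1-3) by blast
    then show "G x (pair_grad1 E \<Psi> (\<lambda>_ _. 0) \<alpha>\<^sub>1 \<alpha>\<^sub>2 x y) \<theta>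
        - G y (- pair_grad2 E \<Psi> (\<lambda>_ _. 0) \<alpha>\<^sub>1 \<alpha>\<^sub>2 x y) \<theta> < \<eta>"
      using *(4,5) unfolding bad_def pg1[OF xy] pg2[OF xy] by linarith
  qed
qed

text \<open>The argument by contradiction is run twice: the \<open>\<alpha>\<^sub>2\<close> values
  are selected so that violations persist for arbitrarily large \<open>\<alpha>\<^sub>1\<close>, and
  for each of them a sequence of such \<open>\<alpha>\<^sub>1\<close> is selected. Compactness of
  \<open>K \<times> K\<close> supplies the limit points demanded by (C2).\<close>

lemma uniform_estimate_pair:
  fixes G :: "'a::euclidean_space \<Rightarrow> 'a \<Rightarrow> 't::topological_space \<Rightarrow> real"
  assumes E: "E \<subseteq> closure (interior E)" and pen: "penalization_pair E \<Psi>\<^sub>1 \<Psi>\<^sub>2"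
    and ce: "continuity_estimate_ext E \<Psi>\<^sub>1 \<Psi>\<^sub>2 G"
  shows "uniform_estimate E \<Psi>\<^sub>1 \<Psi>\<^sub>2 G"
  unfolding uniform_estimate_def
proof (intro allI impI, elim conjE)
  fix K :: "'a set" and K' :: "'t set" and C \<eta> :: real
  assume K: "compact K" "K \<subseteq> E" "compact K'" and \<eta>: "0 < \<eta>"
  let ?p = "\<lambda>\<alpha>\<^sub>1 \<alpha>\<^sub>2 x y. pair_grad1 E \<Psi>\<^sub>1 \<Psi>\<^sub>2 \<alpha>\<^sub>1 \<alpha>\<^sub>2 x y"
  let ?q = "\<lambda>\<alpha>\<^sub>1 \<alpha>\<^sub>2 x y. - pair_grad2 E \<Psi>\<^sub>1 \<Psi>\<^sub>2 \<alpha>\<^sub>1 \<alpha>\<^sub>2 x y"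
  have KK: "compact (K \<times> K)" using K by (intro compact_Times)
  have cont: "continuous_on (E \<times> E) (\<lambda>(x, y). \<Psi>\<^sub>1 x y)" "continuous_on (E \<times> E) (\<lambda>(x, y). \<Psi>\<^sub>2 x y)"
    using pen C1_continuous_on[OF subset_closure_interior_Times[OF E]] by (auto simp: penalization_pair_def)
  have lim: "(\<lambda>n. \<Psi> (s n) (s' n)) \<longlonglongrightarrow> \<Psi> l l'" if "\<Psi> \<in> {\<Psi>\<^sub>1, \<Psi>\<^sub>2}" "\<And>n. (s n, s' n) \<in> K \<times> K" "(l, l') \<in> K \<times> K"
    "(\<lambda>n. (s n, s' n)) \<longlonglongrightarrow> (l, l')" for \<Psi> s s' l l'
  proof -
    have c: "continuous_on (E \<times> E) (\<lambda>(x, y). \<Psi> x y)" using that(1) cont by blast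
    have m: "(l, l') \<in> E \<times> E" "\<And>n. (s n, s' n) \<in> E \<times> E" using that(2,3) K(2) by blast+
    have "(\<lambda>n. (\<lambda>(x, y). \<Psi> x y) (s n, s' n)) \<longlonglongrightarrow> (\<lambda>(x, y). \<Psi> x y) (l, l')"
      by (rule continuous_on_tendsto_compose[OF c that(4) m(1) always_eventually[OF allI[OF m(2)]]])
    then show ?thesis by simp
  qed
  have nonneg: "0 \<le> \<Psi>\<^sub>1 x y" "0 \<le> \<Psi>\<^sub>2 x y" if "x \<in> K" "y \<in> K" for x y
    using pen that K(2) unfolding penalization_pair_def by blast+
  have squeeze: "f \<longlonglongrightarrow> 0" if "\<And>n. 0 \<le> f n" "\<And>n. f n \<le> inverse (real (Suc n))" for f :: "nat \<Rightarrow> real"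
    by (rule tendsto_sandwich[OF _ _ tendsto_const LIMSEQ_inverse_real_of_nat])
      (intro always_eventually allI that)+
  have squeeze': "f \<longlonglongrightarrow> 0" if "\<And>n. 0 \<le> f n" "\<And>n. a n * f n \<le> inverse (real (Suc n))" "\<And>n. real n < a n"
    for f a :: "nat \<Rightarrow> real"
  proof (rule tendsto_sandwich[OF _ _ tendsto_const LIMSEQ_inverse_real_of_nat])
    show "\<forall>\<^sub>F n in sequentially. f n \<le> inverse (real (Suc n))"
      using eventually_ge_at_top[of 1]
    proof eventually_elim
      case (elim n)
      then have "1 \<le> a n" using that(3)[of n] by linarith
      then have "f n \<le> a n * f n" using that(1)[of n] mult_right_mono[of 1 "a n" "f n"] by simp
      then show ?case using that(2)[of n] by linarith
    qed
  qed (use that in auto)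
  define bad where "bad \<alpha>\<^sub>1 \<alpha>\<^sub>2 x y \<theta> \<longleftrightarrow> G y (?q \<alpha>\<^sub>1 \<alpha>\<^sub>2 x y) \<theta> \<le> C \<and> - C \<le> G x (?p \<alpha>\<^sub>1 \<alpha>\<^sub>2 x y) \<theta> \<and>
    \<eta> \<le> G x (?p \<alpha>\<^sub>1 \<alpha>\<^sub>2 x y) \<theta> - G y (?q \<alpha>\<^sub>1 \<alpha>\<^sub>2 x y) \<theta>" for \<alpha>\<^sub>1 \<alpha>\<^sub>2 x y \<theta>
  have invle: "inverse (real (Suc n)) \<le> inverse (real (Suc m))" if "m \<le> n" for m n
    using that by (intro le_imp_inverse_le) auto
  define R where "R m \<alpha>\<^sub>2 n \<alpha>\<^sub>1 \<longleftrightarrow> (\<exists>x y \<theta>. x \<in> K \<and> y \<in> K \<and> \<theta> \<in> K' \<and> \<alpha>\<^sub>1 * \<Psi>\<^sub>1 x y \<le> inverse (real (Suc n)) \<and>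
    \<alpha>\<^sub>2 * \<Psi>\<^sub>2 x y \<le> inverse (real (Suc m)) \<and> bad \<alpha>\<^sub>1 \<alpha>\<^sub>2 x y \<theta>)" for m \<alpha>\<^sub>2 n \<alpha>\<^sub>1
  have R_anti: "R m \<alpha>\<^sub>2 n \<alpha>\<^sub>1" if "R m' \<alpha>\<^sub>2 n' \<alpha>\<^sub>1" "m \<le> m'" "n \<le> n'" for m m' n n' \<alpha>\<^sub>1 \<alpha>\<^sub>2
    using that(1) invle[OF that(2)] invle[OF that(3)] unfolding R_def by (meson order_trans)
  have "\<exists>m. \<forall>\<alpha>\<^sub>2\<ge>real m. \<exists>n. \<forall>\<alpha>\<^sub>1\<ge>real n. \<not> R m \<alpha>\<^sub>2 n \<alpha>\<^sub>1"
  proof (rule ccontr)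
    assume no: "\<not> ?thesis"
    have "\<exists>b. strict_mono b \<and> (\<forall>m. real m < b m \<and> (\<forall>n. \<exists>\<alpha>\<^sub>1\<ge>real n. R m (b m) n \<alpha>\<^sub>1))"
    proof (rule strict_mono_selection[where Q = "\<lambda>m \<alpha>\<^sub>2. \<forall>n. \<exists>\<alpha>\<^sub>1\<ge>real n. R m \<alpha>\<^sub>2 n \<alpha>\<^sub>1"])
      show "\<exists>a\<ge>real m. \<forall>n. \<exists>\<alpha>\<^sub>1\<ge>real n. R m a n \<alpha>\<^sub>1" for m using no by blast
      show "\<forall>n. \<exists>\<alpha>\<^sub>1\<ge>real n. R m a n \<alpha>\<^sub>1" if "m \<le> m'" "\<forall>n. \<exists>\<alpha>\<^sub>1\<ge>real n. R m' a n \<alpha>\<^sub>1" for m m' a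
        using that R_anti[OF _ that(1) order_refl] by blast
    qed
    then obtain b where b: "strict_mono b" "\<And>m. real m < b m" "\<And>m n. \<exists>\<alpha>\<^sub>1\<ge>real n. R m (b m) n \<alpha>\<^sub>1" by blast
    have "\<exists>a. strict_mono a \<and> (\<forall>n. real n < a n \<and> R m (b m) n (a n))" for m
      by (rule strict_mono_selection[where Q = "\<lambda>n \<alpha>\<^sub>1. R m (b m) n \<alpha>\<^sub>1"]) (use b(3) R_anti in blast)+
    then have "\<forall>m. \<exists>a. strict_mono a \<and> (\<forall>n. real n < a n \<and> R m (b m) n (a n))" by blast
    from choice[OF this] obtain a where
      a: "\<And>m. strict_mono (a m)" "\<And>m n. real n < a m n" "\<And>m n. R m (b m) n (a m n)" by blast
    have "\<forall>m n. \<exists>x y \<theta>. x \<in> K \<and> y \<in> K \<and> \<theta> \<in> K' \<and> a m n * \<Psi>\<^sub>1 x y \<le> inverse (real (Suc n)) \<and>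
        b m * \<Psi>\<^sub>2 x y \<le> inverse (real (Suc m)) \<and> bad (a m n) (b m) x y \<theta>"
      using a(3) unfolding R_def by blast
    then obtain X Y T where XYT: "\<And>m n. X m n \<in> K" "\<And>m n. Y m n \<in> K" "\<And>m n. T m n \<in> K'"
      "\<And>m n. a m n * \<Psi>\<^sub>1 (X m n) (Y m n) \<le> inverse (real (Suc n))"
      "\<And>m n. b m * \<Psi>\<^sub>2 (X m n) (Y m n) \<le> inverse (real (Suc m))"
      "\<And>m n. bad (a m n) (b m) (X m n) (Y m n) (T m n)"
      by metis
    have invb: "inv b (b m) = m" for m using b(1) strict_mono_eq by (intro inv_f_f injI) auto
    have inva: "inv (a m) (a m n) = n" for m n using a(1) strict_mono_eq by (intro inv_f_f injI) auto
    have b0: "0 < b m" for m using b(2)[of m] of_nat_0_le_iff[of m] by linarith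
    have a0: "0 < a m n" for m n using a(2)[of n m] of_nat_0_le_iff[of n] by linarith
    have XYK: "(X m n, Y m n) \<in> K \<times> K" for m n using XYT(1,2) by blast
    have n1: "0 \<le> \<Psi>\<^sub>1 (X m n) (Y m n)" and n2: "0 \<le> \<Psi>\<^sub>2 (X m n) (Y m n)" for m n
      using nonneg XYT(1,2) by blast+
    have a\<Psi>: "(\<lambda>n. a m n * \<Psi>\<^sub>1 (X m n) (Y m n)) \<longlonglongrightarrow> 0" for m
      by (rule squeeze[OF mult_nonneg_nonneg XYT(4)]) (use a0 n1 less_imp_le in blast)+
    have \<Psi>0: "(\<lambda>n. \<Psi>\<^sub>1 (X m n) (Y m n)) \<longlonglongrightarrow> 0" for m
      by (rule squeeze'[OF n1 XYT(4) a(2)])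
    have "\<exists>l. l \<in> K \<times> K \<and> (\<exists>r. strict_mono r \<and> ((\<lambda>n. (X m n, Y m n)) \<circ> r) \<longlonglongrightarrow> l)" for m
      using KK XYK unfolding compact_def by (metis (no_types, lifting))
    then have "\<forall>m. \<exists>l. l \<in> K \<times> K \<and> (\<exists>r. strict_mono r \<and> ((\<lambda>n. (X m n, Y m n)) \<circ> r) \<longlonglongrightarrow> l)" by blast
    from choice[OF this] obtain l where l: "\<And>m. l m \<in> K \<times> K"
      "\<And>m. \<exists>r. strict_mono r \<and> ((\<lambda>n. (X m n, Y m n)) \<circ> r) \<longlonglongrightarrow> l m" by blast
    define xl yl where "xl m = fst (l m)" and "yl m = snd (l m)" for m
    have xyl: "xl m \<in> K" "yl m \<in> K" "(xl m, yl m) \<in> K \<times> K" for m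
      using l(1)[of m] by (auto simp: xl_def yl_def mem_Times_iff)
    have slp: "seq_limit_point (\<lambda>n. (X m n, Y m n)) (xl m, yl m)" for m
      using l(2)[of m] unfolding seq_limit_point_def xl_def yl_def by simp
    \<comment> \<open>With \<open>m\<close> fixed, \<open>\<Psi>\<^sub>1\<close> tends to 0 along
      the subsequence, while the bound on \<open>b m * \<Psi>\<^sub>2\<close> does not involve
      \<open>n\<close> and survives in the limit.\<close>
    have \<Psi>1l: "\<Psi>\<^sub>1 (xl m) (yl m) = 0" and \<Psi>2l: "b m * \<Psi>\<^sub>2 (xl m) (yl m) \<le> inverse (real (Suc m))" for m
    proof -
      obtain r where r: "strict_mono r" "(\<lambda>n. (X m (r n), Y m (r n))) \<longlonglongrightarrow> (xl m, yl m)"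
        using slp[of m] unfolding seq_limit_point_def o_def by blast
      have "(\<lambda>n. \<Psi>\<^sub>1 (X m (r n)) (Y m (r n))) \<longlonglongrightarrow> \<Psi>\<^sub>1 (xl m) (yl m)"
        by (rule lim[OF _ XYK xyl(3) r(2)]) simp
      moreover have "(\<lambda>n. \<Psi>\<^sub>1 (X m (r n)) (Y m (r n))) \<longlonglongrightarrow> 0"
        using LIMSEQ_subseq_LIMSEQ[OF \<Psi>0 r(1)] by (simp add: o_def)
      ultimately show "\<Psi>\<^sub>1 (xl m) (yl m) = 0" by (rule LIMSEQ_unique)
      have "(\<lambda>n. \<Psi>\<^sub>2 (X m (r n)) (Y m (r n))) \<longlonglongrightarrow> \<Psi>\<^sub>2 (xl m) (yl m)"
        by (rule lim[OF _ XYK xyl(3) r(2)]) simp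
      then have "(\<lambda>n. b m * \<Psi>\<^sub>2 (X m (r n)) (Y m (r n))) \<longlonglongrightarrow> b m * \<Psi>\<^sub>2 (xl m) (yl m)"
        by (rule tendsto_mult_left)
      then show "b m * \<Psi>\<^sub>2 (xl m) (yl m) \<le> inverse (real (Suc m))"
        by (rule LIMSEQ_le_const2) (use XYT(5) in blast)
    qed
    have n2l: "0 \<le> \<Psi>\<^sub>2 (xl m) (yl m)" for m using nonneg xyl by blast
    have b\<Psi>: "(\<lambda>m. b m * \<Psi>\<^sub>2 (xl m) (yl m)) \<longlonglongrightarrow> 0"
      by (rule squeeze[OF mult_nonneg_nonneg \<Psi>2l]) (use b0 n2l less_imp_le in blast)+
    have \<Psi>2l0: "(\<lambda>m. \<Psi>\<^sub>2 (xl m) (yl m)) \<longlonglongrightarrow> 0"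
      by (rule squeeze'[OF n2l \<Psi>2l b(2)])
    obtain l0 r where l0: "l0 \<in> K \<times> K" and r: "strict_mono r" "((\<lambda>m. (xl m, yl m)) \<circ> r) \<longlonglongrightarrow> l0"
      using KK xyl(3) unfolding compact_def by (metis (no_types, lifting))
    obtain x0 y0 where xy0: "l0 = (x0, y0)" by (cases l0)
    have "(\<lambda>m. \<Psi>\<^sub>1 (xl (r m)) (yl (r m))) \<longlonglongrightarrow> \<Psi>\<^sub>1 x0 y0"
      by (rule lim[OF _ xyl(3)]) (use l0 r(2) xy0 in \<open>simp_all add: o_def\<close>)
    then have z1: "\<Psi>\<^sub>1 x0 y0 = 0" by (simp add: \<Psi>1l LIMSEQ_const_iff)
    have "(\<lambda>m. \<Psi>\<^sub>2 (xl (r m)) (yl (r m))) \<longlonglongrightarrow> \<Psi>\<^sub>2 x0 y0"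
      by (rule lim[OF _ xyl(3)]) (use l0 r(2) xy0 in \<open>simp_all add: o_def\<close>)
    moreover have "(\<lambda>m. \<Psi>\<^sub>2 (xl (r m)) (yl (r m))) \<longlonglongrightarrow> 0"
      using LIMSEQ_subseq_LIMSEQ[OF \<Psi>2l0 r(1)] by (simp add: o_def)
    ultimately have z2: "\<Psi>\<^sub>2 x0 y0 = 0" by (rule LIMSEQ_unique)
    have slp0: "seq_limit_point (\<lambda>m. (xl m, yl m)) (x0, y0)"
      using r unfolding seq_limit_point_def xy0 by blast
    have x0K: "x0 \<in> K" "y0 \<in> K" using l0 xy0 by auto
    have atop: "filterlim f at_top sequentially" if "\<And>n. real n < f n" for f :: "nat \<Rightarrow> real"
      by (rule filterlim_at_top_mono[OF filterlim_real_sequentially])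
        (intro always_eventually allI less_imp_le that)
    \<comment> \<open>The collection is rewritten as functions of parameter values:
      \<open>\<alpha>\<^sub>2\<close> determines \<open>m\<close>, and
      \<open>\<alpha>\<^sub>1\<close> then determines \<open>n\<close> within the sequence belonging
      to \<open>m\<close>.\<close>
    define A where "A \<alpha>\<^sub>2 = a (inv b \<alpha>\<^sub>2)" for \<alpha>\<^sub>2
    define IX where "IX Z \<alpha>\<^sub>1 \<alpha>\<^sub>2 = Z (inv b \<alpha>\<^sub>2) (inv (A \<alpha>\<^sub>2) \<alpha>\<^sub>1)" for Z :: "nat \<Rightarrow> nat \<Rightarrow> 'a" and \<alpha>\<^sub>1 \<alpha>\<^sub>2
    define IT where "IT \<alpha>\<^sub>1 \<alpha>\<^sub>2 = T (inv b \<alpha>\<^sub>2) (inv (A \<alpha>\<^sub>2) \<alpha>\<^sub>1)" for \<alpha>\<^sub>1 \<alpha>\<^sub>2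
    have Ab: "A (b m) = a m" for m by (simp add: A_def invb)
    have IX: "IX Z (a m n) (b m) = Z m n" for Z m n by (simp add: IX_def Ab invb inva)
    have IT: "IT (a m n) (b m) = T m n" for m n by (simp add: IT_def Ab invb inva)
    have up: "(SUP \<alpha>\<^sub>2\<in>range b. SUP \<alpha>\<^sub>1\<in>range (A \<alpha>\<^sub>2).
        ereal (G (IX Y \<alpha>\<^sub>1 \<alpha>\<^sub>2) (?q \<alpha>\<^sub>1 \<alpha>\<^sub>2 (IX X \<alpha>\<^sub>1 \<alpha>\<^sub>2) (IX Y \<alpha>\<^sub>1 \<alpha>\<^sub>2)) (IT \<alpha>\<^sub>1 \<alpha>\<^sub>2))) < \<infinity>"
    proof (rule le_less_trans)
      show "(SUP \<alpha>\<^sub>2\<in>range b. SUP \<alpha>\<^sub>1\<in>range (A \<alpha>\<^sub>2).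
        ereal (G (IX Y \<alpha>\<^sub>1 \<alpha>\<^sub>2) (?q \<alpha>\<^sub>1 \<alpha>\<^sub>2 (IX X \<alpha>\<^sub>1 \<alpha>\<^sub>2) (IX Y \<alpha>\<^sub>1 \<alpha>\<^sub>2)) (IT \<alpha>\<^sub>1 \<alpha>\<^sub>2))) \<le> ereal C"
        using XYT(6) by (intro SUP_least) (auto simp: Ab IX IT bad_def)
    qed simp
    have low: "- \<infinity> < (INF \<alpha>\<^sub>2\<in>range b. INF \<alpha>\<^sub>1\<in>range (A \<alpha>\<^sub>2).
        ereal (G (IX X \<alpha>\<^sub>1 \<alpha>\<^sub>2) (?p \<alpha>\<^sub>1 \<alpha>\<^sub>2 (IX X \<alpha>\<^sub>1 \<alpha>\<^sub>2) (IX Y \<alpha>\<^sub>1 \<alpha>\<^sub>2)) (IT \<alpha>\<^sub>1 \<alpha>\<^sub>2)))"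
    proof (rule less_le_trans)
      show "ereal (- C) \<le> (INF \<alpha>\<^sub>2\<in>range b. INF \<alpha>\<^sub>1\<in>range (A \<alpha>\<^sub>2).
        ereal (G (IX X \<alpha>\<^sub>1 \<alpha>\<^sub>2) (?p \<alpha>\<^sub>1 \<alpha>\<^sub>2 (IX X \<alpha>\<^sub>1 \<alpha>\<^sub>2) (IX Y \<alpha>\<^sub>1 \<alpha>\<^sub>2)) (IT \<alpha>\<^sub>1 \<alpha>\<^sub>2)))"
        using XYT(6) by (intro INF_greatest) (auto simp: Ab IX IT bad_def)
    qed simp
    have "fundamental_ext E \<Psi>\<^sub>1 \<Psi>\<^sub>2 G (\<lambda>_. A) (\<lambda>_. b) (\<lambda>_. IX X) (\<lambda>_. IX Y) (\<lambda>_. IT)"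
      unfolding fundamental_ext_def
    proof (intro allI impI conjI)
      show "filterlim b at_top sequentially" by (rule atop[OF b(2)])
      show "\<forall>\<alpha>\<^sub>2\<in>range b. filterlim (A \<alpha>\<^sub>2) at_top sequentially" using atop[OF a(2)] by (auto simp: Ab)
      have c1: "\<forall>\<alpha>\<^sub>2\<in>range b. \<forall>\<alpha>\<^sub>1\<in>range (A \<alpha>\<^sub>2). IX X \<alpha>\<^sub>1 \<alpha>\<^sub>2 \<in> K \<and> IX Y \<alpha>\<^sub>1 \<alpha>\<^sub>2 \<in> K \<and> IT \<alpha>\<^sub>1 \<alpha>\<^sub>2 \<in> K'"
        using XYT(1-3) by (auto simp: Ab IX IT)
      have c2: "\<forall>\<alpha>\<^sub>2\<in>range b. (xl (inv b \<alpha>\<^sub>2)) \<in> K \<and> (yl (inv b \<alpha>\<^sub>2)) \<in> K \<and>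
          seq_limit_point (\<lambda>n. (IX X (A \<alpha>\<^sub>2 n) \<alpha>\<^sub>2, IX Y (A \<alpha>\<^sub>2 n) \<alpha>\<^sub>2)) (xl (inv b \<alpha>\<^sub>2), yl (inv b \<alpha>\<^sub>2)) \<and>
          \<Psi>\<^sub>1 (xl (inv b \<alpha>\<^sub>2)) (yl (inv b \<alpha>\<^sub>2)) = 0 \<and>
          (\<lambda>n. A \<alpha>\<^sub>2 n * \<Psi>\<^sub>1 (IX X (A \<alpha>\<^sub>2 n) \<alpha>\<^sub>2) (IX Y (A \<alpha>\<^sub>2 n) \<alpha>\<^sub>2)) \<longlonglongrightarrow> 0"
        using xyl slp \<Psi>1l a\<Psi> by (auto simp: Ab IX invb)
      have c3: "seq_limit_point (\<lambda>m. (xl (inv b (b m)), yl (inv b (b m)))) (x0, y0)"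
        "\<Psi>\<^sub>1 x0 y0 + \<Psi>\<^sub>2 x0 y0 = 0" "(\<lambda>m. b m * \<Psi>\<^sub>2 (xl (inv b (b m))) (yl (inv b (b m)))) \<longlonglongrightarrow> 0"
        using slp0 z1 z2 b\<Psi> by (simp_all add: invb)
      show "\<exists>K K'. compact K \<and> K \<subseteq> E \<and> compact K' \<and>
        (\<forall>\<alpha>\<^sub>2\<in>range b. \<forall>\<alpha>\<^sub>1\<in>range (A \<alpha>\<^sub>2). IX X \<alpha>\<^sub>1 \<alpha>\<^sub>2 \<in> K \<and> IX Y \<alpha>\<^sub>1 \<alpha>\<^sub>2 \<in> K \<and> IT \<alpha>\<^sub>1 \<alpha>\<^sub>2 \<in> K') \<and>
        (\<exists>xl yl. \<exists>x\<^sub>0\<in>K. \<exists>y\<^sub>0\<in>K.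
           (\<forall>\<alpha>\<^sub>2\<in>range b. xl \<alpha>\<^sub>2 \<in> K \<and> yl \<alpha>\<^sub>2 \<in> K \<and>
              seq_limit_point (\<lambda>n. (IX X (A \<alpha>\<^sub>2 n) \<alpha>\<^sub>2, IX Y (A \<alpha>\<^sub>2 n) \<alpha>\<^sub>2)) (xl \<alpha>\<^sub>2, yl \<alpha>\<^sub>2) \<and>
              \<Psi>\<^sub>1 (xl \<alpha>\<^sub>2) (yl \<alpha>\<^sub>2) = 0 \<and>
              (\<lambda>n. A \<alpha>\<^sub>2 n * \<Psi>\<^sub>1 (IX X (A \<alpha>\<^sub>2 n) \<alpha>\<^sub>2) (IX Y (A \<alpha>\<^sub>2 n) \<alpha>\<^sub>2)) \<longlonglongrightarrow> 0) \<and>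
           seq_limit_point (\<lambda>m. (xl (b m), yl (b m))) (x\<^sub>0, y\<^sub>0) \<and>
           \<Psi>\<^sub>1 x\<^sub>0 y\<^sub>0 + \<Psi>\<^sub>2 x\<^sub>0 y\<^sub>0 = 0 \<and>
           (\<lambda>m. b m * \<Psi>\<^sub>2 (xl (b m)) (yl (b m))) \<longlonglongrightarrow> 0)"
        by (intro exI[of _ K] exI[of _ K'] conjI K c1 exI[of _ "\<lambda>\<alpha>\<^sub>2. xl (inv b \<alpha>\<^sub>2)"]
            exI[of _ "\<lambda>\<alpha>\<^sub>2. yl (inv b \<alpha>\<^sub>2)"] bexI[of _ x0] bexI[of _ y0] c2 c3 x0K)
    qed (rule up low)+
    from ce[unfolded continuity_estimate_ext_def, rule_format, OF this zero_less_one]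
    have "liminf (\<lambda>m. liminf (\<lambda>n. ereal (G (X m n) (?p (a m n) (b m) (X m n) (Y m n)) (T m n)
        - G (Y m n) (?q (a m n) (b m) (X m n) (Y m n)) (T m n)))) \<le> 0"
      unfolding Let_def Ab IX IT .
    moreover have "ereal \<eta> \<le> liminf (\<lambda>m. liminf (\<lambda>n. ereal (G (X m n) (?p (a m n) (b m) (X m n) (Y m n)) (T m n)
        - G (Y m n) (?q (a m n) (b m) (X m n) (Y m n)) (T m n))))"
      by (intro Liminf_bounded always_eventually allI) (use XYT(6) in \<open>simp add: bad_def\<close>)
    ultimately have "ereal \<eta> \<le> 0" by (rule order_trans[rotated])
    then show False using \<eta> by simp
  qed
  then obtain m where m: "\<forall>\<alpha>\<^sub>2\<ge>real m. \<exists>n. \<forall>\<alpha>\<^sub>1\<ge>real n. \<not> R m \<alpha>\<^sub>2 n \<alpha>\<^sub>1" by blast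
  show "\<exists>m. \<forall>\<alpha>\<^sub>2\<ge>real m. \<exists>n. \<forall>\<alpha>\<^sub>1\<ge>real n. \<forall>x\<in>K. \<forall>y\<in>K. \<forall>\<theta>\<in>K'.
      \<alpha>\<^sub>1 * \<Psi>\<^sub>1 x y \<le> inverse (real (Suc n)) \<longrightarrow> \<alpha>\<^sub>2 * \<Psi>\<^sub>2 x y \<le> inverse (real (Suc m)) \<longrightarrow>
      G y (?q \<alpha>\<^sub>1 \<alpha>\<^sub>2 x y) \<theta> \<le> C \<longrightarrow> - C \<le> G x (?p \<alpha>\<^sub>1 \<alpha>\<^sub>2 x y) \<theta> \<longrightarrow>
      G x (?p \<alpha>\<^sub>1 \<alpha>\<^sub>2 x y) \<theta> - G y (?q \<alpha>\<^sub>1 \<alpha>\<^sub>2 x y) \<theta> < \<eta>"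
  proof (rule exI[of _ m], intro allI impI)
    fix \<alpha>\<^sub>2 assume "real m \<le> \<alpha>\<^sub>2"
    then obtain n where n: "\<forall>\<alpha>\<^sub>1\<ge>real n. \<not> R m \<alpha>\<^sub>2 n \<alpha>\<^sub>1" using m by blast
    show "\<exists>n. \<forall>\<alpha>\<^sub>1\<ge>real n. \<forall>x\<in>K. \<forall>y\<in>K. \<forall>\<theta>\<in>K'.
      \<alpha>\<^sub>1 * \<Psi>\<^sub>1 x y \<le> inverse (real (Suc n)) \<longrightarrow> \<alpha>\<^sub>2 * \<Psi>\<^sub>2 x y \<le> inverse (real (Suc m)) \<longrightarrow>
      G y (?q \<alpha>\<^sub>1 \<alpha>\<^sub>2 x y) \<theta> \<le> C \<longrightarrow> - C \<le> G x (?p \<alpha>\<^sub>1 \<alpha>\<^sub>2 x y) \<theta> \<longrightarrow>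
      G x (?p \<alpha>\<^sub>1 \<alpha>\<^sub>2 x y) \<theta> - G y (?q \<alpha>\<^sub>1 \<alpha>\<^sub>2 x y) \<theta> < \<eta>"
    proof (rule exI[of _ n], intro allI impI ballI)
      fix \<alpha>\<^sub>1 x y \<theta>
      assume "real n \<le> \<alpha>\<^sub>1" and *: "x \<in> K" "y \<in> K" "\<theta> \<in> K'" "\<alpha>\<^sub>1 * \<Psi>\<^sub>1 x y \<le> inverse (real (Suc n))"
        "\<alpha>\<^sub>2 * \<Psi>\<^sub>2 x y \<le> inverse (real (Suc m))" "G y (?q \<alpha>\<^sub>1 \<alpha>\<^sub>2 x y) \<theta> \<le> C" "- C \<le> G x (?p \<alpha>\<^sub>1 \<alpha>\<^sub>2 x y) \<theta>"
      then have "\<not> R m \<alpha>\<^sub>2 n \<alpha>\<^sub>1" using n by blast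
      then have "\<not> bad \<alpha>\<^sub>1 \<alpha>\<^sub>2 x y \<theta>" using *(1-5) unfolding R_def by blast
      then show "G x (?p \<alpha>\<^sub>1 \<alpha>\<^sub>2 x y) \<theta> - G y (?q \<alpha>\<^sub>1 \<alpha>\<^sub>2 x y) \<theta> < \<eta>"
        using *(6,7) unfolding bad_def by linarith
    qed
  qed
qed

subsection \<open>Finite families of penalties\<close>

text \<open>A triple holds the two multipliers and an additive cost. The cost has zero gradient; it
  only influences which triple of a family is cheapest.\<close>

definition penalty :: "('a \<Rightarrow> 'a \<Rightarrow> real) \<Rightarrow> ('a \<Rightarrow> 'a \<Rightarrow> real) \<Rightarrow> real \<times> real \<times> real \<Rightarrow> 'a \<Rightarrow> 'a \<Rightarrow> real" where
  "penalty \<Psi>\<^sub>1 \<Psi>\<^sub>2 l x y = fst l * \<Psi>\<^sub>1 x y + fst (snd l) * \<Psi>\<^sub>2 x y + snd (snd l)"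

lemma penalization_pair_zero: "penalization E \<Psi> \<Longrightarrow> penalization_pair E \<Psi> (\<lambda>_ _. 0)"
  using const_C1[of 0 "E \<times> E"] by (auto simp: penalization_def penalization_pair_def case_prod_unfold)

text \<open>The sum of the two functions has a positive minimum on the compact set of pairs at
  distance at least \<rho>. This turns small penalties into small distances.\<close>

lemma penalization_pair_separates:
  assumes E: "E \<subseteq> closure (interior E)" and pen: "penalization_pair E \<Psi>\<^sub>1 \<Psi>\<^sub>2"
    and K: "compact K" "K \<subseteq> E" and \<rho>: "0 < \<rho>"
  shows "\<exists>\<kappa>>0. \<forall>x\<in>K. \<forall>y\<in>K. \<rho> \<le> dist x y \<longrightarrow> \<kappa> \<le> \<Psi>\<^sub>1 x y + \<Psi>\<^sub>2 x y"
proof -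
  define S where "S = (K \<times> K) \<inter> {z. \<rho> \<le> dist (fst z) (snd z)}"
  have "closed {z :: 'a \<times> 'a. \<rho> \<le> dist (fst z) (snd z)}"
    by (intro closed_Collect_le continuous_intros)
  then have S: "compact S" unfolding S_def using K by (intro compact_Int_closed compact_Times)
  have SE: "S \<subseteq> E \<times> E" using K by (auto simp: S_def)
  have "continuous_on (E \<times> E) (\<lambda>(x, y). \<Psi>\<^sub>1 x y)" "continuous_on (E \<times> E) (\<lambda>(x, y). \<Psi>\<^sub>2 x y)"
    using pen C1_continuous_on[OF subset_closure_interior_Times[OF E]] by (auto simp: penalization_pair_def)
  then have "continuous_on (E \<times> E) (\<lambda>z. (\<lambda>(x, y). \<Psi>\<^sub>1 x y) z + (\<lambda>(x, y). \<Psi>\<^sub>2 x y) z)"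
    by (rule continuous_on_add)
  then have c: "continuous_on S (\<lambda>z. \<Psi>\<^sub>1 (fst z) (snd z) + \<Psi>\<^sub>2 (fst z) (snd z))"
    using SE by (simp add: case_prod_unfold) (rule continuous_on_subset)
  have pos: "0 < \<Psi>\<^sub>1 x y + \<Psi>\<^sub>2 x y" if xy: "x \<in> E" "y \<in> E" "x \<noteq> y" for x y
  proof -
    have "0 \<le> \<Psi>\<^sub>1 x y" "0 \<le> \<Psi>\<^sub>2 x y" "\<not> (\<Psi>\<^sub>1 x y = 0 \<and> \<Psi>\<^sub>2 x y = 0)"
      using pen xy unfolding penalization_pair_def by blast+
    then show ?thesis by linarith
  qed
  show ?thesis
  proof (cases "S = {}")
    case True
    then have "\<not> \<rho> \<le> dist x y" if "x \<in> K" "y \<in> K" for x y using that by (auto simp: S_def)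
    then show ?thesis by (intro exI[of _ 1]) auto
  next
    case False
    obtain z where z: "z \<in> S" "\<forall>w\<in>S. \<Psi>\<^sub>1 (fst z) (snd z) + \<Psi>\<^sub>2 (fst z) (snd z) \<le> \<Psi>\<^sub>1 (fst w) (snd w) + \<Psi>\<^sub>2 (fst w) (snd w)"
      using continuous_attains_inf[OF S False c] by blast
    have "fst z \<noteq> snd z" "fst z \<in> E" "snd z \<in> E" using z(1) \<rho> SE by (auto simp: S_def)
    then have "0 < \<Psi>\<^sub>1 (fst z) (snd z) + \<Psi>\<^sub>2 (fst z) (snd z)" using pos by blast
    moreover have "\<Psi>\<^sub>1 (fst z) (snd z) + \<Psi>\<^sub>2 (fst z) (snd z) \<le> \<Psi>\<^sub>1 x y + \<Psi>\<^sub>2 x y"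
      if "x \<in> K" "y \<in> K" "\<rho> \<le> dist x y" for x y
      using bspec[OF z(2), of "(x, y)"] that by (simp add: S_def)
    ultimately show ?thesis by blast
  qed
qed

text \<open>If the scale \<open>2 ^ l\<close> is optimal when choosing it costs \<open>(N - l) * d\<close>, then comparison with
  \<open>l - 1\<close> bounds the scaled quantity by \<open>2 * d\<close>, although nothing else is known about \<open>t\<close>.\<close>

lemma optimal_scale_bound:
  fixes t d b :: real and N l :: nat
  assumes N: "b < real N * d" and t: "0 \<le> t" and le: "2 ^ l * t + (real N - real l) * d \<le> b"
    and l: "l \<le> N" and min: "\<And>k. k \<le> N \<Longrightarrow> 2 ^ l * t + (real N - real l) * d \<le> 2 ^ k * t + (real N - real k) * d"
  shows "2 ^ l * t \<le> 2 * d"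
proof (cases l)
  case 0
  \<comment> \<open>The lowest scale is excluded: its cost \<open>N * d\<close> alone exceeds the
    budget \<open>b\<close>.\<close>
  then show ?thesis using N t le by simp
next
  case (Suc k)
  then show ?thesis using min[of k] l by (simp add: algebra_simps)
qed

text \<open>The pairs \<open>(x, y)\<close> that matter are those at which \<open>l\<close> is a cheapest penalty in the family and costs at
  most \<open>b\<close>: these are close together and satisfy the conclusion of the continuity estimate up to \<open>\<eta>\<close>.\<close>

definition fine_penalties ::
  "'a::euclidean_space set \<Rightarrow> ('a \<Rightarrow> 'a \<Rightarrow> 't::topological_space \<Rightarrow> real) \<Rightarrow> ('a \<Rightarrow> 'a \<Rightarrow> real) \<Rightarrow> ('a \<Rightarrow> 'a \<Rightarrow> real)
    \<Rightarrow> 'a set \<Rightarrow> 't set \<Rightarrow> real \<Rightarrow> real \<Rightarrow> real \<Rightarrow> real \<Rightarrow> (real \<times> real \<times> real) set \<Rightarrow> bool" where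
  "fine_penalties E G \<Psi>\<^sub>1 \<Psi>\<^sub>2 K K' C \<eta> \<rho> b L \<longleftrightarrow> finite L \<and> (\<exists>\<alpha>\<^sub>1 \<alpha>\<^sub>2. (\<alpha>\<^sub>1, \<alpha>\<^sub>2, 0) \<in> L) \<and>
    (\<forall>l\<in>L. 0 \<le> fst l \<and> 0 \<le> fst (snd l) \<and> 0 \<le> snd (snd l)) \<and>
    (\<forall>l\<in>L. \<forall>x\<in>K. \<forall>y\<in>K. (\<forall>k\<in>L. penalty \<Psi>\<^sub>1 \<Psi>\<^sub>2 l x y \<le> penalty \<Psi>\<^sub>1 \<Psi>\<^sub>2 k x y) \<longrightarrow>
      penalty \<Psi>\<^sub>1 \<Psi>\<^sub>2 l x y \<le> b \<longrightarrow> dist x y < \<rho> \<and>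
      (\<forall>\<theta>\<in>K'. G y (- pair_grad2 E \<Psi>\<^sub>1 \<Psi>\<^sub>2 (fst l) (fst (snd l)) x y) \<theta> \<le> C \<longrightarrow>
        - C \<le> G x (pair_grad1 E \<Psi>\<^sub>1 \<Psi>\<^sub>2 (fst l) (fst (snd l)) x y) \<theta> \<longrightarrow>
        G x (pair_grad1 E \<Psi>\<^sub>1 \<Psi>\<^sub>2 (fst l) (fst (snd l)) x y) \<theta>
          - G y (- pair_grad2 E \<Psi>\<^sub>1 \<Psi>\<^sub>2 (fst l) (fst (snd l)) x y) \<theta> < \<eta>))"

text \<open>Both multipliers run through dyadic multiples of base values and the costs add up, so
  minimality holds in each index separately and the scale bound applies twice. The steps
  \<open>d\<^sub>1\<close> and \<open>d\<^sub>2\<close> are half the smallness required by the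
  uniform estimate.\<close>

lemma penalty_family:
  fixes G :: "'a::euclidean_space \<Rightarrow> 'a \<Rightarrow> 't::topological_space \<Rightarrow> real"
  assumes E: "E \<subseteq> closure (interior E)" and pen: "penalization_pair E \<Psi>\<^sub>1 \<Psi>\<^sub>2"
    and ue: "uniform_estimate E \<Psi>\<^sub>1 \<Psi>\<^sub>2 G" and K: "compact K" "K \<subseteq> E" and K': "compact K'"
    and \<eta>: "0 < \<eta>" and \<rho>: "0 < \<rho>"
  shows "\<exists>L. fine_penalties E G \<Psi>\<^sub>1 \<Psi>\<^sub>2 K K' C \<eta> \<rho> b L"
proof -
  obtain \<kappa> where \<kappa>: "0 < \<kappa>" "\<forall>x\<in>K. \<forall>y\<in>K. \<rho> \<le> dist x y \<longrightarrow> \<kappa> \<le> \<Psi>\<^sub>1 x y + \<Psi>\<^sub>2 x y"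
    using penalization_pair_separates[OF E pen K \<rho>] by blast
  have nonneg: "0 \<le> \<Psi>\<^sub>1 x y" "0 \<le> \<Psi>\<^sub>2 x y" if "x \<in> K" "y \<in> K" for x y
    using pen that K(2) unfolding penalization_pair_def by blast+
  define good where "good \<alpha>\<^sub>1 \<alpha>\<^sub>2 x y \<longleftrightarrow> (\<forall>\<theta>\<in>K'. G y (- pair_grad2 E \<Psi>\<^sub>1 \<Psi>\<^sub>2 \<alpha>\<^sub>1 \<alpha>\<^sub>2 x y) \<theta> \<le> C \<longrightarrow>
      - C \<le> G x (pair_grad1 E \<Psi>\<^sub>1 \<Psi>\<^sub>2 \<alpha>\<^sub>1 \<alpha>\<^sub>2 x y) \<theta> \<longrightarrow>
      G x (pair_grad1 E \<Psi>\<^sub>1 \<Psi>\<^sub>2 \<alpha>\<^sub>1 \<alpha>\<^sub>2 x y) \<theta> - G y (- pair_grad2 E \<Psi>\<^sub>1 \<Psi>\<^sub>2 \<alpha>\<^sub>1 \<alpha>\<^sub>2 x y) \<theta> < \<eta>)"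
    for \<alpha>\<^sub>1 \<alpha>\<^sub>2 x y
  have "\<exists>m. \<forall>\<alpha>\<^sub>2\<ge>real m. \<exists>n. \<forall>\<alpha>\<^sub>1\<ge>real n. \<forall>x\<in>K. \<forall>y\<in>K. \<forall>\<theta>\<in>K'.
      \<alpha>\<^sub>1 * \<Psi>\<^sub>1 x y \<le> inverse (real (Suc n)) \<longrightarrow> \<alpha>\<^sub>2 * \<Psi>\<^sub>2 x y \<le> inverse (real (Suc m)) \<longrightarrow>
      G y (- pair_grad2 E \<Psi>\<^sub>1 \<Psi>\<^sub>2 \<alpha>\<^sub>1 \<alpha>\<^sub>2 x y) \<theta> \<le> C \<longrightarrow> - C \<le> G x (pair_grad1 E \<Psi>\<^sub>1 \<Psi>\<^sub>2 \<alpha>\<^sub>1 \<alpha>\<^sub>2 x y) \<theta> \<longrightarrow>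
      G x (pair_grad1 E \<Psi>\<^sub>1 \<Psi>\<^sub>2 \<alpha>\<^sub>1 \<alpha>\<^sub>2 x y) \<theta> - G y (- pair_grad2 E \<Psi>\<^sub>1 \<Psi>\<^sub>2 \<alpha>\<^sub>1 \<alpha>\<^sub>2 x y) \<theta> < \<eta>"
    using ue K K' \<eta> unfolding uniform_estimate_def by blast
  then obtain m where m: "\<And>\<alpha>\<^sub>2. real m \<le> \<alpha>\<^sub>2 \<Longrightarrow> \<exists>n. \<forall>\<alpha>\<^sub>1\<ge>real n. \<forall>x\<in>K. \<forall>y\<in>K.
      \<alpha>\<^sub>1 * \<Psi>\<^sub>1 x y \<le> inverse (real (Suc n)) \<longrightarrow> \<alpha>\<^sub>2 * \<Psi>\<^sub>2 x y \<le> inverse (real (Suc m)) \<longrightarrow> good \<alpha>\<^sub>1 \<alpha>\<^sub>2 x y"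
    unfolding good_def by meson
  have half: "0 < inverse (real (Suc i)) / 2" "2 * (inverse (real (Suc i)) / 2) = inverse (real (Suc i))"
    "inverse (real (Suc i)) \<le> 1" for i by (simp, simp, simp add: inverse_le_1_iff)
  define d\<^sub>2 where "d\<^sub>2 = inverse (real (Suc m)) / 2"
  \<comment> \<open>Above \<open>m\<close> for the uniform estimate, and above
    \<open>4 / \<kappa>\<close> so that \<open>\<alpha>\<^sub>2 * \<Psi>\<^sub>2 x y \<le> 1\<close>
    forces \<open>\<Psi>\<^sub>2 x y \<le> \<kappa> / 4\<close>; with the same choice for
    \<open>\<alpha>\<^sub>1\<close> the sum stays below \<kappa>, hence the distance below
    \<rho>.\<close>
  define \<alpha>\<^sub>2 where "\<alpha>\<^sub>2 = real m + 4 / \<kappa>"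
  have \<alpha>\<^sub>2: "4 / \<kappa> \<le> \<alpha>\<^sub>2" "real m \<le> \<alpha>\<^sub>2" "0 < \<alpha>\<^sub>2" using \<kappa> by (auto simp: \<alpha>\<^sub>2_def add_nonneg_pos)
  obtain N\<^sub>2 where N\<^sub>2: "b < real N\<^sub>2 * d\<^sub>2" using half(1) reals_Archimedean3 unfolding d\<^sub>2_def by blast
  have pow: "c \<le> 2 ^ i * c" if "0 \<le> c" for c :: real and i :: nat
    using mult_right_mono[of 1 "2 ^ i" c] that by simp
  have "\<exists>n. \<forall>\<alpha>\<^sub>1\<ge>real n. \<forall>x\<in>K. \<forall>y\<in>K. \<alpha>\<^sub>1 * \<Psi>\<^sub>1 x y \<le> inverse (real (Suc n)) \<longrightarrow>
      2 ^ i * \<alpha>\<^sub>2 * \<Psi>\<^sub>2 x y \<le> inverse (real (Suc m)) \<longrightarrow> good \<alpha>\<^sub>1 (2 ^ i * \<alpha>\<^sub>2) x y" for i :: nat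
    by (rule m) (use pow[of \<alpha>\<^sub>2 i] \<alpha>\<^sub>2 in linarith)
  then obtain nn where nn: "\<And>(i::nat) \<alpha>\<^sub>1 x y. real (nn i) \<le> \<alpha>\<^sub>1 \<Longrightarrow> x \<in> K \<Longrightarrow> y \<in> K \<Longrightarrow>
      \<alpha>\<^sub>1 * \<Psi>\<^sub>1 x y \<le> inverse (real (Suc (nn i))) \<Longrightarrow> 2 ^ i * \<alpha>\<^sub>2 * \<Psi>\<^sub>2 x y \<le> inverse (real (Suc m)) \<Longrightarrow>
      good \<alpha>\<^sub>1 (2 ^ i * \<alpha>\<^sub>2) x y" by metis
  \<comment> \<open>The threshold for the first multiplier depends on the scale of the second. There
    are finitely many scales, so one threshold serves all of them.\<close>
  define n where "n = Max (nn ` {..N\<^sub>2})"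
  have n: "nn i \<le> n" if "i \<le> N\<^sub>2" for i using that by (simp add: n_def)
  define d\<^sub>1 where "d\<^sub>1 = inverse (real (Suc n)) / 2"
  define \<alpha>\<^sub>1 where "\<alpha>\<^sub>1 = real n + 4 / \<kappa>"
  have \<alpha>\<^sub>1: "4 / \<kappa> \<le> \<alpha>\<^sub>1" "real n \<le> \<alpha>\<^sub>1" "0 < \<alpha>\<^sub>1" using \<kappa> by (auto simp: \<alpha>\<^sub>1_def add_nonneg_pos)
  obtain N\<^sub>1 where N\<^sub>1: "b < real N\<^sub>1 * d\<^sub>1" using half(1) reals_Archimedean3 unfolding d\<^sub>1_def by blast
  have d0: "0 < d\<^sub>1" "0 < d\<^sub>2" using half(1) by (auto simp: d\<^sub>1_def d\<^sub>2_def)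
  \<comment> \<open>The cost drops to 0 at the top pair of scales, which provides the member of the
    family that vanishes on the diagonal.\<close>
  define piece where "piece i j = (2 ^ i * \<alpha>\<^sub>1, 2 ^ j * \<alpha>\<^sub>2, (real N\<^sub>1 - real i) * d\<^sub>1 + (real N\<^sub>2 - real j) * d\<^sub>2)"
    for i j :: nat
  define L where "L = (\<lambda>(i, j). piece i j) ` ({..N\<^sub>1} \<times> {..N\<^sub>2})"
  have piece: "penalty \<Psi>\<^sub>1 \<Psi>\<^sub>2 (piece i j) x y = (2 ^ i * (\<alpha>\<^sub>1 * \<Psi>\<^sub>1 x y) + (real N\<^sub>1 - real i) * d\<^sub>1) +
      (2 ^ j * (\<alpha>\<^sub>2 * \<Psi>\<^sub>2 x y) + (real N\<^sub>2 - real j) * d\<^sub>2)" for i j x y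
    by (simp add: penalty_def piece_def)
  have mem: "piece i j \<in> L" if "i \<le> N\<^sub>1" "j \<le> N\<^sub>2" for i j using that by (auto simp: L_def)
  have active: "dist x y < \<rho> \<and> good (2 ^ i * \<alpha>\<^sub>1) (2 ^ j * \<alpha>\<^sub>2) x y"
    if ij: "i \<le> N\<^sub>1" "j \<le> N\<^sub>2" and xy: "x \<in> K" "y \<in> K"
      and min: "\<forall>k\<in>L. penalty \<Psi>\<^sub>1 \<Psi>\<^sub>2 (piece i j) x y \<le> penalty \<Psi>\<^sub>1 \<Psi>\<^sub>2 k x y"
      and le: "penalty \<Psi>\<^sub>1 \<Psi>\<^sub>2 (piece i j) x y \<le> b" for i j x y
  proof -
    have t: "0 \<le> \<alpha>\<^sub>1 * \<Psi>\<^sub>1 x y" "0 \<le> \<alpha>\<^sub>2 * \<Psi>\<^sub>2 x y" using nonneg[OF xy] \<alpha>\<^sub>1 \<alpha>\<^sub>2 by auto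
    then have t': "0 \<le> 2 ^ i * (\<alpha>\<^sub>1 * \<Psi>\<^sub>1 x y)" "0 \<le> 2 ^ j * (\<alpha>\<^sub>2 * \<Psi>\<^sub>2 x y)" by simp_all
    have z: "0 \<le> (real N\<^sub>1 - real i) * d\<^sub>1" "0 \<le> (real N\<^sub>2 - real j) * d\<^sub>2" using ij d0 by auto
    have 1: "2 ^ i * (\<alpha>\<^sub>1 * \<Psi>\<^sub>1 x y) \<le> 2 * d\<^sub>1"
    proof (rule optimal_scale_bound[OF N\<^sub>1 t(1) _ ij(1)])
      show "2 ^ i * (\<alpha>\<^sub>1 * \<Psi>\<^sub>1 x y) + (real N\<^sub>1 - real i) * d\<^sub>1 \<le> b" using le t' z unfolding piece by linarith
      fix k assume "k \<le> N\<^sub>1"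
      from bspec[OF min mem[OF this ij(2)]]
      show "2 ^ i * (\<alpha>\<^sub>1 * \<Psi>\<^sub>1 x y) + (real N\<^sub>1 - real i) * d\<^sub>1 \<le> 2 ^ k * (\<alpha>\<^sub>1 * \<Psi>\<^sub>1 x y) + (real N\<^sub>1 - real k) * d\<^sub>1"
        unfolding piece by linarith
    qed
    have 2: "2 ^ j * (\<alpha>\<^sub>2 * \<Psi>\<^sub>2 x y) \<le> 2 * d\<^sub>2"
    proof (rule optimal_scale_bound[OF N\<^sub>2 t(2) _ ij(2)])
      show "2 ^ j * (\<alpha>\<^sub>2 * \<Psi>\<^sub>2 x y) + (real N\<^sub>2 - real j) * d\<^sub>2 \<le> b" using le t' z unfolding piece by linarith
      fix k assume "k \<le> N\<^sub>2"
      from bspec[OF min mem[OF ij(1) this]]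
      show "2 ^ j * (\<alpha>\<^sub>2 * \<Psi>\<^sub>2 x y) + (real N\<^sub>2 - real j) * d\<^sub>2 \<le> 2 ^ k * (\<alpha>\<^sub>2 * \<Psi>\<^sub>2 x y) + (real N\<^sub>2 - real k) * d\<^sub>2"
        unfolding piece by linarith
    qed
    have small: "s \<le> \<kappa> / 4" if "4 / \<kappa> \<le> a" "0 \<le> s" "a * s \<le> 1" for a s :: real
    proof -
      have "4 / \<kappa> * s \<le> 1" using mult_right_mono[OF that(1,2)] that(3) by linarith
      then show ?thesis using \<kappa>(1) by (simp add: field_simps)
    qed
    have "\<alpha>\<^sub>1 * \<Psi>\<^sub>1 x y \<le> 1" "\<alpha>\<^sub>2 * \<Psi>\<^sub>2 x y \<le> 1"
      using 1 2 pow[OF t(1), of i] pow[OF t(2), of j] half(3)[of n] half(3)[of m] unfolding d\<^sub>1_def d\<^sub>2_def by linarith+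
    then have "\<Psi>\<^sub>1 x y + \<Psi>\<^sub>2 x y < \<kappa>"
      using small[OF \<alpha>\<^sub>1(1) nonneg(1)[OF xy]] small[OF \<alpha>\<^sub>2(1) nonneg(2)[OF xy]] \<kappa>(1) by linarith
    then have "dist x y < \<rho>" using \<kappa>(2) xy by (meson not_le)
    moreover have "good (2 ^ i * \<alpha>\<^sub>1) (2 ^ j * \<alpha>\<^sub>2) x y"
    proof (rule nn[OF _ xy])
      show "real (nn j) \<le> 2 ^ i * \<alpha>\<^sub>1" using n[OF ij(2)] \<alpha>\<^sub>1 pow[of \<alpha>\<^sub>1 i] by linarith
      have "inverse (real (Suc n)) \<le> inverse (real (Suc (nn j)))"
        using n[OF ij(2)] by (intro le_imp_inverse_le) auto
      then show "2 ^ i * \<alpha>\<^sub>1 * \<Psi>\<^sub>1 x y \<le> inverse (real (Suc (nn j)))"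
        using 1 half(2)[of n] unfolding d\<^sub>1_def mult.assoc by linarith
      show "2 ^ j * \<alpha>\<^sub>2 * \<Psi>\<^sub>2 x y \<le> inverse (real (Suc m))"
        using 2 half(2)[of m] unfolding d\<^sub>2_def mult.assoc by linarith
    qed
    ultimately show ?thesis by blast
  qed
  show ?thesis
    unfolding fine_penalties_def good_def[symmetric]
  proof (intro exI[of _ L] conjI ballI impI)
    show "finite L" by (simp add: L_def)
    have "piece N\<^sub>1 N\<^sub>2 = (2 ^ N\<^sub>1 * \<alpha>\<^sub>1, 2 ^ N\<^sub>2 * \<alpha>\<^sub>2, 0)" by (simp add: piece_def)
    then show "\<exists>\<alpha>\<^sub>1 \<alpha>\<^sub>2. (\<alpha>\<^sub>1, \<alpha>\<^sub>2, 0) \<in> L" using mem[of N\<^sub>1 N\<^sub>2] by auto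
  next
    fix l assume "l \<in> L"
    then obtain i j where ij: "l = piece i j" "i \<le> N\<^sub>1" "j \<le> N\<^sub>2" by (auto simp: L_def)
    then show "0 \<le> fst l" "0 \<le> fst (snd l)" "0 \<le> snd (snd l)"
      using \<alpha>\<^sub>1 \<alpha>\<^sub>2 d0 by (auto simp: piece_def)
  next
    fix l x y assume "l \<in> L" and a: "x \<in> K" "y \<in> K" "\<forall>k\<in>L. penalty \<Psi>\<^sub>1 \<Psi>\<^sub>2 l x y \<le> penalty \<Psi>\<^sub>1 \<Psi>\<^sub>2 k x y"
      "penalty \<Psi>\<^sub>1 \<Psi>\<^sub>2 l x y \<le> b"
    then obtain i j where ij: "l = piece i j" "i \<le> N\<^sub>1" "j \<le> N\<^sub>2" by (auto simp: L_def)
    show "dist x y < \<rho>" "good (fst l) (fst (snd l)) x y"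
      using active[OF ij(2,3) a(1,2)] a(3,4) unfolding ij(1) by (simp_all add: piece_def)
  qed
qed

subsection \<open>The Hamiltonian\<close>

locale hamiltonian =
  fixes E :: "'a::euclidean_space set"
    and \<Lambda> :: "'a \<Rightarrow> 'a \<Rightarrow> 't::polish_space \<Rightarrow> real"
    and \<I> :: "'a \<Rightarrow> 't \<Rightarrow> ennreal"
    and \<Upsilon> :: "'a \<Rightarrow> real"
  assumes E_interior: "E \<subseteq> closure (interior E)"
    and Lambda1: "continuous_on (E \<times> UNIV \<times> UNIV) (\<lambda>(x, p, \<theta>). \<Lambda> x p \<theta>)"
    and Lambda2: "\<forall>x\<in>E. \<forall>\<theta>. convex_on UNIV (\<lambda>p. \<Lambda> x p \<theta>) \<and> \<Lambda> x 0 \<theta> = 0"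
    and containment: "containment_function E \<Lambda> \<Upsilon>"
    and Lambda4: "\<forall>K. compact K \<and> K \<subseteq> E \<longrightarrow>
      (\<exists>M C\<^sub>1 C\<^sub>2. 0 \<le> M \<and> 0 \<le> C\<^sub>1 \<and> 0 \<le> C\<^sub>2 \<and>
        (\<forall>x\<in>K. \<forall>p \<theta>\<^sub>1 \<theta>\<^sub>2. \<Lambda> x p \<theta>\<^sub>1 \<le> max M (C\<^sub>1 * \<Lambda> x p \<theta>\<^sub>2 + C\<^sub>2)))"
    and I1: "lsc_on (E \<times> UNIV) (\<lambda>(x, \<theta>). \<I> x \<theta>)"
    and I2: "\<forall>x\<in>E. \<exists>\<theta>. \<I> x \<theta> = 0"
    and I3: "\<forall>K M. compact K \<and> K \<subseteq> E \<and> 0 \<le> M \<longrightarrow> compact (Theta_set \<I> K M)"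
    and I4: "\<forall>x\<in>E. \<forall>M\<ge>0. \<exists>U M' C\<^sub>1' C\<^sub>2'.
      openin (top_of_set E) U \<and> x \<in> U \<and> 0 \<le> M' \<and> 0 \<le> C\<^sub>1' \<and> 0 \<le> C\<^sub>2' \<and>
      (\<forall>y\<^sub>1\<in>U. \<forall>y\<^sub>2\<in>U. \<forall>\<theta>\<in>Theta_set \<I> {x} M.
        \<I> y\<^sub>1 \<theta> \<le> max (ennreal M') (ennreal C\<^sub>1' * \<I> y\<^sub>2 \<theta> + ennreal C\<^sub>2'))"
    and I5: "\<forall>K M. compact K \<and> K \<subseteq> E \<and> 0 \<le> M \<longrightarrow>
      (\<forall>\<epsilon>>0. \<exists>\<delta>>0. \<forall>\<theta>\<in>Omega_set \<I> K M. \<forall>x\<in>K. \<forall>y\<in>K. dist x y \<le> \<delta> \<longrightarrow>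
        \<bar>enn2real (\<I> x \<theta>) - enn2real (\<I> y \<theta>)\<bar> \<le> \<epsilon>)"
begin

abbreviation \<H> :: "'a \<Rightarrow> 'a \<Rightarrow> real" where "\<H> \<equiv> Ham \<Lambda> \<I>"

section \<open>Local compactness, finiteness and convexity\<close>

lemma Upsilon_C1: "\<Upsilon> \<in> C1 E"
  and Upsilon_nonneg: "x \<in> E \<Longrightarrow> 0 \<le> \<Upsilon> x"
  and compact_Upsilon: "0 \<le> c \<Longrightarrow> compact {x\<in>E. \<Upsilon> x \<le> c}"
  using containment by (auto simp: containment_function_def)

lemma continuous_Upsilon: "continuous_on E \<Upsilon>"
  by (rule C1_continuous_on[OF E_interior Upsilon_C1])

text \<open>By continuity of \<Upsilon>, the points of \<open>E\<close> near \<open>x\<close> lie in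
  the compact sublevel set at height \<open>\<Upsilon> x + 1\<close>. Thus \<open>E\<close> is
  locally compact without being open or closed.\<close>

lemma locally_compact_domain:
  assumes x: "x \<in> E" and T: "openin (top_of_set E) U" "x \<in> U"
  shows "\<exists>R>0. compact (E \<inter> cball x R) \<and> E \<inter> cball x R \<subseteq> U"
proof -
  obtain r where r: "0 < r" "ball x r \<inter> E \<subseteq> U"
    using T unfolding openin_contains_ball by blast
  obtain \<delta> where \<delta>: "0 < \<delta>" "\<And>y. y \<in> E \<Longrightarrow> dist y x < \<delta> \<Longrightarrow> dist (\<Upsilon> y) (\<Upsilon> x) < 1"
    using continuous_Upsilon x unfolding continuous_on_iff by (metis zero_less_one)
  define R where "R = min r \<delta> / 2"
  have R: "0 < R" "R < r" "R < \<delta>" using r \<delta> by (auto simp: R_def)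
  have "\<Upsilon> y \<le> \<Upsilon> x + 1" if "y \<in> E" "dist x y \<le> R" for y
    using \<delta>(2)[of y] that R by (auto simp: dist_commute dist_real_def)
  then have "E \<inter> cball x R = {y\<in>E. \<Upsilon> y \<le> \<Upsilon> x + 1} \<inter> cball x R" by auto
  moreover have "compact ({y\<in>E. \<Upsilon> y \<le> \<Upsilon> x + 1} \<inter> cball x R)"
    using compact_Upsilon[of "\<Upsilon> x + 1"] Upsilon_nonneg[OF x] by (intro compact_Int_closed) auto
  moreover have "cball x R \<subseteq> ball x r" using R by auto
  ultimately show ?thesis using R(1) r(2) by (intro exI[of _ R]) auto
qed

lemma compact_neighbourhood: "x \<in> E \<Longrightarrow> \<exists>R>0. compact (E \<inter> cball x R)"
  using locally_compact_domain[of x E] by (metis openin_subtopology_self)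

text \<open>With the second control frozen, the right-hand side of \<open>Lambda4\<close> is a bound
  that is uniform in the first.\<close>

lemma Lambda_bounded:
  assumes "x \<in> E" shows "\<exists>B. \<forall>\<theta>. \<Lambda> x p \<theta> \<le> B"
proof -
  have "compact {x} \<and> {x} \<subseteq> E" using assms by auto
  then obtain M C\<^sub>1 C\<^sub>2 where "\<forall>y\<in>{x}. \<forall>p \<theta>\<^sub>1 \<theta>\<^sub>2. \<Lambda> y p \<theta>\<^sub>1 \<le> max M (C\<^sub>1 * \<Lambda> y p \<theta>\<^sub>2 + C\<^sub>2)"
    using Lambda4 by meson
  then show ?thesis by blast
qed

lemma Ham_ereal_finite:
  assumes "x \<in> E" shows "\<bar>Ham_ereal \<Lambda> \<I> x p\<bar> \<noteq> \<infinity>"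
proof -
  obtain B where B: "\<And>\<theta>. \<Lambda> x p \<theta> \<le> B" using Lambda_bounded[OF assms] by blast
  have "Ham_ereal \<Lambda> \<I> x p \<le> ereal B"
    unfolding Ham_ereal_def
  proof (rule SUP_least)
    fix \<theta>
    have "ereal (\<Lambda> x p \<theta>) - enn2ereal (\<I> x \<theta>) \<le> ereal (\<Lambda> x p \<theta>) - 0"
      by (intro ereal_minus_mono) auto
    then show "ereal (\<Lambda> x p \<theta>) - enn2ereal (\<I> x \<theta>) \<le> ereal B" using B[of \<theta>] by (simp add: order_trans)
  qed
  moreover obtain \<theta> where \<theta>: "\<I> x \<theta> = 0" using I2 assms by blast
  have "ereal (\<Lambda> x p \<theta>) - enn2ereal (\<I> x \<theta>) \<le> Ham_ereal \<Lambda> \<I> x p"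
    unfolding Ham_ereal_def by (rule SUP_upper) simp
  ultimately show ?thesis using \<theta> zero_ennreal.rep_eq by (cases "Ham_ereal \<Lambda> \<I> x p") auto
qed

lemma ereal_Ham: "x \<in> E \<Longrightarrow> ereal (\<H> x p) = Ham_ereal \<Lambda> \<I> x p"
  using Ham_ereal_finite[of x p] by (simp add: Ham_def ereal_real)

lemma minus_enn2ereal: "i \<noteq> \<infinity> \<Longrightarrow> ereal a - enn2ereal i = ereal (a - enn2real i)"
  by (cases i) (auto simp: enn2ereal_ennreal)

lemma Ham_ge:
  assumes "x \<in> E" "\<I> x \<theta> \<noteq> \<infinity>" shows "\<Lambda> x p \<theta> - enn2real (\<I> x \<theta>) \<le> \<H> x p"
proof -
  have "ereal (\<Lambda> x p \<theta>) - enn2ereal (\<I> x \<theta>) \<le> Ham_ereal \<Lambda> \<I> x p"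
    unfolding Ham_ereal_def by (rule SUP_upper) simp
  then show ?thesis using assms by (simp add: minus_enn2ereal ereal_Ham[symmetric])
qed

lemma Ham_le:
  assumes x: "x \<in> E" and le: "\<And>\<theta>. \<I> x \<theta> \<noteq> \<infinity> \<Longrightarrow> \<Lambda> x p \<theta> - enn2real (\<I> x \<theta>) \<le> c"
  shows "\<H> x p \<le> c"
proof -
  have "Ham_ereal \<Lambda> \<I> x p \<le> ereal c"
    unfolding Ham_ereal_def
  proof (rule SUP_least)
    fix \<theta>
    show "ereal (\<Lambda> x p \<theta>) - enn2ereal (\<I> x \<theta>) \<le> ereal c"
    proof (cases "\<I> x \<theta> = \<infinity>")
      case False
      then show ?thesis using le[OF False] by (simp add: minus_enn2ereal)
    qed simp
  qed
  then show ?thesis using x by (simp add: ereal_Ham[symmetric])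
qed

lemma Ham_near_optimal:
  assumes x: "x \<in> E" and e: "0 < e"
  obtains \<theta> where "\<I> x \<theta> \<noteq> \<infinity>" "\<H> x p - e < \<Lambda> x p \<theta> - enn2real (\<I> x \<theta>)"
  using Ham_le[OF x, of p "\<H> x p - e"] e by (metis not_le diff_gt_0_iff_gt less_add_same_cancel1 diff_less_eq)

lemma Ham_le_Lambda_bound:
  assumes "x \<in> E" "\<And>\<theta>. \<Lambda> x p \<theta> \<le> c" shows "\<H> x p \<le> c"
proof (rule Ham_le[OF assms(1)])
  fix \<theta>
  show "\<Lambda> x p \<theta> - enn2real (\<I> x \<theta>) \<le> c" using assms(2)[of \<theta>] enn2real_nonneg[of "\<I> x \<theta>"] by linarith
qed

lemma Ham_zero: "x \<in> E \<Longrightarrow> \<H> x 0 \<le> 0"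
  using Lambda2 by (intro Ham_le_Lambda_bound) auto

lemma Ham_Upsilon_bounded: "\<exists>C\<ge>0. \<forall>x\<in>E. \<H> x (gradient_on E \<Upsilon> x) \<le> C"
proof -
  define s where "s = (SUP \<theta>. SUP x\<in>E. ereal (\<Lambda> x (gradient_on E \<Upsilon> x) \<theta>))"
  have "s < \<infinity>" using containment by (simp add: containment_function_def s_def)
  have up: "ereal (\<Lambda> x (gradient_on E \<Upsilon> x) \<theta>) \<le> s" if "x \<in> E" for x \<theta>
  proof -
    have "ereal (\<Lambda> x (gradient_on E \<Upsilon> x) \<theta>) \<le> (SUP x\<in>E. ereal (\<Lambda> x (gradient_on E \<Upsilon> x) \<theta>))"
      by (rule SUP_upper[OF that])
    also have "\<dots> \<le> s" unfolding s_def by (rule SUP_upper) simp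
    finally show ?thesis .
  qed
  have "\<Lambda> x (gradient_on E \<Upsilon> x) \<theta> \<le> max 0 (real_of_ereal s)" if "x \<in> E" for x \<theta>
    using up[OF that, of \<theta>] \<open>s < \<infinity>\<close> by (cases s) auto
  then show ?thesis by (intro exI[of _ "max 0 (real_of_ereal s)"]) (auto intro: Ham_le_Lambda_bound)
qed

lemma Ham_convex:
  assumes x: "x \<in> E" shows "convex_on UNIV (\<H> x)"
proof (rule convex_onI)
  fix t :: real and p q assume t: "0 < t" "t < 1"
  show "\<H> x ((1 - t) *\<^sub>R p + t *\<^sub>R q) \<le> (1 - t) * \<H> x p + t * \<H> x q"
  proof (rule Ham_le[OF x])
    fix \<theta> assume fin: "\<I> x \<theta> \<noteq> \<infinity>"
    have "\<Lambda> x ((1 - t) *\<^sub>R p + t *\<^sub>R q) \<theta> \<le> (1 - t) * \<Lambda> x p \<theta> + t * \<Lambda> x q \<theta>"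
      using Lambda2 x t by (intro convex_onD) auto
    also have "\<dots> = (1 - t) * (\<Lambda> x p \<theta> - enn2real (\<I> x \<theta>)) + t * (\<Lambda> x q \<theta> - enn2real (\<I> x \<theta>)) + enn2real (\<I> x \<theta>)"
      by (simp add: algebra_simps)
    also have "\<dots> \<le> (1 - t) * \<H> x p + t * \<H> x q + enn2real (\<I> x \<theta>)"
      using Ham_ge[OF x fin] t by (intro add_mono mult_left_mono) auto
    finally show "\<Lambda> x ((1 - t) *\<^sub>R p + t *\<^sub>R q) \<theta> - enn2real (\<I> x \<theta>) \<le> (1 - t) * \<H> x p + t * \<H> x q" by simp
  qed
qed simp

section \<open>Continuity of the Hamiltonian\<close>

lemma ennreal_le_of_enn2real: "i \<noteq> \<infinity> \<Longrightarrow> enn2real i \<le> M \<Longrightarrow> i \<le> ennreal M"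
  by (metis ennreal_enn2real ennreal_leI infinity_ennreal_def less_top)

text \<open>The cost is only controlled near a point \<open>x\<close> for those \<open>\<theta>\<close> with bounded cost at \<open>x\<close> itself;
  the radius \<open>\<rho>\<close> depends on \<open>x\<close>.\<close>

lemma cost_upper_estimate:
  assumes x: "x \<in> E" and M: "0 \<le> M" and e: "0 < e"
  shows "\<exists>\<rho>>0. \<forall>y\<in>E. dist x y < \<rho> \<longrightarrow>
    (\<forall>\<theta>. \<I> x \<theta> \<le> ennreal M \<longrightarrow> \<I> y \<theta> \<noteq> \<infinity> \<and> enn2real (\<I> y \<theta>) \<le> enn2real (\<I> x \<theta>) + e)"
proof -
  obtain U M' C\<^sub>1' C\<^sub>2' where U: "openin (top_of_set E) U" "x \<in> U" and M': "0 \<le> M'" "0 \<le> C\<^sub>1'" "0 \<le> C\<^sub>2'"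
    and le: "\<And>y\<^sub>1 y\<^sub>2 \<theta>. y\<^sub>1 \<in> U \<Longrightarrow> y\<^sub>2 \<in> U \<Longrightarrow> \<theta> \<in> Theta_set \<I> {x} M \<Longrightarrow>
      \<I> y\<^sub>1 \<theta> \<le> max (ennreal M') (ennreal C\<^sub>1' * \<I> y\<^sub>2 \<theta> + ennreal C\<^sub>2')"
    using I4[rule_format, OF x M] by blast
  obtain R where R: "0 < R" "compact (E \<inter> cball x R)" "E \<inter> cball x R \<subseteq> U"
    using locally_compact_domain[OF x U] by blast
  define K where "K = E \<inter> cball x R"
  define M2 where "M2 = max M' (C\<^sub>1' * M + C\<^sub>2')"
  have M2: "0 \<le> M2" using M' by (simp add: M2_def)
  \<comment> \<open>\<open>I4\<close> carries the bound from \<open>x\<close> to all of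
    \<open>K\<close>, with one constant for all \<theta> concerned. This places \<theta> in the
    class \<open>Omega_set\<close>, on which \<open>I5\<close> gives equicontinuity.\<close>
  have bound: "\<I> y \<theta> \<le> ennreal M2" if "\<I> x \<theta> \<le> ennreal M" "y \<in> K" for y \<theta>
  proof -
    have "\<theta> \<in> Theta_set \<I> {x} M" using that by (simp add: Theta_set_def)
    then have "\<I> y \<theta> \<le> max (ennreal M') (ennreal C\<^sub>1' * \<I> x \<theta> + ennreal C\<^sub>2')"
      using le[of y x \<theta>] U(2) R(3) that(2) by (auto simp: K_def)
    also have "\<dots> \<le> max (ennreal M') (ennreal C\<^sub>1' * ennreal M + ennreal C\<^sub>2')"
      by (intro max.mono order_refl add_mono mult_left_mono that(1)) auto
    also have "ennreal C\<^sub>1' * ennreal M + ennreal C\<^sub>2' = ennreal (C\<^sub>1' * M + C\<^sub>2')"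
      using M' M by (simp add: ennreal_mult)
    also have "max (ennreal M') (ennreal (C\<^sub>1' * M + C\<^sub>2')) \<le> ennreal M2"
      unfolding M2_def by (intro max.boundedI ennreal_leI) auto
    finally show ?thesis .
  qed
  obtain \<delta> where \<delta>: "0 < \<delta>" "\<And>\<theta> a b. \<theta> \<in> Omega_set \<I> K M2 \<Longrightarrow> a \<in> K \<Longrightarrow> b \<in> K \<Longrightarrow> dist a b \<le> \<delta> \<Longrightarrow>
      \<bar>enn2real (\<I> a \<theta>) - enn2real (\<I> b \<theta>)\<bar> \<le> e"
    using I5 R(2) M2 e unfolding K_def by (metis inf_le1)
  have "\<I> y \<theta> \<noteq> \<infinity> \<and> enn2real (\<I> y \<theta>) \<le> enn2real (\<I> x \<theta>) + e"
    if "y \<in> E" "dist x y < min R \<delta>" "\<I> x \<theta> \<le> ennreal M" for y \<theta>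
  proof -
    have "y \<in> K" "x \<in> K" using that x R(1) by (auto simp: K_def)
    moreover have "\<theta> \<in> Omega_set \<I> K M2" using bound that(3) by (simp add: Omega_set_def)
    ultimately have "\<bar>enn2real (\<I> x \<theta>) - enn2real (\<I> y \<theta>)\<bar> \<le> e" using that by (intro \<delta>(2)) auto
    moreover have "\<I> y \<theta> \<noteq> \<infinity>" using bound[OF that(3) \<open>y \<in> K\<close>] by (auto simp: top_unique)
    ultimately show ?thesis by linarith
  qed
  then show ?thesis using R(1) \<delta>(1) by (intro exI[of _ "min R \<delta>"]) auto
qed

lemma Lambda_tendsto:
  assumes "\<And>n. X n \<in> E" "x \<in> E" "X \<longlonglongrightarrow> x" "P \<longlonglongrightarrow> p" "T \<longlonglongrightarrow> \<theta>"
  shows "(\<lambda>n. \<Lambda> (X n) (P n) (T n)) \<longlonglongrightarrow> \<Lambda> x p \<theta>"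
proof -
  have "(\<lambda>n. (\<lambda>(x, p, \<theta>). \<Lambda> x p \<theta>) (X n, P n, T n)) \<longlonglongrightarrow> (\<lambda>(x, p, \<theta>). \<Lambda> x p \<theta>) (x, p, \<theta>)"
    by (rule continuous_on_tendsto_compose[OF Lambda1 tendsto_Pair[OF assms(3) tendsto_Pair[OF assms(4,5)]]])
      (use assms in auto)
  then show ?thesis by simp
qed

text \<open>A control that is nearly optimal at \<open>x\<close> is kept at the nearby points: its
  cost rises by little there, and \<Lambda> is continuous.\<close>

lemma Ham_lower_semicontinuous:
  assumes X: "\<And>n. X n \<in> E" "x \<in> E" "X \<longlonglongrightarrow> x" "P \<longlonglongrightarrow> p" and c: "c < \<H> x p"
  shows "\<forall>\<^sub>F n in sequentially. c < \<H> (X n) (P n)"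
proof -
  define e where "e = (\<H> x p - c) / 3"
  have e: "0 < e" using c by (simp add: e_def)
  obtain \<theta> where \<theta>: "\<I> x \<theta> \<noteq> \<infinity>" "\<H> x p - e < \<Lambda> x p \<theta> - enn2real (\<I> x \<theta>)"
    by (rule Ham_near_optimal[OF X(2) e])
  have "\<I> x \<theta> \<le> ennreal (enn2real (\<I> x \<theta>))" by (rule ennreal_le_of_enn2real[OF \<theta>(1)]) simp
  then obtain \<rho> where \<rho>: "0 < \<rho>" "\<And>y. y \<in> E \<Longrightarrow> dist x y < \<rho> \<Longrightarrow> \<I> y \<theta> \<noteq> \<infinity> \<and> enn2real (\<I> y \<theta>) \<le> enn2real (\<I> x \<theta>) + e"
    using cost_upper_estimate[OF X(2) enn2real_nonneg e] by blast
  have "\<forall>\<^sub>F n in sequentially. dist (X n) x < \<rho>" using X(3) \<rho>(1) by (rule tendstoD)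
  moreover have "\<Lambda> x p \<theta> - e < \<Lambda> x p \<theta>" using e by simp
  then have "\<forall>\<^sub>F n in sequentially. \<Lambda> x p \<theta> - e < \<Lambda> (X n) (P n) \<theta>"
    using Lambda_tendsto[OF X tendsto_const] by (rule order_tendstoD(1)[rotated])
  ultimately show ?thesis
  proof eventually_elim
    case (elim n)
    then have "\<I> (X n) \<theta> \<noteq> \<infinity>" "enn2real (\<I> (X n) \<theta>) \<le> enn2real (\<I> x \<theta>) + e"
      using \<rho>(2)[OF X(1)[of n]] by (auto simp: dist_commute)
    then have "\<Lambda> (X n) (P n) \<theta> - (enn2real (\<I> x \<theta>) + e) \<le> \<H> (X n) (P n)"
      using Ham_ge[OF X(1)[of n], of \<theta> "P n"] by linarith
    moreover have "3 * e = \<H> x p - c" by (simp add: e_def)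
    ultimately show ?case using \<theta>(2) elim by linarith
  qed
qed

text \<open>Controls nearly optimal along the sequence have bounded cost, because \<Lambda> is
  bounded along it uniformly in \<theta>; by \<open>I3\<close> they subconverge. Lower
  semicontinuity of the cost makes the limiting control a competitor at the limit point.\<close>

lemma Ham_not_above_limit:
  assumes X: "\<And>n. X n \<in> E" "x \<in> E" "X \<longlonglongrightarrow> x" "P \<longlonglongrightarrow> p" and ge: "\<And>n. c \<le> \<H> (X n) (P n)"
  shows "c \<le> \<H> x p"
proof (rule ccontr)
  assume "\<not> c \<le> \<H> x p"
  define e where "e = (c - \<H> x p) / 2"
  have e: "0 < e" using \<open>\<not> c \<le> \<H> x p\<close> by (simp add: e_def)
  have "\<exists>\<theta>. \<I> (X n) \<theta> \<noteq> \<infinity> \<and> \<H> (X n) (P n) - e < \<Lambda> (X n) (P n) \<theta> - enn2real (\<I> (X n) \<theta>)" for n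
    using Ham_near_optimal[OF X(1) e] by metis
  then obtain T where T: "\<And>n. \<I> (X n) (T n) \<noteq> \<infinity>"
    "\<And>n. \<H> (X n) (P n) - e < \<Lambda> (X n) (P n) (T n) - enn2real (\<I> (X n) (T n))" by metis
  have cost: "enn2real (\<I> (X n) (T n)) < \<Lambda> (X n) (P n) (T n) - c + e" for n
    using T(2)[of n] ge[of n] by linarith
  define K where "K = insert x (range X)"
  have K: "compact K" "K \<subseteq> E" using compact_sequence_with_limit[OF X(3)] X by (auto simp: K_def)
  then obtain M C\<^sub>1 C\<^sub>2 where C: "0 \<le> M" "0 \<le> C\<^sub>1" "0 \<le> C\<^sub>2"
    "\<And>x p \<theta>\<^sub>1 \<theta>\<^sub>2. x \<in> K \<Longrightarrow> \<Lambda> x p \<theta>\<^sub>1 \<le> max M (C\<^sub>1 * \<Lambda> x p \<theta>\<^sub>2 + C\<^sub>2)"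
    using Lambda4 by meson
  \<comment> \<open>An arbitrary reference control. Along the sequence its \<Lambda> values
    converge, hence are bounded, and \<open>Lambda4\<close> extends the bound to all
    controls.\<close>
  obtain \<theta>0 :: 't where True by simp
  have "Bseq (\<lambda>n. \<Lambda> (X n) (P n) \<theta>0)"
    using Lambda_tendsto[OF X tendsto_const] by (intro convergent_imp_Bseq convergentI)
  then obtain B where B: "\<And>n. \<bar>\<Lambda> (X n) (P n) \<theta>0\<bar> \<le> B" unfolding Bseq_def by auto
  define B' where "B' = max M (C\<^sub>1 * B + C\<^sub>2)"
  have LB: "\<Lambda> (X n) (P n) (T n) \<le> B'" for n
  proof -
    have "\<Lambda> (X n) (P n) (T n) \<le> max M (C\<^sub>1 * \<Lambda> (X n) (P n) \<theta>0 + C\<^sub>2)" by (rule C(4)) (simp add: K_def)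
    also have "\<dots> \<le> B'" unfolding B'_def
      using B[of n] C(2) by (intro max.mono order_refl add_mono mult_left_mono) auto
    finally show ?thesis .
  qed
  have costM: "enn2real (\<I> (X n) (T n)) \<le> max 0 (B' - c + e)" for n using cost[of n] LB[of n] by linarith
  have "\<And>n. T n \<in> Theta_set \<I> K (max 0 (B' - c + e))"
    unfolding Theta_set_def using ennreal_le_of_enn2real[OF T(1) costM] by (auto simp: K_def)
  moreover have "compact (Theta_set \<I> K (max 0 (B' - c + e)))" using I3 K by auto
  ultimately obtain \<theta> r where r: "strict_mono r" "(T \<circ> r) \<longlonglongrightarrow> \<theta>"
    unfolding compact_def by metis
  have Xr: "(\<lambda>n. X (r n)) \<longlonglongrightarrow> x" and Pr: "(\<lambda>n. P (r n)) \<longlonglongrightarrow> p"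
    using LIMSEQ_subseq_LIMSEQ[OF X(3) r(1)] LIMSEQ_subseq_LIMSEQ[OF X(4) r(1)] by (simp_all add: o_def)
  have Tr: "(\<lambda>n. T (r n)) \<longlonglongrightarrow> \<theta>" using r(2) by (simp add: o_def)
  have lim: "(\<lambda>n. \<Lambda> (X (r n)) (P (r n)) (T (r n))) \<longlonglongrightarrow> \<Lambda> x p \<theta>"
    using X(1) by (intro Lambda_tendsto X(2) Xr Pr Tr) auto
  \<comment> \<open>Limit of the upper bounds for the costs along the subsequence. It bounds the
    cost at the limit, so the Hamiltonian there is at least \<open>c - e\<close>, contradicting the
    gap of \<open>2 * e\<close>.\<close>
  define t where "t = \<Lambda> x p \<theta> - c + e"
  have "(\<lambda>n. \<Lambda> (X (r n)) (P (r n)) (T (r n)) - c + e) \<longlonglongrightarrow> t"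
    unfolding t_def by (intro tendsto_intros lim)
  moreover have "0 \<le> \<Lambda> (X (r n)) (P (r n)) (T (r n)) - c + e" for n
    using cost[of "r n"] enn2real_nonneg[of "\<I> (X (r n)) (T (r n))"] by linarith
  ultimately have t0: "0 \<le> t" by (intro LIMSEQ_le_const) auto
  have "\<I> x \<theta> \<le> ennreal t"
  proof (rule ccontr)
    assume "\<not> \<I> x \<theta> \<le> ennreal t"
    then obtain s where s: "ennreal t < s" "s < \<I> x \<theta>" using dense by (meson not_le)
    then obtain q where q: "s = ennreal q" "0 \<le> q" by (cases s) auto
    have tq: "t < q" using s(1) t0 q by (simp add: ennreal_less_iff)
    obtain W where W: "open W" "{z\<in>E \<times> UNIV. s < (\<lambda>(x, \<theta>). \<I> x \<theta>) z} = (E \<times> UNIV) \<inter> W"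
      using I1 unfolding lsc_on_def openin_open by blast
    have "(x, \<theta>) \<in> {z\<in>E \<times> UNIV. s < (\<lambda>(x, \<theta>). \<I> x \<theta>) z}" using s(2) X(2) by simp
    then have "(x, \<theta>) \<in> W" unfolding W(2) by (rule IntD2)
    then have "\<forall>\<^sub>F n in sequentially. (X (r n), T (r n)) \<in> W"
      using tendsto_Pair[OF Xr Tr] W(1) by (simp add: topological_tendstoD)
    moreover have "\<forall>\<^sub>F n in sequentially. \<Lambda> (X (r n)) (P (r n)) (T (r n)) - c + e < q"
      using \<open>_ \<longlonglongrightarrow> t\<close> tq by (rule order_tendstoD(2))
    ultimately have "\<forall>\<^sub>F n in sequentially. False"
    proof eventually_elim
      case (elim n)
      then have "(X (r n), T (r n)) \<in> {z\<in>E \<times> UNIV. s < (\<lambda>(x, \<theta>). \<I> x \<theta>) z}"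
        unfolding W(2) using X(1) by simp
      then have "ennreal q < \<I> (X (r n)) (T (r n))" by (simp add: q)
      then have "q < enn2real (\<I> (X (r n)) (T (r n)))"
        using T(1)[of "r n"] q(2) by (cases "\<I> (X (r n)) (T (r n))") (auto simp: ennreal_less_iff)
      then show ?case using cost[of "r n"] elim by linarith
    qed
    then show False by simp
  qed
  then have "\<I> x \<theta> \<noteq> \<infinity>" "enn2real (\<I> x \<theta>) \<le> t"
    using t0 by (auto simp: top_unique enn2real_leI)
  then have "c - e \<le> \<H> x p" using Ham_ge[OF X(2), of \<theta> p] unfolding t_def by linarith
  moreover have "2 * e = c - \<H> x p" by (simp add: e_def)
  ultimately show False using e by linarith
qed

lemma Ham_continuous: "continuous_on (E \<times> UNIV) (\<lambda>(x, p). \<H> x p)"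
  unfolding continuous_on_sequentially
proof (intro allI ballI impI, elim conjE)
  fix Z z assume Z: "\<forall>n. Z n \<in> E \<times> (UNIV :: 'a set)" and z: "z \<in> E \<times> (UNIV :: 'a set)" and lim: "Z \<longlonglongrightarrow> z"
  define X P where "X n = fst (Z n)" and "P n = snd (Z n)" for n
  have XP: "\<And>n. X n \<in> E" "fst z \<in> E" "X \<longlonglongrightarrow> fst z" "P \<longlonglongrightarrow> snd z"
    using Z z tendsto_fst[OF lim] tendsto_snd[OF lim] by (auto simp: X_def[abs_def] P_def[abs_def] mem_Times_iff)
  have "(\<lambda>n. \<H> (X n) (P n)) \<longlonglongrightarrow> \<H> (fst z) (snd z)"
  proof (rule order_tendstoI)
    show "\<forall>\<^sub>F n in sequentially. c < \<H> (X n) (P n)" if "c < \<H> (fst z) (snd z)" for c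
      by (rule Ham_lower_semicontinuous[OF XP that])
  next
    fix c assume c: "\<H> (fst z) (snd z) < c"
    show "\<forall>\<^sub>F n in sequentially. \<H> (X n) (P n) < c"
    proof (rule ccontr)
      assume "\<not> ?thesis"
      then have "\<exists>\<^sub>F n in sequentially. c \<le> \<H> (X n) (P n)" by (simp add: frequently_def not_le)
      then have "infinite {n. c \<le> \<H> (X n) (P n)}"
        unfolding cofinite_eq_sequentially[symmetric] frequently_cofinite .
      from infinite_enumerate[OF this]
      obtain r :: "nat \<Rightarrow> nat" where r: "strict_mono r" "\<forall>n. r n \<in> {n. c \<le> \<H> (X n) (P n)}"
        by blast
      have "c \<le> \<H> (fst z) (snd z)"
      proof (rule Ham_not_above_limit)
        show "(X \<circ> r) n \<in> E" for n by (simp add: XP(1))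
        show "fst z \<in> E" by (rule XP(2))
        show "(X \<circ> r) \<longlonglongrightarrow> fst z" by (rule LIMSEQ_subseq_LIMSEQ[OF XP(3) r(1)])
        show "(P \<circ> r) \<longlonglongrightarrow> snd z" by (rule LIMSEQ_subseq_LIMSEQ[OF XP(4) r(1)])
        show "c \<le> \<H> ((X \<circ> r) n) ((P \<circ> r) n)" for n using r(2) by simp
      qed
      then show False using c by simp
    qed
  qed
  then show "((\<lambda>(x, p). \<H> x p) \<circ> Z) \<longlonglongrightarrow> (\<lambda>(x, p). \<H> x p) z"
    by (simp add: o_def case_prod_unfold X_def P_def)
qed

lemma Ham_op_continuous:
  assumes "f \<in> Ccc_inf E" shows "continuous_on E (Ham_op E \<Lambda> \<I> f)"
proof -
  have "f \<in> C1 E" using assms Cinf_subset_C1 by (auto simp: Ccc_inf_def)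
  then have "continuous_on E (\<lambda>x. (x, gradient_on E f x))"
    by (intro continuous_on_Pair continuous_on_id continuous_on_gradient_on E_interior)
  from continuous_on_compose2[OF Ham_continuous this]
  show ?thesis by (simp add: Ham_op_def[abs_def] image_subset_iff)
qed

end

subsection \<open>Inf-convolutions with finitely many penalties\<close>

text \<open>\<open>B\<close> truncates the inf-convolutions: where the truncation is attained the test gradient is \<open>0\<close>, and \<open>B\<close>
  exceeds \<open>h / (1 - \<epsilon>)\<close>. \<open>R\<close> is so large that minima and maxima lie in the compact set \<open>{\<Upsilon> \<le> R}\<close>.\<close>

locale comparison = hamiltonian E \<Lambda> \<I> \<Upsilon>
  for E :: "'a::euclidean_space set"
    and \<Lambda> :: "'a \<Rightarrow> 'a \<Rightarrow> 't::polish_space \<Rightarrow> real"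
    and \<I> :: "'a \<Rightarrow> 't \<Rightarrow> ennreal"
    and \<Upsilon> :: "'a \<Rightarrow> real" +
  fixes \<Psi>\<^sub>1 \<Psi>\<^sub>2 :: "'a \<Rightarrow> 'a \<Rightarrow> real" and h u v :: "'a \<Rightarrow> real" and lam C\<^sub>\<Upsilon> Bh Bu Bv \<epsilon> B R :: real
  assumes pen: "penalization_pair E \<Psi>\<^sub>1 \<Psi>\<^sub>2"
    and h_cont: "continuous_on E h" and lam: "0 < lam"
    and u_sub: "viscosity_subsolution E (Ccc_inf E) (Ham_op E \<Lambda> \<I>) lam h u"
    and v_super: "viscosity_supersolution E (Ccc_inf E) (Ham_op E \<Lambda> \<I>) lam h v"
    and C\<^sub>\<Upsilon>: "\<And>x. x \<in> E \<Longrightarrow> \<H> x (gradient_on E \<Upsilon> x) \<le> C\<^sub>\<Upsilon>" and C\<^sub>\<Upsilon>0: "0 \<le> C\<^sub>\<Upsilon>"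
    and Bh: "\<And>x. x \<in> E \<Longrightarrow> \<bar>h x\<bar> \<le> Bh" and Bu: "\<And>x. x \<in> E \<Longrightarrow> u x \<le> Bu"
    and Bv: "\<And>x. x \<in> E \<Longrightarrow> - Bv \<le> v x" and B0: "0 \<le> Bh" "0 \<le> Bv" "0 \<le> B" "0 \<le> R"
    and \<epsilon>: "0 < \<epsilon>" "\<epsilon> < 1"
    and B_h: "Bh / (1 - \<epsilon>) \<le> B" and R_y: "(1 + \<epsilon>) * B + Bv < \<epsilon> * R" and R_x: "Bu + Bv \<le> \<epsilon> * R"
begin

definition K :: "'a set" where "K = {x\<in>E. \<Upsilon> x \<le> R}"

text \<open>The term with \<Upsilon> pushes \<open>vh\<close> above \<open>B\<close> outside
  \<open>K\<close>. The divisor makes the test gradient for \<open>vh\<close> a convex combination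
  of one for \<open>v\<close> and the gradient of \<Upsilon>.\<close>

definition vh :: "'a \<Rightarrow> real" where "vh y = (v y + \<epsilon> * \<Upsilon> y) / (1 + \<epsilon>)"

abbreviation P :: "real \<times> real \<times> real \<Rightarrow> 'a \<Rightarrow> 'a \<Rightarrow> real" where "P \<equiv> penalty \<Psi>\<^sub>1 \<Psi>\<^sub>2"

abbreviation p\<^sub>x :: "real \<times> real \<times> real \<Rightarrow> 'a \<Rightarrow> 'a \<Rightarrow> 'a" where
  "p\<^sub>x l x y \<equiv> pair_grad1 E \<Psi>\<^sub>1 \<Psi>\<^sub>2 (fst l) (fst (snd l)) x y"

abbreviation p\<^sub>y :: "real \<times> real \<times> real \<Rightarrow> 'a \<Rightarrow> 'a \<Rightarrow> 'a" where
  "p\<^sub>y l x y \<equiv> - pair_grad2 E \<Psi>\<^sub>1 \<Psi>\<^sub>2 (fst l) (fst (snd l)) x y"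

definition g :: "(real \<times> real \<times> real) set \<Rightarrow> 'a \<Rightarrow> real" where
  "g L x = Inf (insert B ((\<lambda>(l, y). vh y + P l x y) ` (L \<times> K)))"

text \<open>The member with zero cost vanishes on the diagonal, which gives
  \<open>g L x \<le> vh x\<close>.\<close>

definition admissible :: "(real \<times> real \<times> real) set \<Rightarrow> bool" where
  "admissible L \<longleftrightarrow> finite L \<and> (\<exists>\<alpha>\<^sub>1 \<alpha>\<^sub>2. (\<alpha>\<^sub>1, \<alpha>\<^sub>2, 0) \<in> L) \<and> (\<forall>l\<in>L. 0 \<le> fst l \<and> 0 \<le> fst (snd l) \<and> 0 \<le> snd (snd l))"

text \<open>The inequality is in fact an equality, by \<open>g_le\<close>. It is written as an
  inequality because in this form it bounds the lower semicontinuous \<open>v y\<close> by a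
  continuous function.\<close>

definition active :: "(real \<times> real \<times> real) set \<Rightarrow> real \<times> real \<times> real \<Rightarrow> 'a \<Rightarrow> 'a \<Rightarrow> bool" where
  "active L l x y \<longleftrightarrow> l \<in> L \<and> y \<in> K \<and> vh y + P l x y \<le> g L x"

lemma K: "compact K" "K \<subseteq> E"
  using compact_Upsilon B0 by (auto simp: K_def)

lemma \<epsilon>': "0 < 1 - \<epsilon>" "0 < 1 + \<epsilon>" using \<epsilon> by auto

lemma Psi_nonneg: "x \<in> E \<Longrightarrow> y \<in> E \<Longrightarrow> 0 \<le> \<Psi>\<^sub>1 x y" "x \<in> E \<Longrightarrow> y \<in> E \<Longrightarrow> 0 \<le> \<Psi>\<^sub>2 x y"
  and Psi_C1: "(\<lambda>(x, y). \<Psi>\<^sub>1 x y) \<in> C1 (E \<times> E)" "(\<lambda>(x, y). \<Psi>\<^sub>2 x y) \<in> C1 (E \<times> E)"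
  and Psi_diag: "x \<in> E \<Longrightarrow> \<Psi>\<^sub>1 x x = 0" "x \<in> E \<Longrightarrow> \<Psi>\<^sub>2 x x = 0"
  using pen unfolding penalization_pair_def by blast+

lemma penalty_nonneg: "admissible L \<Longrightarrow> l \<in> L \<Longrightarrow> x \<in> E \<Longrightarrow> y \<in> E \<Longrightarrow> 0 \<le> P l x y"
  using Psi_nonneg unfolding admissible_def penalty_def by (simp add: add_nonneg_nonneg)

lemma continuous_penalty: "continuous_on (E \<times> E) (\<lambda>z. P l (fst z) (snd z))"
proof -
  have "continuous_on (E \<times> E) (\<lambda>(x, y). \<Psi>\<^sub>1 x y)" "continuous_on (E \<times> E) (\<lambda>(x, y). \<Psi>\<^sub>2 x y)"
    using Psi_C1 C1_continuous_on[OF subset_closure_interior_Times[OF E_interior]] by auto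
  then show ?thesis unfolding penalty_def case_prod_unfold by (intro continuous_intros)
qed

lemma penalty_superjet1:
  assumes "x \<in> E" "y \<in> E" shows "p\<^sub>x l x y \<in> superjet E (\<lambda>z. P l z y) x"
proof (rule superjet_has_derivative)
  have "((\<lambda>z. fst l * \<Psi>\<^sub>1 z y + fst (snd l) * \<Psi>\<^sub>2 z y + snd (snd l)) has_derivative
      (\<lambda>w. fst l * (grad1 E \<Psi>\<^sub>1 x y \<bullet> w) + fst (snd l) * (grad1 E \<Psi>\<^sub>2 x y \<bullet> w) + 0)) (at x within E)"
    by (intro has_derivative_add has_derivative_mult_right has_derivative_const
        grad1_has_derivative[OF E_interior] Psi_C1 assms)
  then show "((\<lambda>z. P l z y) has_derivative (\<lambda>w. p\<^sub>x l x y \<bullet> w)) (at x within E)"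
    by (simp add: penalty_def pair_grad1_def inner_add_left)
qed

lemma penalty_superjet2:
  assumes "x \<in> E" "y \<in> E" shows "- p\<^sub>y l x y \<in> superjet E (\<lambda>z. P l x z) y"
proof (rule superjet_has_derivative)
  have "((\<lambda>z. fst l * \<Psi>\<^sub>1 x z + fst (snd l) * \<Psi>\<^sub>2 x z + snd (snd l)) has_derivative
      (\<lambda>w. fst l * (grad2 E \<Psi>\<^sub>1 x y \<bullet> w) + fst (snd l) * (grad2 E \<Psi>\<^sub>2 x y \<bullet> w) + 0)) (at y within E)"
    by (intro has_derivative_add has_derivative_mult_right has_derivative_const
        grad2_has_derivative[OF E_interior] Psi_C1 assms)
  then show "((\<lambda>z. P l x z) has_derivative (\<lambda>w. - p\<^sub>y l x y \<bullet> w)) (at y within E)"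
    unfolding penalty_def minus_minus pair_grad2_def inner_add_left inner_scaleR_left by simp
qed

lemma Upsilon_superjet: "x \<in> E \<Longrightarrow> gradient_on E \<Upsilon> x \<in> superjet E \<Upsilon> x"
  by (intro superjet_has_derivative gradient_on_has_derivative E_interior Upsilon_C1)

lemma vh_ge: "y \<in> E \<Longrightarrow> v y / (1 + \<epsilon>) \<le> vh y" and vh_lower: "y \<in> E \<Longrightarrow> - Bv \<le> vh y"
proof -
  assume y: "y \<in> E"
  have "0 \<le> \<epsilon> * \<Upsilon> y" using Upsilon_nonneg[OF y] \<epsilon> by simp
  then show 1: "v y / (1 + \<epsilon>) \<le> vh y" unfolding vh_def using \<epsilon>' by (intro divide_right_mono) auto
  have "- Bv * (1 + \<epsilon>) \<le> v y" using Bv[OF y] mult_nonneg_nonneg[OF B0(2), of \<epsilon>] \<epsilon> by (simp add: algebra_simps)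
  then have "- Bv \<le> v y / (1 + \<epsilon>)" using \<epsilon>' by (simp add: le_divide_eq)
  then show "- Bv \<le> vh y" using 1 by linarith
qed

lemma vh_outside: "y \<in> E \<Longrightarrow> y \<notin> K \<Longrightarrow> B < vh y"
proof -
  assume y: "y \<in> E" "y \<notin> K"
  then have "\<epsilon> * R < \<epsilon> * \<Upsilon> y" using \<epsilon> by (simp add: K_def)
  then have "(1 + \<epsilon>) * B < v y + \<epsilon> * \<Upsilon> y" using R_y Bv[OF y(1)] by linarith
  then show "B < vh y" unfolding vh_def using \<epsilon>' by (simp add: less_divide_eq mult.commute)
qed

section \<open>Values, continuity and minimisers of one inf-convolution\<close>

context
  fixes L assumes L: "admissible L"
begin

lemma g_bdd: "x \<in> E \<Longrightarrow> bdd_below (insert B ((\<lambda>(l, y). vh y + P l x y) ` (L \<times> K)))"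
proof (rule bdd_belowI[of _ "- Bv"])
  fix s assume x: "x \<in> E" and "s \<in> insert B ((\<lambda>(l, y). vh y + P l x y) ` (L \<times> K))"
  then consider "s = B" | l y where "l \<in> L" "y \<in> K" "s = vh y + P l x y" by auto
  then show "- Bv \<le> s"
  proof cases
    case 1
    then show ?thesis using B0 by simp
  next
    case 2
    then have "y \<in> E" using K by blast
    then show ?thesis using vh_lower[of y] penalty_nonneg[OF L 2(1) x, of y] 2(3) by linarith
  qed
qed

lemma g_le_B: "x \<in> E \<Longrightarrow> g L x \<le> B"
  unfolding g_def by (intro cInf_lower g_bdd) auto

text \<open>Outside \<open>K\<close> the value of \<open>vh\<close> already exceeds the truncation
  level. Hence an active \<open>y\<close> minimises over all of \<open>E\<close>, as needed for jets
  relative to \<open>E\<close>.\<close>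

lemma g_le: 
  assumes "x \<in> E" "l \<in> L" "y \<in> E" shows "g L x \<le> vh y + P l x y"
proof (cases "y \<in> K")
  case True
  then show ?thesis unfolding g_def using assms by (intro cInf_lower g_bdd) auto
next
  case False
  then show ?thesis
    using g_le_B[OF assms(1)] vh_outside[OF assms(3)] penalty_nonneg[OF L assms(2,1,3)] by linarith
qed

lemma g_ge: "x \<in> E \<Longrightarrow> - Bv \<le> g L x"
  unfolding g_def
proof (rule cInf_greatest)
  fix s assume x: "x \<in> E" and "s \<in> insert B ((\<lambda>(l, y). vh y + P l x y) ` (L \<times> K))"
  then consider "s = B" | l y where "l \<in> L" "y \<in> K" "s = vh y + P l x y" by auto
  then show "- Bv \<le> s"
  proof cases
    case 1
    then show ?thesis using B0 by simp
  next
    case 2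
    then have "y \<in> E" using K by blast
    then show ?thesis using vh_lower[of y] penalty_nonneg[OF L 2(1) x, of y] 2(3) by linarith
  qed
qed simp

lemma g_le_vh:
  assumes "x \<in> E" shows "g L x \<le> vh x"
proof -
  obtain \<alpha>\<^sub>1 \<alpha>\<^sub>2 where l: "(\<alpha>\<^sub>1, \<alpha>\<^sub>2, 0) \<in> L" using L unfolding admissible_def by blast
  then show ?thesis using g_le[OF assms l assms] Psi_diag[OF assms] by (simp add: penalty_def)
qed

lemma penalty_attains_min:
  assumes "x \<in> E" "K \<noteq> {}" shows "\<exists>y\<in>K. \<forall>z\<in>K. vh y + P l x y \<le> vh z + P l x z"
proof -
  have c: "continuous_on K (\<lambda>y. \<epsilon> * \<Upsilon> y + (1 + \<epsilon>) * P l x y)"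
  proof (intro continuous_intros continuous_on_subset[OF continuous_Upsilon] K(2))
    have "continuous_on K (\<lambda>y. P l (fst (x, y)) (snd (x, y)))"
      by (rule continuous_on_compose2[OF continuous_penalty]) (use assms K in \<open>auto intro!: continuous_intros\<close>)
    then show "continuous_on K (P l x)" by simp
  qed
  have "lsc_on E v" using v_super by (simp add: viscosity_supersolution_def)
  from lsc_on_attains_min[OF this K assms(2) c] obtain y where y: "y \<in> K"
    "\<forall>z\<in>K. v y + (\<epsilon> * \<Upsilon> y + (1 + \<epsilon>) * P l x y) \<le> v z + (\<epsilon> * \<Upsilon> z + (1 + \<epsilon>) * P l x z)" by blast
  have eq: "vh z + P l x z = (v z + (\<epsilon> * \<Upsilon> z + (1 + \<epsilon>) * P l x z)) / (1 + \<epsilon>)" for z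
    using \<epsilon>' by (simp add: vh_def field_simps)
  show ?thesis unfolding eq using y \<epsilon>' by (intro bexI[of _ y] ballI divide_right_mono) auto
qed

lemma g_attained:
  assumes x: "x \<in> E" shows "g L x = B \<or> (\<exists>l\<in>L. \<exists>y\<in>K. g L x = vh y + P l x y)"
proof (cases "K = {}")
  case True
  then show ?thesis by (simp add: g_def)
next
  case False
  have "\<forall>l. \<exists>y. y \<in> K \<and> (\<forall>z\<in>K. vh y + P l x y \<le> vh z + P l x z)"
    using penalty_attains_min[OF x False] by blast
  then obtain Y where Y: "\<And>l. Y l \<in> K" "\<And>l z. z \<in> K \<Longrightarrow> vh (Y l) + P l x (Y l) \<le> vh z + P l x z" by metis
  have "finite L" "L \<noteq> {}" using L by (auto simp: admissible_def)
  then obtain l where l: "l \<in> L" "\<And>k. k \<in> L \<Longrightarrow> vh (Y l) + P l x (Y l) \<le> vh (Y k) + P k x (Y k)"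
    using ex_min_if_finite[of "(\<lambda>l. vh (Y l) + P l x (Y l)) ` L"] by (auto simp: not_less)
  have "min B (vh (Y l) + P l x (Y l)) \<le> g L x"
    unfolding g_def
  proof (rule cInf_greatest)
    fix s assume "s \<in> insert B ((\<lambda>(l, y). vh y + P l x y) ` (L \<times> K))"
    then consider "s = B" | k y where "k \<in> L" "y \<in> K" "s = vh y + P k x y" by auto
    then show "min B (vh (Y l) + P l x (Y l)) \<le> s"
    proof cases
      case 2
      then show ?thesis using l(2)[OF 2(1)] Y(2)[OF 2(2), of k] by linarith
    qed simp
  qed simp
  moreover have "g L x \<le> vh (Y l) + P l x (Y l)" using K(2) Y(1) by (intro g_le[OF x l(1)]) blast
  ultimately have "g L x = B \<or> g L x = vh (Y l) + P l x (Y l)" using g_le_B[OF x] by linarith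
  then show ?thesis using l(1) Y(1) by blast
qed

text \<open>A pair attaining the infimum at one point competes at any other, so the modulus is that
  of the finitely many penalties on \<open>K \<times> K\<close>; continuity of \<open>v\<close> does
  not enter.\<close>

lemma continuous_g: "continuous_on K (g L)"
  unfolding continuous_on_iff
proof (intro ballI allI impI)
  fix x and e :: real assume x: "x \<in> K" and e: "0 < e"
  have "\<exists>d>0. \<forall>x'\<in>K. \<forall>y\<in>K. dist x' x < d \<longrightarrow> \<bar>P l x' y - P l x y\<bar> < e / 2" for l
  proof -
    have "uniformly_continuous_on (K \<times> K) (\<lambda>z. P l (fst z) (snd z))"
      using K by (intro compact_uniformly_continuous continuous_on_subset[OF continuous_penalty] compact_Times) auto
    then obtain d where d: "0 < d" "\<And>z z'. z \<in> K \<times> K \<Longrightarrow> z' \<in> K \<times> K \<Longrightarrow> dist z' z < d \<Longrightarrow>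
        dist (P l (fst z') (snd z')) (P l (fst z) (snd z)) < e / 2"
      unfolding uniformly_continuous_on_def using e by (metis half_gt_zero)
    have "\<bar>P l x' y - P l x y\<bar> < e / 2" if "x' \<in> K" "y \<in> K" "dist x' x < d" for x' y
      using d(2)[of "(x, y)" "(x', y)"] that x by (simp add: dist_Pair_Pair dist_real_def)
    then show ?thesis using d(1) by blast
  qed
  then obtain d where d: "\<And>l. 0 < d l"
    "\<And>l x' y. x' \<in> K \<Longrightarrow> y \<in> K \<Longrightarrow> dist x' x < d l \<Longrightarrow> \<bar>P l x' y - P l x y\<bar> < e / 2" by metis
  define D where "D = Min (insert 1 (d ` L))"
  have D: "0 < D" "\<And>l. l \<in> L \<Longrightarrow> D \<le> d l" using L d(1) by (auto simp: D_def admissible_def)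
  have one: "g L b \<le> g L a + e / 2" if ab: "a \<in> K" "b \<in> K"
    and close: "\<And>l y. l \<in> L \<Longrightarrow> y \<in> K \<Longrightarrow> \<bar>P l b y - P l a y\<bar> < e / 2" for a b
  proof -
    have E: "a \<in> E" "b \<in> E" using ab K by auto
    consider "g L a = B" | l y where "l \<in> L" "y \<in> K" "g L a = vh y + P l a y" using g_attained[OF E(1)] by blast
    then show ?thesis
    proof cases
      case 1
      then show ?thesis using g_le_B[OF E(2)] e by linarith
    next
      case 2
      then have "g L b \<le> vh y + P l b y" using K E by (intro g_le) auto
      then show ?thesis using close[OF 2(1,2)] 2(3) by linarith
    qed
  qed
  have "dist (g L x') (g L x) < e" if x': "x' \<in> K" "dist x' x < D" for x'
  proof -
    have c: "\<bar>P l x' y - P l x y\<bar> < e / 2" if "l \<in> L" "y \<in> K" for l y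
      using d(2)[of x' y l] D(2)[OF that(1)] x' that by linarith
    then have c': "\<bar>P l x y - P l x' y\<bar> < e / 2" if "l \<in> L" "y \<in> K" for l y
      using that by (simp add: abs_minus_commute)
    have "g L x' \<le> g L x + e / 2" by (rule one[OF x x'(1) c])
    moreover have "g L x \<le> g L x' + e / 2" by (rule one[OF x'(1) x c'])
    ultimately show ?thesis using e by (simp add: dist_real_def)
  qed
  then show "\<exists>d>0. \<forall>x'\<in>K. dist x' x < d \<longrightarrow> dist (g L x') (g L x) < e" using D(1) by blast
qed

lemma active_minimal:
  assumes x: "x \<in> E" and a: "active L l x y"
  shows "\<forall>k\<in>L. P l x y \<le> P k x y" "P l x y \<le> B + Bv" "vh y \<le> B" "vh y \<le> g L x"
proof -
  have y: "y \<in> E" "l \<in> L" and le: "vh y + P l x y \<le> g L x" using a K by (auto simp: active_def)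
  show "\<forall>k\<in>L. P l x y \<le> P k x y" using g_le[OF x _ y(1)] le by fastforce
  show "P l x y \<le> B + Bv" using le g_le_B[OF x] vh_lower[OF y(1)] by linarith
  show "vh y \<le> B" "vh y \<le> g L x" using le g_le_B[OF x] penalty_nonneg[OF L y(2) x y(1)] by linarith+
qed

text \<open>For fixed \<open>x\<close>, the point \<open>y\<close> minimises
  \<open>vh + P l x\<close>, so \<open>q\<close> is a subjet of \<open>v\<close> there. The penalty
  gradient is \<open>q\<close> with weight \<open>1 / (1 + \<epsilon>)\<close> plus the gradient of
  \<Upsilon> with weight \<open>\<epsilon> / (1 + \<epsilon>)\<close>, and convexity leaves only the
  error \<open>lam * (\<epsilon> * C\<^sub>\<Upsilon>)\<close>.\<close>

lemma active_supersolution: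
  assumes x: "x \<in> E" and a: "active L l x y"
  shows "lam * ((1 + \<epsilon>) * \<H> y (p\<^sub>y l x y)) + h y \<le> v y + lam * (\<epsilon> * C\<^sub>\<Upsilon>)"
proof -
  have y: "y \<in> E" "l \<in> L" and le: "vh y + P l x y \<le> g L x" using a K by (auto simp: active_def)
  define q where "q = (1 + \<epsilon>) *\<^sub>R p\<^sub>y l x y - \<epsilon> *\<^sub>R gradient_on E \<Upsilon> y"
  have "(1 + \<epsilon>) *\<^sub>R (- p\<^sub>y l x y) + \<epsilon> *\<^sub>R gradient_on E \<Upsilon> y \<in> superjet E (\<lambda>z. (1 + \<epsilon>) * P l x z + \<epsilon> * \<Upsilon> z) y"
    using \<epsilon> by (intro superjet_add superjet_scaleR penalty_superjet2 Upsilon_superjet x y) auto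
  moreover have "(1 + \<epsilon>) *\<^sub>R (- p\<^sub>y l x y) + \<epsilon> *\<^sub>R gradient_on E \<Upsilon> y = - q" by (simp add: q_def)
  ultimately have "- q \<in> superjet E (\<lambda>z. (1 + \<epsilon>) * P l x z + \<epsilon> * \<Upsilon> z) y" by simp
  then have "- q \<in> superjet E (\<lambda>z. - v z) y"
  proof (rule superjet_mono)
    fix z assume z: "z \<in> E"
    have "vh y + P l x y \<le> vh z + P l x z" using le g_le[OF x y(2) z] by linarith
    then have "(1 + \<epsilon>) * (vh y + P l x y) \<le> (1 + \<epsilon>) * (vh z + P l x z)" using \<epsilon>' by (intro mult_left_mono) auto
    moreover have "(1 + \<epsilon>) * vh w = v w + \<epsilon> * \<Upsilon> w" for w using \<epsilon>' by (simp add: vh_def)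
    ultimately show "- v z - - v y \<le> (1 + \<epsilon>) * P l x z + \<epsilon> * \<Upsilon> z - ((1 + \<epsilon>) * P l x y + \<epsilon> * \<Upsilon> y)"
      by (simp only: distrib_left)
  qed
  moreover obtain r where "0 < r" "compact (E \<inter> cball y r)" using compact_neighbourhood[OF y(1)] by blast
  moreover have "viscosity_supersolution E (Ccc_inf E) (\<lambda>f x. \<H> x (gradient_on E f x)) lam h v"
    using v_super by (simp add: Ham_op_def[abs_def])
  ultimately have sup: "lam * \<H> y q + h y \<le> v y"
    by (intro supersolution_subjet[OF E_interior _ Ham_continuous h_cont y(1)])
  have "p\<^sub>y l x y = (1 - \<epsilon> / (1 + \<epsilon>)) *\<^sub>R q + (\<epsilon> / (1 + \<epsilon>)) *\<^sub>R gradient_on E \<Upsilon> y"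
  proof -
    have "1 - \<epsilon> / (1 + \<epsilon>) = 1 / (1 + \<epsilon>)" using \<epsilon>' by (simp add: field_simps)
    then show ?thesis using \<epsilon>' by (simp add: q_def scaleR_diff_right)
  qed
  moreover have "\<H> y ((1 - \<epsilon> / (1 + \<epsilon>)) *\<^sub>R q + (\<epsilon> / (1 + \<epsilon>)) *\<^sub>R gradient_on E \<Upsilon> y)
      \<le> (1 - \<epsilon> / (1 + \<epsilon>)) * \<H> y q + (\<epsilon> / (1 + \<epsilon>)) * \<H> y (gradient_on E \<Upsilon> y)"
    using \<epsilon> by (intro convex_onD[OF Ham_convex[OF y(1)]]) auto
  ultimately have "(1 + \<epsilon>) * \<H> y (p\<^sub>y l x y) \<le> (1 + \<epsilon>) * ((1 - \<epsilon> / (1 + \<epsilon>)) * \<H> y q + (\<epsilon> / (1 + \<epsilon>)) * \<H> y (gradient_on E \<Upsilon> y))"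
    using \<epsilon>' by (intro mult_left_mono) auto
  also have "\<dots> = ((1 + \<epsilon>) * (1 - \<epsilon> / (1 + \<epsilon>))) * \<H> y q + ((1 + \<epsilon>) * (\<epsilon> / (1 + \<epsilon>))) * \<H> y (gradient_on E \<Upsilon> y)"
    by (simp only: distrib_left mult.assoc)
  also have "\<dots> = \<H> y q + \<epsilon> * \<H> y (gradient_on E \<Upsilon> y)" using \<epsilon>' by (simp add: right_diff_distrib)
  also have "\<dots> \<le> \<H> y q + \<epsilon> * C\<^sub>\<Upsilon>" using C\<^sub>\<Upsilon>[OF y(1)] \<epsilon> by simp
  finally have "lam * ((1 + \<epsilon>) * \<H> y (p\<^sub>y l x y)) \<le> lam * (\<H> y q + \<epsilon> * C\<^sub>\<Upsilon>)"
    using lam by (intro mult_left_mono) auto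
  then show ?thesis using sup by (simp add: distrib_left)
qed

end

section \<open>Bounds at active pairs\<close>

lemma fine_admissible: "fine_penalties E \<Lambda> \<Psi>\<^sub>1 \<Psi>\<^sub>2 K K' C \<eta>\<^sub>0 \<rho> b L \<Longrightarrow> admissible L"
  unfolding fine_penalties_def admissible_def by blast

text \<open>The budget \<open>B + Bv\<close> is the bound for an active penalty that follows from
  \<open>g L x \<le> B\<close> and \<open>- Bv \<le> vh y\<close>, so active pairs are among those
  controlled by the family.\<close>

lemma fine_active:
  assumes L: "fine_penalties E \<Lambda> \<Psi>\<^sub>1 \<Psi>\<^sub>2 K K' C \<eta>\<^sub>0 \<rho> (B + Bv) L" and x: "x \<in> K" and a: "active L l x y"
  shows "dist x y < \<rho>"
    and "\<theta> \<in> K' \<Longrightarrow> \<Lambda> y (p\<^sub>y l x y) \<theta> \<le> C \<Longrightarrow> - C \<le> \<Lambda> x (p\<^sub>x l x y) \<theta> \<Longrightarrow>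
      \<Lambda> x (p\<^sub>x l x y) \<theta> - \<Lambda> y (p\<^sub>y l x y) \<theta> < \<eta>\<^sub>0"
proof -
  have "l \<in> L" "y \<in> K" using a by (auto simp: active_def)
  moreover have "x \<in> E" using x K by blast
  ultimately have *: "dist x y < \<rho> \<and> (\<forall>\<theta>\<in>K'. \<Lambda> y (p\<^sub>y l x y) \<theta> \<le> C \<longrightarrow> - C \<le> \<Lambda> x (p\<^sub>x l x y) \<theta> \<longrightarrow>
      \<Lambda> x (p\<^sub>x l x y) \<theta> - \<Lambda> y (p\<^sub>y l x y) \<theta> < \<eta>\<^sub>0)"
    using L x active_minimal(1,2)[OF fine_admissible[OF L] _ a] unfolding fine_penalties_def by blast
  from * show "dist x y < \<rho>" by blast
  from * show "\<Lambda> x (p\<^sub>x l x y) \<theta> - \<Lambda> y (p\<^sub>y l x y) \<theta> < \<eta>\<^sub>0"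
    if "\<theta> \<in> K'" "\<Lambda> y (p\<^sub>y l x y) \<theta> \<le> C" "- C \<le> \<Lambda> x (p\<^sub>x l x y) \<theta>" using that by blast
qed

definition C\<^sub>6 :: real where "C\<^sub>6 = (Bh / (1 - \<epsilon>) + Bv) / lam"

text \<open>The supersolution inequality bounds the Hamiltonian at \<open>y\<close> by
  \<open>C\<^sub>0\<close>, hence \<Lambda> at a zero-cost control; \<open>Lambda4\<close> spreads
  this to all controls (\<open>C\<^sub>3\<close>), the continuity estimate carries it to
  \<open>x\<close>, and \<open>Lambda4\<close> spreads it again (\<open>C\<^sub>4\<close>). Together
  with the lower bound \<open>- C\<^sub>6\<close>, which holds whenever the excess is nonnegative, a
  near-optimal control at \<open>x\<close> has cost at most \<open>M\<close>. These constants do not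
  depend on the family \<open>L\<close>, so it may be built for them.\<close>

lemma active_estimates:
  assumes \<eta>\<^sub>0: "0 < \<eta>\<^sub>0"
  shows "\<exists>C\<^sub>4\<ge>0. \<exists>M\<ge>0. \<exists>C. \<forall>\<rho> L l x y. fine_penalties E \<Lambda> \<Psi>\<^sub>1 \<Psi>\<^sub>2 K (Theta_set \<I> K M) C \<eta>\<^sub>0 \<rho> (B + Bv) L \<longrightarrow>
    x \<in> K \<longrightarrow> active L l x y \<longrightarrow> \<H> x (p\<^sub>x l x y) \<le> C\<^sub>4 \<and>
    (\<forall>\<theta>. \<I> x \<theta> \<noteq> \<infinity> \<longrightarrow> \<H> x (p\<^sub>x l x y) - \<eta>\<^sub>0 < \<Lambda> x (p\<^sub>x l x y) \<theta> - enn2real (\<I> x \<theta>) \<longrightarrow> - C\<^sub>6 \<le> \<H> x (p\<^sub>x l x y) \<longrightarrow>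
      \<I> x \<theta> \<le> ennreal M \<and> \<Lambda> x (p\<^sub>x l x y) \<theta> - \<Lambda> y (p\<^sub>y l x y) \<theta> < \<eta>\<^sub>0)"
proof -
  obtain M\<^sub>0 C\<^sub>1 C\<^sub>2 where C: "0 \<le> M\<^sub>0" "0 \<le> C\<^sub>1" "0 \<le> C\<^sub>2"
    "\<And>x p \<theta>\<^sub>1 \<theta>\<^sub>2. x \<in> K \<Longrightarrow> \<Lambda> x p \<theta>\<^sub>1 \<le> max M\<^sub>0 (C\<^sub>1 * \<Lambda> x p \<theta>\<^sub>2 + C\<^sub>2)"
    using Lambda4[rule_format, OF conjI[OF K]] by blast
  have trans: "\<Lambda> x p \<theta> \<le> max M\<^sub>0 (C\<^sub>1 * c + C\<^sub>2)" if "x \<in> K" "\<Lambda> x p \<theta>' \<le> c" for x p \<theta> \<theta>' c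
  proof -
    have "C\<^sub>1 * \<Lambda> x p \<theta>' \<le> C\<^sub>1 * c" using that C by (intro mult_left_mono)
    then show ?thesis using C(4)[OF that(1), of p \<theta> \<theta>'] by linarith
  qed
  define C\<^sub>0 where "C\<^sub>0 = ((1 + \<epsilon>) * B + lam * (\<epsilon> * C\<^sub>\<Upsilon>) + Bh) / (lam * (1 + \<epsilon>))"
  define C\<^sub>3 where "C\<^sub>3 = max M\<^sub>0 (C\<^sub>1 * C\<^sub>0 + C\<^sub>2)"
  define C\<^sub>4 where "C\<^sub>4 = max M\<^sub>0 (C\<^sub>1 * (C\<^sub>3 + \<eta>\<^sub>0) + C\<^sub>2)"
  have C6: "0 \<le> C\<^sub>6" unfolding C\<^sub>6_def using B0 \<epsilon>' lam by simp
  define M where "M = C\<^sub>4 + C\<^sub>6 + \<eta>\<^sub>0"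
  define CC where "CC = max C\<^sub>3 (C\<^sub>6 + \<eta>\<^sub>0)"
  have nn: "0 \<le> C\<^sub>3" "0 \<le> C\<^sub>4" "0 \<le> M" "C\<^sub>3 \<le> CC" "C\<^sub>6 + \<eta>\<^sub>0 \<le> CC"
    using C(1) C6 \<eta>\<^sub>0 by (auto simp: C\<^sub>3_def C\<^sub>4_def M_def CC_def)
  have "\<H> x (p\<^sub>x l x y) \<le> C\<^sub>4 \<and>
    (\<forall>\<theta>. \<I> x \<theta> \<noteq> \<infinity> \<longrightarrow> \<H> x (p\<^sub>x l x y) - \<eta>\<^sub>0 < \<Lambda> x (p\<^sub>x l x y) \<theta> - enn2real (\<I> x \<theta>) \<longrightarrow> - C\<^sub>6 \<le> \<H> x (p\<^sub>x l x y) \<longrightarrow>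
      \<I> x \<theta> \<le> ennreal M \<and> \<Lambda> x (p\<^sub>x l x y) \<theta> - \<Lambda> y (p\<^sub>y l x y) \<theta> < \<eta>\<^sub>0)"
    if L: "fine_penalties E \<Lambda> \<Psi>\<^sub>1 \<Psi>\<^sub>2 K (Theta_set \<I> K M) CC \<eta>\<^sub>0 \<rho> (B + Bv) L" and x: "x \<in> K" and a: "active L l x y"
    for \<rho> L l x y
  proof -
    have adm: "admissible L" by (rule fine_admissible[OF L])
    have E: "x \<in> E" "y \<in> E" "y \<in> K" using x a K by (auto simp: active_def)
    have "v y / (1 + \<epsilon>) \<le> B" using vh_ge[OF E(2)] active_minimal(3)[OF adm E(1) a] by linarith
    then have "v y \<le> (1 + \<epsilon>) * B" using \<epsilon>' by (simp add: divide_le_eq mult.commute)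
    then have "lam * ((1 + \<epsilon>) * \<H> y (p\<^sub>y l x y)) \<le> (1 + \<epsilon>) * B + lam * (\<epsilon> * C\<^sub>\<Upsilon>) + Bh"
      using active_supersolution[OF adm E(1) a] Bh[OF E(2)] by linarith
    then have Hy: "\<H> y (p\<^sub>y l x y) \<le> C\<^sub>0"
      unfolding C\<^sub>0_def using lam \<epsilon>' by (simp add: le_divide_eq mult.assoc mult.left_commute mult.commute)
    obtain \<theta>\<^sub>y where "\<I> y \<theta>\<^sub>y = 0" using I2 E(2) by blast
    then have "\<Lambda> y (p\<^sub>y l x y) \<theta>\<^sub>y \<le> C\<^sub>0" using Ham_ge[OF E(2), of \<theta>\<^sub>y "p\<^sub>y l x y"] Hy by simp
    then have Ly: "\<Lambda> y (p\<^sub>y l x y) \<theta> \<le> C\<^sub>3" for \<theta> unfolding C\<^sub>3_def by (rule trans[OF E(3)])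
    obtain \<theta>\<^sub>x where \<theta>\<^sub>x: "\<I> x \<theta>\<^sub>x = 0" using I2 E(1) by blast
    \<comment> \<open>Zero cost puts this control into the compact set whatever \<open>M\<close> is,
      so the estimate is usable before any lower bound on the Hamiltonian. If \<Lambda> is too
      negative for the estimate, its upper bound is immediate.\<close>
    have "\<theta>\<^sub>x \<in> Theta_set \<I> K M" unfolding Theta_set_def using x \<theta>\<^sub>x by (intro UN_I[of x]) auto
    note * = fine_active(2)[OF L x a this order_trans[OF Ly nn(4)]]
    have "\<Lambda> x (p\<^sub>x l x y) \<theta>\<^sub>x \<le> C\<^sub>3 + \<eta>\<^sub>0"
    proof (cases "- CC \<le> \<Lambda> x (p\<^sub>x l x y) \<theta>\<^sub>x")
      case True
      then show ?thesis using *[OF True] Ly[of \<theta>\<^sub>x] by linarith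
    next
      case False
      then show ?thesis using nn \<eta>\<^sub>0 by linarith
    qed
    then have Lx: "\<Lambda> x (p\<^sub>x l x y) \<theta> \<le> C\<^sub>4" for \<theta> unfolding C\<^sub>4_def by (rule trans[OF x])
    have Hx: "\<H> x (p\<^sub>x l x y) \<le> C\<^sub>4" by (rule Ham_le_Lambda_bound[OF E(1) Lx])
    moreover have "\<I> x \<theta> \<le> ennreal M \<and> \<Lambda> x (p\<^sub>x l x y) \<theta> - \<Lambda> y (p\<^sub>y l x y) \<theta> < \<eta>\<^sub>0"
      if fin: "\<I> x \<theta> \<noteq> \<infinity>" and near: "\<H> x (p\<^sub>x l x y) - \<eta>\<^sub>0 < \<Lambda> x (p\<^sub>x l x y) \<theta> - enn2real (\<I> x \<theta>)"
        and low: "- C\<^sub>6 \<le> \<H> x (p\<^sub>x l x y)" for \<theta>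
    proof -
      have "enn2real (\<I> x \<theta>) \<le> M" using Lx[of \<theta>] near low unfolding M_def by linarith
      then have I: "\<I> x \<theta> \<le> ennreal M" by (rule ennreal_le_of_enn2real[OF fin])
      then have "\<theta> \<in> Theta_set \<I> K M" unfolding Theta_set_def using x by (intro UN_I[of x]) auto
      moreover have "- CC \<le> \<Lambda> x (p\<^sub>x l x y) \<theta>"
        using near low nn(5) enn2real_nonneg[of "\<I> x \<theta>"] by linarith
      ultimately have "\<Lambda> x (p\<^sub>x l x y) \<theta> - \<Lambda> y (p\<^sub>y l x y) \<theta> < \<eta>\<^sub>0"
        using fine_active(2)[OF L x a] order_trans[OF Ly nn(4)] by blast
      then show ?thesis using I by blast
    qed
    ultimately show ?thesis by blast
  qed
  then show ?thesis using nn(2,3) by blast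
qed

section \<open>Loss in the comparison through one inf-convolution\<close>

text \<open>At an active pair \<open>v y / (1 + \<epsilon>)\<close> lies below \<open>g L x\<close>,
  so this bounds the failure of \<open>lam * \<H> x q + h x / (1 - \<epsilon>) \<le> g L x\<close>
  for the penalty gradient \<open>q\<close>. The divisor under \<open>h\<close> anticipates the
  factor \<open>1 - \<epsilon>\<close> in front of the combination.\<close>

definition excess :: "real \<times> real \<times> real \<Rightarrow> 'a \<Rightarrow> 'a \<Rightarrow> real" where
  "excess l x y = lam * \<H> x (p\<^sub>x l x y) + h x / (1 - \<epsilon>) - v y / (1 + \<epsilon>)"

definition bad_points :: "real \<Rightarrow> (real \<times> real \<times> real) set \<Rightarrow> 'a set" where
  "bad_points \<eta> L = {x\<in>K. \<exists>l y. active L l x y \<and> \<eta> \<le> excess l x y}"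

lemma excess_lower: 
  assumes "x \<in> E" "y \<in> E" "0 \<le> excess l x y" shows "- C\<^sub>6 \<le> \<H> x (p\<^sub>x l x y)"
proof -
  have "h x / (1 - \<epsilon>) \<le> Bh / (1 - \<epsilon>)" using Bh[OF assms(1)] \<epsilon>' by (intro divide_right_mono) auto
  moreover have "- Bv * (1 + \<epsilon>) \<le> v y"
    using Bv[OF assms(2)] mult_nonneg_nonneg[OF B0(2), of \<epsilon>] \<epsilon> by (simp add: algebra_simps)
  then have "- Bv \<le> v y / (1 + \<epsilon>)" using \<epsilon>' by (simp add: le_divide_eq)
  ultimately have "- (Bh / (1 - \<epsilon>) + Bv) \<le> lam * \<H> x (p\<^sub>x l x y)" using assms(3) unfolding excess_def by linarith
  then have "- (Bh / (1 - \<epsilon>) + Bv) / lam \<le> \<H> x (p\<^sub>x l x y)" using lam by (simp add: divide_le_eq mult.commute)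
  then show ?thesis unfolding C\<^sub>6_def minus_divide_left .
qed

lemma excess_upper:
  assumes "x \<in> E" "y \<in> E" "\<H> x (p\<^sub>x l x y) \<le> c" shows "excess l x y \<le> lam * c + Bh / (1 - \<epsilon>) + Bv"
proof -
  have "h x / (1 - \<epsilon>) \<le> Bh / (1 - \<epsilon>)" using Bh[OF assms(1)] \<epsilon>' by (intro divide_right_mono) auto
  moreover have "- Bv * (1 + \<epsilon>) \<le> v y"
    using Bv[OF assms(2)] mult_nonneg_nonneg[OF B0(2), of \<epsilon>] \<epsilon> by (simp add: algebra_simps)
  then have "- Bv \<le> v y / (1 + \<epsilon>)" using \<epsilon>' by (simp add: le_divide_eq)
  moreover have "lam * \<H> x (p\<^sub>x l x y) \<le> lam * c" using assms(3) lam by (intro mult_left_mono) auto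
  ultimately show ?thesis unfolding excess_def by linarith
qed

lemma continuous_on_px: "continuous_on (E \<times> E) (\<lambda>z. p\<^sub>x l (fst z) (snd z))"
  using continuous_on_grad1[OF E_interior Psi_C1(1)] continuous_on_grad1[OF E_interior Psi_C1(2)]
  unfolding pair_grad1_def case_prod_unfold by (intro continuous_intros)

text \<open>Solved for \<open>v y\<close>, activity and large excess become upper bounds by
  functions \<open>c\<close> and \<open>c'\<close> that are continuous in the pair. The bad set is
  then a finite union of projections of compact sets.\<close>

lemma closed_bad_points:
  assumes L: "admissible L" shows "closed (bad_points \<eta> L)"
proof -
  have lsc: "lsc_on E v" using v_super by (simp add: viscosity_supersolution_def)
  have KK: "compact (K \<times> K)" "K \<times> K \<subseteq> E \<times> E" using K by (auto intro: compact_Times)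
  define c where "c l z = (1 + \<epsilon>) * (g L (fst z) - P l (fst z) (snd z)) - \<epsilon> * \<Upsilon> (snd z)" for l and z :: "'a \<times> 'a"
  define c' where "c' l z = (1 + \<epsilon>) * (lam * \<H> (fst z) (p\<^sub>x l (fst z) (snd z)) + h (fst z) / (1 - \<epsilon>) - \<eta>)"
    for l and z :: "'a \<times> 'a"
  have fs: "continuous_on (K \<times> K) (\<lambda>z. f (fst z))" "continuous_on (K \<times> K) (\<lambda>z. f (snd z))"
    if "continuous_on K f" for f :: "'a \<Rightarrow> real"
    by (rule continuous_on_compose2[OF that]; auto intro!: continuous_intros)+
  have cont: "continuous_on (K \<times> K) (c l)" for l
    unfolding c_def
    by (intro continuous_intros fs continuous_g[OF L] continuous_on_subset[OF continuous_penalty KK(2)]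
        continuous_on_subset[OF continuous_Upsilon K(2)])
  have "continuous_on (K \<times> K) (\<lambda>z. (\<lambda>(x, p). \<H> x p) (fst z, p\<^sub>x l (fst z) (snd z)))" for l
    by (rule continuous_on_compose2[OF Ham_continuous])
      (use KK in \<open>auto intro!: continuous_intros continuous_on_subset[OF continuous_on_px]\<close>)
  then have cont': "continuous_on (K \<times> K) (c' l)" for l
    unfolding c'_def case_prod_conv
    by (intro continuous_intros fs continuous_on_subset[OF h_cont K(2)]) (use \<epsilon> in auto)
  have cl: "closed {z\<in>K \<times> K. v (snd z) \<le> f z}" if "continuous_on (K \<times> K) f" for f
    by (rule lsc_on_closed_sublevel[OF lsc compact_imp_closed[OF KK(1)] _ _ that])
      (use K in \<open>auto intro!: continuous_intros\<close>)
  define Z where "Z l = {z\<in>K \<times> K. v (snd z) \<le> c l z} \<inter> {z\<in>K \<times> K. v (snd z) \<le> c' l z}" for l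
  have "compact (Z l)" for l
  proof -
    have "compact ((K \<times> K) \<inter> Z l)"
      unfolding Z_def by (intro compact_Int_closed KK(1) closed_Int cl cont cont')
    moreover have "(K \<times> K) \<inter> Z l = Z l" by (auto simp: Z_def)
    ultimately show ?thesis by simp
  qed
  then have "compact (\<Union>l\<in>L. fst ` Z l)"
    using L by (intro compact_UN compact_continuous_image continuous_intros) (auto simp: admissible_def)
  moreover have "bad_points \<eta> L = (\<Union>l\<in>L. fst ` Z l)"
  proof -
    have 1: "vh y + P l x y \<le> g L x \<longleftrightarrow> v y \<le> c l (x, y)" for l x y
    proof -
      have "vh y + P l x y \<le> g L x \<longleftrightarrow> vh y \<le> g L x - P l x y" by linarith
      also have "\<dots> \<longleftrightarrow> v y + \<epsilon> * \<Upsilon> y \<le> (g L x - P l x y) * (1 + \<epsilon>)"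
        unfolding vh_def using \<epsilon>' by (simp add: pos_divide_le_eq)
      also have "\<dots> \<longleftrightarrow> v y \<le> c l (x, y)" by (auto simp: c_def mult.commute)
      finally show ?thesis .
    qed
    have 2: "\<eta> \<le> excess l x y \<longleftrightarrow> v y \<le> c' l (x, y)" for l x y
    proof -
      have "\<eta> \<le> excess l x y \<longleftrightarrow> v y / (1 + \<epsilon>) \<le> lam * \<H> x (p\<^sub>x l x y) + h x / (1 - \<epsilon>) - \<eta>"
        unfolding excess_def by linarith
      also have "\<dots> \<longleftrightarrow> v y \<le> c' l (x, y)"
        unfolding c'_def using \<epsilon>' by (simp add: pos_divide_le_eq mult.commute)
      finally show ?thesis .
    qed
    show ?thesis
    proof (intro equalityI subsetI)
      fix x assume "x \<in> bad_points \<eta> L"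
      then obtain l y where *: "x \<in> K" "l \<in> L" "y \<in> K" "v y \<le> c l (x, y)" "v y \<le> c' l (x, y)"
        unfolding bad_points_def active_def 1 2 by blast
      then have "(x, y) \<in> Z l" by (simp add: Z_def)
      then show "x \<in> (\<Union>l\<in>L. fst ` Z l)" using *(2) by (intro UN_I[of l] image_eqI[of _ _ "(x, y)"]) auto
    next
      fix x assume "x \<in> (\<Union>l\<in>L. fst ` Z l)"
      then obtain l z where *: "l \<in> L" "z \<in> Z l" "x = fst z" by blast
      then have "x \<in> K" "snd z \<in> K" "v (snd z) \<le> c l (x, snd z)" "v (snd z) \<le> c' l (x, snd z)"
        by (auto simp: Z_def)
      then show "x \<in> bad_points \<eta> L" unfolding bad_points_def active_def 1 2 using *(1) by blast
    qed
  qed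
  ultimately show ?thesis by (simp add: compact_imp_closed)
qed

text \<open>The radius depends on \<open>x\<close>, through the cost estimate there, but not on the
  family. Three errors of at most \<open>\<eta> / 4\<close> occur: the two divisors of
  \<open>h\<close> together with \<Upsilon>, the transfer of the Hamiltonian from \<open>x\<close>
  to \<open>y\<close>, and the variation of \<open>h\<close>.\<close>

lemma excess_eventually_small:
  assumes x: "x \<in> K" and M: "0 \<le> M" and \<eta>\<^sub>0: "0 < \<eta>\<^sub>0" and \<eta>: "0 < \<eta>"
    and small: "Bh * (1 / (1 - \<epsilon>) - 1 / (1 + \<epsilon>)) + lam * (\<epsilon> * C\<^sub>\<Upsilon>) \<le> \<eta> / 4" "lam * (3 * \<eta>\<^sub>0) \<le> \<eta> / 4"
  shows "\<exists>r>0. \<forall>L l y. admissible L \<longrightarrow> active L l x y \<longrightarrow> dist x y < r \<longrightarrow>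
    (\<forall>\<theta>. \<I> x \<theta> \<noteq> \<infinity> \<longrightarrow> \<H> x (p\<^sub>x l x y) - \<eta>\<^sub>0 < \<Lambda> x (p\<^sub>x l x y) \<theta> - enn2real (\<I> x \<theta>) \<longrightarrow> - C\<^sub>6 \<le> \<H> x (p\<^sub>x l x y) \<longrightarrow>
      \<I> x \<theta> \<le> ennreal M \<and> \<Lambda> x (p\<^sub>x l x y) \<theta> - \<Lambda> y (p\<^sub>y l x y) \<theta> < \<eta>\<^sub>0) \<longrightarrow>
    excess l x y < \<eta>"
proof -
  have xE: "x \<in> E" using x K by blast
  obtain r\<^sub>1 where r\<^sub>1: "0 < r\<^sub>1" "\<And>y \<theta>. y \<in> E \<Longrightarrow> dist x y < r\<^sub>1 \<Longrightarrow> \<I> x \<theta> \<le> ennreal M \<Longrightarrow>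
      \<I> y \<theta> \<noteq> \<infinity> \<and> enn2real (\<I> y \<theta>) \<le> enn2real (\<I> x \<theta>) + \<eta>\<^sub>0"
    using cost_upper_estimate[OF xE M \<eta>\<^sub>0] by blast
  have "0 < (1 - \<epsilon>) * (\<eta> / 4)" using \<epsilon>' \<eta> by simp
  then obtain r\<^sub>2 where r\<^sub>2: "0 < r\<^sub>2" "\<And>y. y \<in> E \<Longrightarrow> dist y x < r\<^sub>2 \<Longrightarrow> dist (h y) (h x) < (1 - \<epsilon>) * (\<eta> / 4)"
    using h_cont xE unfolding continuous_on_iff by meson
  have "excess l x y < \<eta>"
    if adm: "admissible L" and a: "active L l x y" and d: "dist x y < min r\<^sub>1 r\<^sub>2"
      and est: "\<And>\<theta>. \<I> x \<theta> \<noteq> \<infinity> \<Longrightarrow> \<H> x (p\<^sub>x l x y) - \<eta>\<^sub>0 < \<Lambda> x (p\<^sub>x l x y) \<theta> - enn2real (\<I> x \<theta>) \<Longrightarrow>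
        - C\<^sub>6 \<le> \<H> x (p\<^sub>x l x y) \<Longrightarrow> \<I> x \<theta> \<le> ennreal M \<and> \<Lambda> x (p\<^sub>x l x y) \<theta> - \<Lambda> y (p\<^sub>y l x y) \<theta> < \<eta>\<^sub>0"
    for L l y
  proof (rule ccontr)
    assume "\<not> excess l x y < \<eta>"
    then have ge: "\<eta> \<le> excess l x y" by simp
    have yE: "y \<in> E" using a K by (auto simp: active_def)
    have low: "- C\<^sub>6 \<le> \<H> x (p\<^sub>x l x y)" using ge \<eta> by (intro excess_lower[OF xE yE]) linarith
    obtain \<theta> where \<theta>: "\<I> x \<theta> \<noteq> \<infinity>" "\<H> x (p\<^sub>x l x y) - \<eta>\<^sub>0 < \<Lambda> x (p\<^sub>x l x y) \<theta> - enn2real (\<I> x \<theta>)"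
      by (rule Ham_near_optimal[OF xE \<eta>\<^sub>0])
    have est': "\<I> x \<theta> \<le> ennreal M" "\<Lambda> x (p\<^sub>x l x y) \<theta> - \<Lambda> y (p\<^sub>y l x y) \<theta> < \<eta>\<^sub>0"
      using est[OF \<theta> low] by auto
    have I: "\<I> y \<theta> \<noteq> \<infinity>" "enn2real (\<I> y \<theta>) \<le> enn2real (\<I> x \<theta>) + \<eta>\<^sub>0"
      using r\<^sub>1(2)[OF yE _ est'(1)] d by auto
    \<comment> \<open>One \<open>\<eta>\<^sub>0\<close> each for near-optimality at
      \<open>x\<close>, for the continuity estimate, and for the change of cost from
      \<open>x\<close> to \<open>y\<close>.\<close>
    have "\<H> x (p\<^sub>x l x y) \<le> \<H> y (p\<^sub>y l x y) + 3 * \<eta>\<^sub>0"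
      using Ham_ge[OF yE I(1), of "p\<^sub>y l x y"] I(2) est'(2) \<theta>(2) by linarith
    then have 1: "lam * \<H> x (p\<^sub>x l x y) \<le> lam * \<H> y (p\<^sub>y l x y) + lam * (3 * \<eta>\<^sub>0)"
      using lam by (simp add: distrib_left[symmetric])
    have "(lam * \<H> y (p\<^sub>y l x y)) * (1 + \<epsilon>) \<le> v y - h y + lam * (\<epsilon> * C\<^sub>\<Upsilon>)"
      using active_supersolution[OF adm xE a] by (simp add: mult.commute mult.left_commute)
    then have "lam * \<H> y (p\<^sub>y l x y) \<le> (v y - h y + lam * (\<epsilon> * C\<^sub>\<Upsilon>)) / (1 + \<epsilon>)"
      using \<epsilon>' by (simp add: pos_le_divide_eq)
    also have "\<dots> = v y / (1 + \<epsilon>) - h y / (1 + \<epsilon>) + lam * (\<epsilon> * C\<^sub>\<Upsilon>) / (1 + \<epsilon>)"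
      by (simp add: add_divide_distrib diff_divide_distrib)
    also have "lam * (\<epsilon> * C\<^sub>\<Upsilon>) / (1 + \<epsilon>) \<le> lam * (\<epsilon> * C\<^sub>\<Upsilon>)"
    proof -
      have "0 \<le> lam * (\<epsilon> * C\<^sub>\<Upsilon>)" using lam \<epsilon> C\<^sub>\<Upsilon>0 by simp
      then have "lam * (\<epsilon> * C\<^sub>\<Upsilon>) \<le> lam * (\<epsilon> * C\<^sub>\<Upsilon>) * (1 + \<epsilon>)" using \<epsilon> by (simp add: distrib_left)
      then show ?thesis using \<epsilon>' by (simp add: pos_divide_le_eq)
    qed
    finally have 2: "lam * \<H> y (p\<^sub>y l x y) \<le> v y / (1 + \<epsilon>) - h y / (1 + \<epsilon>) + lam * (\<epsilon> * C\<^sub>\<Upsilon>)" by simp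
    have "\<bar>h y - h x\<bar> < (1 - \<epsilon>) * (\<eta> / 4)"
      using r\<^sub>2(2)[OF yE] d unfolding dist_real_def by (simp only: dist_commute min_less_iff_conj)
    then have "h x - h y < (1 - \<epsilon>) * (\<eta> / 4)" by linarith
    then have "(h x - h y) / (1 - \<epsilon>) < \<eta> / 4" using \<epsilon>' by (simp add: pos_divide_less_eq mult.commute)
    then have 3: "h x / (1 - \<epsilon>) < h y / (1 - \<epsilon>) + \<eta> / 4" unfolding diff_divide_distrib by linarith
    have "1 / (1 + \<epsilon>) \<le> 1 / (1 - \<epsilon>)" using \<epsilon> by (intro divide_left_mono) auto
    then have "h y * (1 / (1 - \<epsilon>) - 1 / (1 + \<epsilon>)) \<le> Bh * (1 / (1 - \<epsilon>) - 1 / (1 + \<epsilon>))"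
      using Bh[OF yE] by (intro mult_right_mono) auto
    then have 4: "h y / (1 - \<epsilon>) - h y / (1 + \<epsilon>) \<le> Bh * (1 / (1 - \<epsilon>) - 1 / (1 + \<epsilon>))"
      by (simp add: right_diff_distrib)
    show False using ge 1 2 3 4 small \<eta> unfolding excess_def by linarith
  qed
  then show ?thesis using r\<^sub>1(1) r\<^sub>2(1) by (intro exI[of _ "min r\<^sub>1 r\<^sub>2"]) auto
qed

text \<open>An active penalty touches the infimum from above, so a superjet exists even where there
  is no subjet. One suitable superjet per point suffices, and at bad points the crude bound
  \<open>C\<^sub>5\<close> takes the place of \<eta>.\<close>

lemma g_touching:
  assumes L: "admissible L" and x: "x \<in> K" and \<eta>: "0 \<le> \<eta>" and C5: "0 \<le> C\<^sub>5"
    and upper: "\<And>l y. active L l x y \<Longrightarrow> excess l x y \<le> C\<^sub>5"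
  shows "\<exists>q\<in>superjet E (g L) x. lam * \<H> x q + h x / (1 - \<epsilon>) \<le> g L x + (\<eta> + C\<^sub>5 * indicator (bad_points \<eta> L) x)"
proof -
  have xE: "x \<in> E" using x K by blast
  have rhs: "0 \<le> \<eta> + C\<^sub>5 * indicator (bad_points \<eta> L) x" using \<eta> C5 by (simp add: indicator_def)
  consider "g L x = B" | l y where "l \<in> L" "y \<in> K" "g L x = vh y + P l x y"
    using g_attained[OF L xE] by blast
  then show ?thesis
  proof cases
    case 1
    have "0 \<in> superjet E (g L) x"
      by (rule superjet_mono[OF superjet_const[of E B]]) (use g_le_B[OF L] 1 in auto)
    moreover have "h x / (1 - \<epsilon>) \<le> B"
      using Bh[OF xE] B_h \<epsilon>' divide_right_mono[of "h x" Bh "1 - \<epsilon>"] by linarith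
    moreover have "lam * \<H> x 0 \<le> 0" using lam Ham_zero[OF xE] by (simp add: mult_le_0_iff)
    ultimately show ?thesis using 1 rhs by (intro bexI[of _ 0]) auto
  next
    case 2
    have yE: "y \<in> E" using 2 K by blast
    have a: "active L l x y" using 2 by (simp add: active_def)
    have "p\<^sub>x l x y \<in> superjet E (g L) x"
    proof (rule superjet_mono[OF penalty_superjet1[OF xE yE]])
      fix z assume "z \<in> E"
      then show "g L z - g L x \<le> P l z y - P l x y" using g_le[OF L _ 2(1) yE, of z] 2(3) by linarith
    qed
    moreover have "excess l x y \<le> \<eta> + C\<^sub>5 * indicator (bad_points \<eta> L) x"
    proof (cases "x \<in> bad_points \<eta> L")
      case True
      then show ?thesis using upper[OF a] \<eta> by simp
    next
      case False
      then have "\<not> \<eta> \<le> excess l x y" using x a unfolding bad_points_def by blast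
      then show ?thesis using False by simp
    qed
    moreover have "v y / (1 + \<epsilon>) \<le> g L x" using vh_ge[OF yE] active_minimal(4)[OF L xE a] by linarith
    ultimately show ?thesis unfolding excess_def by (intro bexI[of _ "p\<^sub>x l x y"]) auto
  qed
qed

text \<open>At a maximum of \<open>u - \<epsilon> \<Upsilon>\<close> minus \<open>1 - \<epsilon>\<close> times a convex combination of inf-convolutions, the test gradient
  is \<open>\<epsilon> \<nabla>\<Upsilon> + (1 - \<epsilon>) (\<Sum>k. w k *\<^sub>R q k)\<close>, and convexity of \<open>\<H>\<close> splits it.\<close>

lemma combination_estimate:
  fixes N :: nat
  assumes Lk: "\<And>k. admissible (Lk k)" and x1: "x\<^sub>1 \<in> K"
    and w: "\<And>k. 0 \<le> w k" "(\<Sum>k<N. w k) = 1"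
    and pos: "0 < u x\<^sub>1 - \<epsilon> * \<Upsilon> x\<^sub>1 - (1 - \<epsilon>) * vh x\<^sub>1"
    and touch: "\<And>k x. x \<in> K \<Longrightarrow> \<exists>q\<in>superjet E (g (Lk k)) x. lam * \<H> x q + h x / (1 - \<epsilon>) \<le> g (Lk k) x + s k x"
    and s: "\<And>x. x \<in> K \<Longrightarrow> (\<Sum>k<N. w k * s k x) \<le> c"
  shows "u x\<^sub>1 - \<epsilon> * \<Upsilon> x\<^sub>1 - (1 - \<epsilon>) * vh x\<^sub>1 \<le> lam * (\<epsilon> * C\<^sub>\<Upsilon>) + (1 - \<epsilon>) * c"
proof -
  define W where "W x = (\<Sum>k<N. w k * g (Lk k) x)" for x
  have x1E: "x\<^sub>1 \<in> E" using x1 K by blast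
  have usc: "usc_on E u" using u_sub by (simp add: viscosity_subsolution_def)
  have "continuous_on K (\<lambda>x. - (\<epsilon> * \<Upsilon> x) - (1 - \<epsilon>) * W x)"
    unfolding W_def by (intro continuous_intros continuous_g Lk continuous_on_subset[OF continuous_Upsilon K(2)])
  from usc_on_attains_max[OF usc K _ this] x1 obtain x where x: "x \<in> K"
    "\<And>z. z \<in> K \<Longrightarrow> u z + (- (\<epsilon> * \<Upsilon> z) - (1 - \<epsilon>) * W z) \<le> u x + (- (\<epsilon> * \<Upsilon> x) - (1 - \<epsilon>) * W x)"
    by blast
  have xE: "x \<in> E" using x K by blast
  have "W x\<^sub>1 \<le> (\<Sum>k<N. w k * vh x\<^sub>1)"
    unfolding W_def using w g_le_vh[OF Lk x1E] by (intro sum_mono mult_left_mono) auto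
  also have "\<dots> = vh x\<^sub>1" using w(2) by (simp add: sum_distrib_right[symmetric])
  finally have "(1 - \<epsilon>) * W x\<^sub>1 \<le> (1 - \<epsilon>) * vh x\<^sub>1" using \<epsilon>' by (intro mult_left_mono) auto
  then have big: "u x\<^sub>1 - \<epsilon> * \<Upsilon> x\<^sub>1 - (1 - \<epsilon>) * vh x\<^sub>1 \<le> u x - \<epsilon> * \<Upsilon> x - (1 - \<epsilon>) * W x"
    using x(2)[OF x1] by linarith
  have Wge: "- Bv \<le> W z" if "z \<in> E" for z
  proof -
    have "(\<Sum>k<N. w k * - Bv) \<le> W z"
      unfolding W_def using w g_ge[OF Lk that] by (intro sum_mono mult_left_mono) auto
    then show ?thesis using w(2) by (simp add: sum_distrib_right[symmetric] sum_negf)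
  qed
  \<comment> \<open>The maximum over \<open>K\<close> is global: outside \<open>K\<close> the term
    with \<Upsilon> makes the value nonpositive by the choice of \<open>R\<close>, while the value
    at \<open>x\<close> is positive.\<close>
  have max: "u z - \<epsilon> * \<Upsilon> z - (1 - \<epsilon>) * W z \<le> u x - \<epsilon> * \<Upsilon> x - (1 - \<epsilon>) * W x" if z: "z \<in> E" for z
  proof (cases "z \<in> K")
    case True
    then show ?thesis using x(2)[OF True] by linarith
  next
    case False
    then have "\<epsilon> * R \<le> \<epsilon> * \<Upsilon> z" using z \<epsilon> by (simp add: K_def)
    moreover have "(1 - \<epsilon>) * - Bv \<le> (1 - \<epsilon>) * W z" using Wge[OF z] \<epsilon>' by (intro mult_left_mono) auto
    moreover have "- Bv \<le> (1 - \<epsilon>) * - Bv" using B0(2) \<epsilon> by (simp add: algebra_simps)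
    ultimately show ?thesis using Bu[OF z] R_x big pos by linarith
  qed
  have "\<forall>k. \<exists>q. q \<in> superjet E (g (Lk k)) x \<and> lam * \<H> x q + h x / (1 - \<epsilon>) \<le> g (Lk k) x + s k x"
    using touch[OF x(1)] by blast
  then obtain q where q: "\<And>k. q k \<in> superjet E (g (Lk k)) x"
    "\<And>k. lam * \<H> x (q k) + h x / (1 - \<epsilon>) \<le> g (Lk k) x + s k x" by metis
  define Q where "Q = (\<Sum>k<N. w k *\<^sub>R q k)"
  define p where "p = (1 - \<epsilon>) *\<^sub>R Q + \<epsilon> *\<^sub>R gradient_on E \<Upsilon> x"
  have "Q \<in> superjet E W x" unfolding Q_def W_def by (rule superjet_sum) (use w q in auto)
  then have "p \<in> superjet E (\<lambda>z. (1 - \<epsilon>) * W z + \<epsilon> * \<Upsilon> z) x"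
    unfolding p_def using \<epsilon> by (intro superjet_add superjet_scaleR Upsilon_superjet xE) auto
  then have "p \<in> superjet E u x"
    by (rule superjet_mono) (use max in \<open>fastforce\<close>)
  moreover obtain r where "0 < r" "compact (E \<inter> cball x r)" using compact_neighbourhood[OF xE] by blast
  moreover have "viscosity_subsolution E (Ccc_inf E) (\<lambda>f x. \<H> x (gradient_on E f x)) lam h u"
    using u_sub by (simp add: Ham_op_def[abs_def])
  ultimately have sub: "u x \<le> lam * \<H> x p + h x"
    by (intro subsolution_superjet[OF E_interior _ Ham_continuous h_cont xE])
  have "\<H> x p \<le> (1 - \<epsilon>) * \<H> x Q + \<epsilon> * \<H> x (gradient_on E \<Upsilon> x)"
    unfolding p_def using \<epsilon> by (intro convex_onD[OF Ham_convex[OF xE]]) auto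
  also have "\<H> x Q \<le> (\<Sum>k<N. w k * \<H> x (q k))"
    unfolding Q_def
  proof (rule convex_on_sum[OF _ _ Ham_convex[OF xE]])
    show "{..<N} \<noteq> {}" using w(2) by (metis sum.empty zero_neq_one)
  qed (use w in simp_all)
  finally have "\<H> x p \<le> (1 - \<epsilon>) * (\<Sum>k<N. w k * \<H> x (q k)) + \<epsilon> * C\<^sub>\<Upsilon>"
    using C\<^sub>\<Upsilon>[OF xE] \<epsilon> by (smt (verit) mult_left_mono)
  then have "lam * \<H> x p \<le> lam * ((1 - \<epsilon>) * (\<Sum>k<N. w k * \<H> x (q k)) + \<epsilon> * C\<^sub>\<Upsilon>)"
    using lam by (intro mult_left_mono) auto
  also have "\<dots> = (1 - \<epsilon>) * (\<Sum>k<N. w k * (lam * \<H> x (q k))) + lam * (\<epsilon> * C\<^sub>\<Upsilon>)"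
    by (simp add: distrib_left sum_distrib_left mult.left_commute)
  also have "(\<Sum>k<N. w k * (lam * \<H> x (q k))) \<le> (\<Sum>k<N. w k * (g (Lk k) x + s k x - h x / (1 - \<epsilon>)))"
    using w q(2) by (intro sum_mono mult_left_mono) (auto simp: le_diff_eq)
  also have "\<dots> = W x + (\<Sum>k<N. w k * s k x) - h x / (1 - \<epsilon>)"
  proof -
    have "(\<Sum>k<N. w k * (g (Lk k) x + s k x - h x / (1 - \<epsilon>))) =
        W x + (\<Sum>k<N. w k * s k x) - (\<Sum>k<N. w k) * (h x / (1 - \<epsilon>))"
      unfolding W_def sum_distrib_right by (simp only: distrib_left right_diff_distrib sum.distrib sum_subtractf)
    then show ?thesis using w(2) by simp
  qed
  also have "\<dots> \<le> W x + c - h x / (1 - \<epsilon>)" using s[OF x(1)] by linarith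
  finally have "lam * \<H> x p \<le> (1 - \<epsilon>) * (W x + c - h x / (1 - \<epsilon>)) + lam * (\<epsilon> * C\<^sub>\<Upsilon>)"
    using \<epsilon>' by (simp add: mult_left_mono)
  \<comment> \<open>The factor \<open>1 - \<epsilon>\<close> cancels the divisor of
    \<open>h\<close>, so exactly the \<open>h x\<close> of the subsolution inequality is
    removed.\<close>
  also have "(1 - \<epsilon>) * (W x + c - h x / (1 - \<epsilon>)) = (1 - \<epsilon>) * W x + (1 - \<epsilon>) * c - h x"
    using \<epsilon>' by (simp add: distrib_left right_diff_distrib)
  finally have "u x \<le> (1 - \<epsilon>) * W x + (1 - \<epsilon>) * c + lam * (\<epsilon> * C\<^sub>\<Upsilon>)" using sub by linarith
  moreover have "0 \<le> \<epsilon> * \<Upsilon> x" using Upsilon_nonneg[OF xE] \<epsilon> by simp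
  ultimately show ?thesis using big by linarith
qed

end

section \<open>Contradiction from a positive gap\<close>

context hamiltonian
begin

text \<open>More than \<open>\<gamma> / 2\<close> of the gap survives the perturbation, whereas the
  combination leaves at most \<open>\<eta> + C\<^sub>5 * \<delta>\<close>, that is
  \<open>3 * \<gamma> / 8\<close>. The bounds \<open>M\<close> and \<open>C\<^sub>5\<close> are
  common to all \<open>k\<close>, so \<delta> can be fixed before the weights are chosen.\<close>

lemma comparison_principle_Ham_op:
  assumes pen: "penalization_pair E \<Psi>\<^sub>1 \<Psi>\<^sub>2" and ue: "uniform_estimate E \<Psi>\<^sub>1 \<Psi>\<^sub>2 \<Lambda>"
    and h: "h \<in> Cb E" and lam: "0 < lam"
  shows "comparison_principle E (Ccc_inf E) (Ham_op E \<Lambda> \<I>) lam h"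
  unfolding comparison_principle_def
proof (intro allI impI ballI, rule ccontr)
  fix u v x\<^sub>1
  assume u: "viscosity_subsolution E (Ccc_inf E) (Ham_op E \<Lambda> \<I>) lam h u"
    and v: "viscosity_supersolution E (Ccc_inf E) (Ham_op E \<Lambda> \<I>) lam h v"
    and x1: "x\<^sub>1 \<in> E" and "\<not> u x\<^sub>1 \<le> v x\<^sub>1"
  define \<gamma> where "\<gamma> = u x\<^sub>1 - v x\<^sub>1"
  have \<gamma>: "0 < \<gamma>" using \<open>\<not> u x\<^sub>1 \<le> v x\<^sub>1\<close> by (simp add: \<gamma>_def)
  obtain C\<^sub>\<Upsilon> where C\<^sub>\<Upsilon>: "0 \<le> C\<^sub>\<Upsilon>" "\<And>x. x \<in> E \<Longrightarrow> \<H> x (gradient_on E \<Upsilon> x) \<le> C\<^sub>\<Upsilon>" using Ham_Upsilon_bounded by blast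
  obtain Bh where Bh: "\<And>x. x \<in> E \<Longrightarrow> \<bar>h x\<bar> \<le> Bh" using h unfolding Cb_def bounded_iff by auto
  have Bh0: "0 \<le> Bh" using Bh[OF x1] by linarith
  obtain Bu where Bu: "\<And>x. x \<in> E \<Longrightarrow> u x \<le> Bu"
    using u unfolding viscosity_subsolution_def bdd_above_def by auto
  obtain m where m: "\<And>x. x \<in> E \<Longrightarrow> m \<le> v x"
    using v unfolding viscosity_supersolution_def bdd_below_def by auto
  define Bv where "Bv = max 0 (- m)"
  have Bv: "0 \<le> Bv" "\<And>x. x \<in> E \<Longrightarrow> - Bv \<le> v x" using m by (force simp: Bv_def)+
  define \<eta> where "\<eta> = \<gamma> / 4"
  have \<eta>: "0 < \<eta>" using \<gamma> by (simp add: \<eta>_def)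
  have "((\<lambda>e. u x\<^sub>1 - e * \<Upsilon> x\<^sub>1 - (1 - e) * ((v x\<^sub>1 + e * \<Upsilon> x\<^sub>1) / (1 + e)) - lam * (e * C\<^sub>\<Upsilon>)) \<longlongrightarrow> \<gamma>) (at_right 0)"
    unfolding \<gamma>_def by (auto intro!: tendsto_eq_intros)
  moreover have "\<gamma> / 2 < \<gamma>" using \<gamma> by simp
  ultimately have ev1: "\<forall>\<^sub>F e in at_right 0.
      \<gamma> / 2 < u x\<^sub>1 - e * \<Upsilon> x\<^sub>1 - (1 - e) * ((v x\<^sub>1 + e * \<Upsilon> x\<^sub>1) / (1 + e)) - lam * (e * C\<^sub>\<Upsilon>)"
    by (rule order_tendstoD(1))
  have "((\<lambda>e. Bh * (1 / (1 - e) - 1 / (1 + e)) + lam * (e * C\<^sub>\<Upsilon>)) \<longlongrightarrow> 0) (at_right 0)"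
    by (auto intro!: tendsto_eq_intros)
  moreover have "0 < \<eta> / 4" using \<eta> by simp
  ultimately have ev2: "\<forall>\<^sub>F e in at_right 0. Bh * (1 / (1 - e) - 1 / (1 + e)) + lam * (e * C\<^sub>\<Upsilon>) < \<eta> / 4"
    by (rule order_tendstoD(2))
  have "\<forall>\<^sub>F e in at_right (0::real). e \<in> {0<..<1}" by (rule eventually_at_right_real) simp
  with ev1 ev2 have "\<forall>\<^sub>F e in at_right 0. e \<in> {0<..<1} \<and>
      \<gamma> / 2 < u x\<^sub>1 - e * \<Upsilon> x\<^sub>1 - (1 - e) * ((v x\<^sub>1 + e * \<Upsilon> x\<^sub>1) / (1 + e)) - lam * (e * C\<^sub>\<Upsilon>) \<and>
      Bh * (1 / (1 - e) - 1 / (1 + e)) + lam * (e * C\<^sub>\<Upsilon>) < \<eta> / 4"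
    by eventually_elim simp
  then obtain \<epsilon> where \<epsilon>: "0 < \<epsilon>" "\<epsilon> < 1"
    and gap: "\<gamma> / 2 < u x\<^sub>1 - \<epsilon> * \<Upsilon> x\<^sub>1 - (1 - \<epsilon>) * ((v x\<^sub>1 + \<epsilon> * \<Upsilon> x\<^sub>1) / (1 + \<epsilon>)) - lam * (\<epsilon> * C\<^sub>\<Upsilon>)"
    and small: "Bh * (1 / (1 - \<epsilon>) - 1 / (1 + \<epsilon>)) + lam * (\<epsilon> * C\<^sub>\<Upsilon>) < \<eta> / 4"
    using eventually_happens'[OF trivial_limit_at_right_real] by (metis (no_types, lifting) greaterThanLessThan_iff)
  define B where "B = Bh / (1 - \<epsilon>)"
  have B: "0 \<le> B" using Bh0 \<epsilon> by (simp add: B_def)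
  \<comment> \<open>The entries give, in turn, a nonempty range of heights, \<open>x\<^sub>1\<close>
    in \<open>K\<close>, minimisers confined to \<open>K\<close> (strictly, by the
    \<open>+ 1\<close>), and maximisers confined to \<open>K\<close>.\<close>
  define R where "R = Max {0, \<Upsilon> x\<^sub>1, ((1 + \<epsilon>) * B + Bv + 1) / \<epsilon>, (Bu + Bv) / \<epsilon>}"
  have R: "0 \<le> R" "\<Upsilon> x\<^sub>1 \<le> R" "((1 + \<epsilon>) * B + Bv + 1) / \<epsilon> \<le> R" "(Bu + Bv) / \<epsilon> \<le> R"
    by (auto simp: R_def)
  have R': "(1 + \<epsilon>) * B + Bv < \<epsilon> * R" "Bu + Bv \<le> \<epsilon> * R"
    using R(3,4) \<epsilon>(1) by (simp_all add: pos_divide_le_eq mult.commute)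
  interpret c: comparison E \<Lambda> \<I> \<Upsilon> \<Psi>\<^sub>1 \<Psi>\<^sub>2 h u v lam C\<^sub>\<Upsilon> Bh Bu Bv \<epsilon> B R
    by unfold_locales (use pen h lam u v C\<^sub>\<Upsilon> Bh Bh0 Bu Bv B R R' \<epsilon> in \<open>auto simp: Cb_def B_def\<close>)
  define \<eta>\<^sub>0 where "\<eta>\<^sub>0 = \<eta> / (12 * lam)"
  have \<eta>\<^sub>0: "0 < \<eta>\<^sub>0" "lam * (3 * \<eta>\<^sub>0) \<le> \<eta> / 4" using \<eta> lam by (simp_all add: \<eta>\<^sub>0_def)
  obtain C\<^sub>4 M C where C4: "0 \<le> C\<^sub>4" "0 \<le> M" and est: "\<And>\<rho> L l x y.
      fine_penalties E \<Lambda> \<Psi>\<^sub>1 \<Psi>\<^sub>2 c.K (Theta_set \<I> c.K M) C \<eta>\<^sub>0 \<rho> (B + Bv) L \<Longrightarrow> x \<in> c.K \<Longrightarrow> c.active L l x y \<Longrightarrow>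
      \<H> x (c.p\<^sub>x l x y) \<le> C\<^sub>4 \<and>
      (\<forall>\<theta>. \<I> x \<theta> \<noteq> \<infinity> \<longrightarrow> \<H> x (c.p\<^sub>x l x y) - \<eta>\<^sub>0 < \<Lambda> x (c.p\<^sub>x l x y) \<theta> - enn2real (\<I> x \<theta>) \<longrightarrow>
        - c.C\<^sub>6 \<le> \<H> x (c.p\<^sub>x l x y) \<longrightarrow> \<I> x \<theta> \<le> ennreal M \<and> \<Lambda> x (c.p\<^sub>x l x y) \<theta> - \<Lambda> y (c.p\<^sub>y l x y) \<theta> < \<eta>\<^sub>0)"
    using c.active_estimates[OF \<eta>\<^sub>0(1)] by meson
  have "compact (Theta_set \<I> c.K M)" using I3 c.K C4(2) by blast
  then have "\<exists>L. fine_penalties E \<Lambda> \<Psi>\<^sub>1 \<Psi>\<^sub>2 c.K (Theta_set \<I> c.K M) C \<eta>\<^sub>0 (inverse (real (Suc k))) (B + Bv) L" for k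
    by (intro penalty_family[OF E_interior pen ue c.K _ \<eta>\<^sub>0(1)]) auto
  then obtain Lk where Lk: "\<And>k. fine_penalties E \<Lambda> \<Psi>\<^sub>1 \<Psi>\<^sub>2 c.K (Theta_set \<I> c.K M) C \<eta>\<^sub>0 (inverse (real (Suc k))) (B + Bv) (Lk k)"
    by metis
  have adm: "c.admissible (Lk k)" for k by (rule c.fine_admissible[OF Lk])
  define C\<^sub>5 where "C\<^sub>5 = lam * C\<^sub>4 + Bh / (1 - \<epsilon>) + Bv"
  have C5: "0 \<le> C\<^sub>5" using lam C4 Bh0 \<epsilon> Bv by (simp add: C\<^sub>5_def)
  have upper: "c.excess l x y \<le> C\<^sub>5" if "x \<in> c.K" "c.active (Lk k) l x y" for k l x y
  proof -
    have "x \<in> E" "y \<in> E" using that c.K unfolding c.active_def by auto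
    then show ?thesis unfolding C\<^sub>5_def using est[OF Lk that] by (intro c.excess_upper) auto
  qed
  define bad where "bad k = c.bad_points \<eta> (Lk k)" for k
  \<comment> \<open>Makes the contribution of the bad indices at most \<open>\<gamma> / 8\<close>;
    the \<open>+ 1\<close> guards against \<open>C\<^sub>5 = 0\<close>.\<close>
  define \<delta> where "\<delta> = \<gamma> / (8 * (C\<^sub>5 + 1))"
  have \<delta>: "0 < \<delta>" using \<gamma> C5 by (simp add: \<delta>_def)
  have C5\<delta>: "C\<^sub>5 * \<delta> \<le> \<gamma> / 8"
  proof -
    have "C\<^sub>5 * \<delta> \<le> (C\<^sub>5 + 1) * \<delta>" using \<delta> by (intro mult_right_mono) auto
    also have "\<dots> = \<gamma> / 8" using C5 by (simp add: \<delta>_def field_simps)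
    finally show ?thesis .
  qed
  have "\<exists>N w. (\<forall>k. 0 \<le> w k) \<and> (\<Sum>k<N. w k) = 1 \<and> (\<forall>x\<in>c.K. (\<Sum>k<N. w k * indicator (bad k) x) < \<delta>)"
  proof (rule small_convex_combination_of_indicators[OF c.K(1) _ _ \<delta>])
    fix k
    have "bad k \<inter> c.K = bad k" unfolding bad_def c.bad_points_def by blast
    then show "closed (bad k \<inter> c.K)" using c.closed_bad_points[OF adm] by (simp add: bad_def)
  next
    fix x assume x: "x \<in> c.K"
    from c.excess_eventually_small[OF x C4(2) \<eta>\<^sub>0(1) \<eta> less_imp_le[OF small] \<eta>\<^sub>0(2)]
    obtain r where r: "0 < r" "\<And>L l y. c.admissible L \<Longrightarrow> c.active L l x y \<Longrightarrow> dist x y < r \<Longrightarrow>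
      (\<forall>\<theta>. \<I> x \<theta> \<noteq> \<infinity> \<longrightarrow> \<H> x (c.p\<^sub>x l x y) - \<eta>\<^sub>0 < \<Lambda> x (c.p\<^sub>x l x y) \<theta> - enn2real (\<I> x \<theta>) \<longrightarrow>
        - c.C\<^sub>6 \<le> \<H> x (c.p\<^sub>x l x y) \<longrightarrow> \<I> x \<theta> \<le> ennreal M \<and> \<Lambda> x (c.p\<^sub>x l x y) \<theta> - \<Lambda> y (c.p\<^sub>y l x y) \<theta> < \<eta>\<^sub>0) \<Longrightarrow>
      c.excess l x y < \<eta>" by blast
    have "\<forall>\<^sub>F k in sequentially. inverse (real (Suc k)) < r"
      using LIMSEQ_inverse_real_of_nat r(1) by (rule order_tendstoD(2))
    then show "\<forall>\<^sub>F k in sequentially. x \<notin> bad k"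
    proof eventually_elim
      case (elim k)
      have "c.excess l x y < \<eta>" if a: "c.active (Lk k) l x y" for l y
        using r(2)[OF adm a _ conjunct2[OF est[OF Lk x a]]] c.fine_active(1)[OF Lk x a] elim by linarith
      then show ?case unfolding bad_def c.bad_points_def by (auto simp: not_le)
    qed
  qed
  then obtain N w where w: "\<And>k. 0 \<le> w k" "(\<Sum>k<N. w k) = 1" "\<And>x. x \<in> c.K \<Longrightarrow> (\<Sum>k<N. w k * indicator (bad k) x) < \<delta>"
    by blast
  have "u x\<^sub>1 - \<epsilon> * \<Upsilon> x\<^sub>1 - (1 - \<epsilon>) * c.vh x\<^sub>1 \<le> lam * (\<epsilon> * C\<^sub>\<Upsilon>) + (1 - \<epsilon>) * (\<eta> + C\<^sub>5 * \<delta>)"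
  proof (rule c.combination_estimate[OF adm _ w(1,2)])
    show "x\<^sub>1 \<in> c.K" using x1 R by (simp add: c.K_def)
    have "0 \<le> lam * (\<epsilon> * C\<^sub>\<Upsilon>)" using lam \<epsilon> C\<^sub>\<Upsilon> by simp
    then show "0 < u x\<^sub>1 - \<epsilon> * \<Upsilon> x\<^sub>1 - (1 - \<epsilon>) * c.vh x\<^sub>1" using gap \<gamma> unfolding c.vh_def by linarith
    show "\<exists>q\<in>superjet E (c.g (Lk k)) x. lam * \<H> x q + h x / (1 - \<epsilon>) \<le> c.g (Lk k) x + (\<eta> + C\<^sub>5 * indicator (bad k) x)"
      if "x \<in> c.K" for k x
      unfolding bad_def by (rule c.g_touching[OF adm that less_imp_le[OF \<eta>] C5 upper[OF that]])
    show "(\<Sum>k<N. w k * (\<eta> + C\<^sub>5 * indicator (bad k) x)) \<le> \<eta> + C\<^sub>5 * \<delta>" if "x \<in> c.K" for x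
    proof -
      have "(\<Sum>k<N. w k * (\<eta> + C\<^sub>5 * indicator (bad k) x)) = (\<Sum>k<N. w k) * \<eta> + C\<^sub>5 * (\<Sum>k<N. w k * indicator (bad k) x)"
        by (simp only: distrib_left sum.distrib sum_distrib_right sum_distrib_left mult.left_commute)
      also have "\<dots> \<le> \<eta> + C\<^sub>5 * \<delta>"
        using w(2) mult_left_mono[OF less_imp_le[OF w(3)[OF that]] C5] by simp
      finally show ?thesis .
    qed
  qed
  also have "(1 - \<epsilon>) * (\<eta> + C\<^sub>5 * \<delta>) \<le> 1 * (\<eta> + C\<^sub>5 * \<delta>)"
    using \<epsilon> \<eta> C5 \<delta> by (intro mult_right_mono) auto
  finally have "u x\<^sub>1 - \<epsilon> * \<Upsilon> x\<^sub>1 - (1 - \<epsilon>) * c.vh x\<^sub>1 - lam * (\<epsilon> * C\<^sub>\<Upsilon>) \<le> 1 * (\<eta> + C\<^sub>5 * \<delta>)"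
    by (simp only: diff_le_eq add.commute)
  with gap[folded c.vh_def] have "\<gamma> / 2 < 1 * (\<eta> + C\<^sub>5 * \<delta>)" by (rule less_le_trans)
  then show False using C5\<delta> \<gamma> unfolding mult_1 \<eta>_def by linarith
qed

end

text \<open>The first conjunct certifies the encoding: \<open>Ham\<close> is a
  \<open>real_of_ereal\<close>, which sends infinite values to 0, so finiteness is what makes it the
  actual supremum.\<close>

theorem theorem2p6:
  fixes E :: "'a::euclidean_space set"
    and \<Lambda> :: "'a \<Rightarrow> 'a \<Rightarrow> 't::polish_space \<Rightarrow> real"
    and \<I> :: "'a \<Rightarrow> 't \<Rightarrow> ennreal"
  assumes E_polish: "completely_metrizable_space (top_of_set E)" "second_countable (top_of_set E)"
    and E_interior: "E \<subseteq> closure (interior E)"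
    and Lambda1: "continuous_on (E \<times> UNIV \<times> UNIV) (\<lambda>(x, p, \<theta>). \<Lambda> x p \<theta>)"
    and Lambda2: "\<forall>x\<in>E. \<forall>\<theta>. convex_on UNIV (\<lambda>p. \<Lambda> x p \<theta>) \<and> \<Lambda> x 0 \<theta> = 0"
    and Lambda3: "\<exists>\<Upsilon>. containment_function E \<Lambda> \<Upsilon>"
    and Lambda4: "\<forall>K. compact K \<and> K \<subseteq> E \<longrightarrow>
      (\<exists>M C\<^sub>1 C\<^sub>2. 0 \<le> M \<and> 0 \<le> C\<^sub>1 \<and> 0 \<le> C\<^sub>2 \<and>
        (\<forall>x\<in>K. \<forall>p \<theta>\<^sub>1 \<theta>\<^sub>2. \<Lambda> x p \<theta>\<^sub>1 \<le> max M (C\<^sub>1 * \<Lambda> x p \<theta>\<^sub>2 + C\<^sub>2)))"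
    and Lambda5:
      "(\<exists>\<Psi>. penalization E \<Psi> \<and> continuity_estimate E \<Psi> \<Lambda>) \<or>
       (\<exists>\<Psi>\<^sub>1 \<Psi>\<^sub>2. penalization_pair E \<Psi>\<^sub>1 \<Psi>\<^sub>2 \<and> continuity_estimate_ext E \<Psi>\<^sub>1 \<Psi>\<^sub>2 \<Lambda>)"
    and I1: "lsc_on (E \<times> UNIV) (\<lambda>(x, \<theta>). \<I> x \<theta>)"
    and I2: "\<forall>x\<in>E. \<exists>\<theta>. \<I> x \<theta> = 0"
    and I3: "\<forall>K M. compact K \<and> K \<subseteq> E \<and> 0 \<le> M \<longrightarrow> compact (Theta_set \<I> K M)"
    and I4: "\<forall>x\<in>E. \<forall>M\<ge>0. \<exists>U M' C\<^sub>1' C\<^sub>2'.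
      openin (top_of_set E) U \<and> x \<in> U \<and> 0 \<le> M' \<and> 0 \<le> C\<^sub>1' \<and> 0 \<le> C\<^sub>2' \<and>
      (\<forall>y\<^sub>1\<in>U. \<forall>y\<^sub>2\<in>U. \<forall>\<theta>\<in>Theta_set \<I> {x} M.
        \<I> y\<^sub>1 \<theta> \<le> max (ennreal M') (ennreal C\<^sub>1' * \<I> y\<^sub>2 \<theta> + ennreal C\<^sub>2'))"
    and I5: "\<forall>K M. compact K \<and> K \<subseteq> E \<and> 0 \<le> M \<longrightarrow>
      (\<forall>\<epsilon>>0. \<exists>\<delta>>0. \<forall>\<theta>\<in>Omega_set \<I> K M. \<forall>x\<in>K. \<forall>y\<in>K. dist x y \<le> \<delta> \<longrightarrow>
        \<bar>enn2real (\<I> x \<theta>) - enn2real (\<I> y \<theta>)\<bar> \<le> \<epsilon>)"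
  shows
    "(\<forall>x\<in>E. \<forall>p. \<bar>Ham_ereal \<Lambda> \<I> x p\<bar> \<noteq> \<infinity>) \<and>
     (\<forall>f\<in>Ccc_inf E. continuous_on E (Ham_op E \<Lambda> \<I> f)) \<and>
     (\<forall>h\<in>Cb E. \<forall>lam>0. comparison_principle E (Ccc_inf E) (Ham_op E \<Lambda> \<I>) lam h)"
proof -
  obtain \<Upsilon> where Y: "containment_function E \<Lambda> \<Upsilon>" using Lambda3 by blast
  interpret hamiltonian E \<Lambda> \<I> \<Upsilon>
    by (rule hamiltonian.intro[OF E_interior Lambda1 Lambda2 Y Lambda4 I1 I2 I3 I4 I5])
  \<comment> \<open>Both alternatives of \<open>Lambda5\<close> take the same form here: a single
    penalization function is paired with the zero function.\<close>
  obtain \<Psi>\<^sub>1 \<Psi>\<^sub>2 where pen: "penalization_pair E \<Psi>\<^sub>1 \<Psi>\<^sub>2" and ue: "uniform_estimate E \<Psi>\<^sub>1 \<Psi>\<^sub>2 \<Lambda>"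
    using Lambda5 penalization_pair_zero uniform_estimate_single[OF E_interior]
      uniform_estimate_pair[OF E_interior] by blast
  show ?thesis
    by (intro conjI ballI allI impI Ham_ereal_finite Ham_op_continuous comparison_principle_Ham_op[OF pen ue])
qed

end
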